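(* Let $\alpha$ denote Otter's constant. If $s\in[0,1]$ satisfies $s\le\sqrt{\alpha}$, then for every $\lambda>0$, $$\limsup_{d\to\infty}\mathrm{KL}\big(\mathbb{P}^{(\lambda,s)}_d\,\big\Vert\,\mathbb{P}^{(\lambda,0)}_d\big)<\infty .$$ Consequently, for every $\lambda>0$ and $s\le\sqrt\alpha$, no one-sided test exists.
   Context: Rooted unlabeled trees: $\mathcal{X}_0=\{\bullet\}$ consists of the trivial tree. For $d\ge1$, an element $t\in\mathcal{X}_d$ is a family $t=\{N_\tau\}_{\tau\in\mathcal{X}_{d-1}}$ of non-negative integers with finite support ($N_\tau$ is the number of children of the root whose subtree is $\tau$); two such trees are equal iff all coordinates agree. Galton–Watson law: for $\mu>0$, $\mathrm{GW}^{(\mu)}_0$ is the Dirac mass at $\bullet$, and for $d\ge1$, $t=\{N_\tau\}\sim \mathrm{GW}^{(\mu)}_d$ means the $N_\tau$ are independent with $N_\tau\sim\mathrm{Poisson}(\mu\,\mathrm{GW}^{(\mu)}_{d-1}(\tau))$. Null model: $\mathbb{P}^{(\lambda,0)}_d=\mathrm{GW}^{(\lambda)}_d\otimes\mathrm{GW}^{(\lambda)}_d$ on $\mathcal{X}_d\times\mathcal{X}_d$. Correlated model $\mathbb{P}^{(\lambda,s)}_d$ ($\lambda>0$, $s\in[0,1]$): $\mathbb{P}^{(\lambda,s)}_0$ is the Dirac mass at $(\bullet,\bullet)$; for $d\ge1$, $(t,t')=(\{N_\tau\},\{N'_\tau\})\sim\mathbb{P}^{(\lambda,s)}_d$ is sampled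 as $N_\tau=\Delta_\tau+\sum_{\tau'\in\mathcal{X}_{d-1}}M_{\tau,\tau'}$, $N'_{\tau'}=\Delta'_{\tau'}+\sum_{\tau\in\mathcal{X}_{d-1}}M_{\tau,\tau'}$, where all $\Delta_\tau,\Delta'_\tau,M_{\tau,\tau'}$ are independent Poisson variables with parameters $\lambda(1-s)\mathrm{GW}^{(\lambda)}_{d-1}(\tau)$ for $\Delta_\tau,\Delta'_\tau$ and $\lambda s\,\mathbb{P}^{(\lambda,s)}_{d-1}(\tau,\tau')$ for $M_{\tau,\tau'}$. $\mathrm{KL}(P\Vert Q)=\mathbb{E}_P[\log\frac{dP}{dQ}]$. A one-sided test (for given $\lambda,s$) is a sequence of tests $\mathcal{T}_d:\mathcal{X}_d\times\mathcal{X}_d\to\{0,1\}$ with $\mathbb{P}^{(\lambda,0)}_d(\mathcal{T}_d=1)\to0$ as $d\to\infty$ and $\liminf_{d\to\infty}\mathbb{P}^{(\lambda,s)}_d(\mathcal{T}_d=1)>0$. Otter's constant $\alpha\approx0.3383219$ is the number such that the number $A_n$ of rooted unlabeled trees with $n$ nodes satisfies $A_n\sim D\,n^{-3/2}\alpha^{-n}$ for some $D>0$ (equivalently, $\alpha$ is the radius of convergence of $\sum_{n\ge1}A_nx^{n-1}$). *)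

theory Defs
  imports "HOL-Probability.Probability" "HOL-Library.Multiset"
begin

text \<open>A rooted unlabeled tree is the multiset of the subtrees hanging from the children of
  its root. A tree t = {N_tau} corresponds to the multiset in which tau has multiplicity N_tau.\<close>

datatype utree = Node "utree multiset"

abbreviation leaf :: utree where "leaf \<equiv> Node {#}"

fun children :: "utree \<Rightarrow> utree multiset" where
  "children (Node M) = M"

fun depth_le :: "nat \<Rightarrow> utree \<Rightarrow> bool" where
  "depth_le 0 (Node M) = (M = {#})"
| "depth_le (Suc d) (Node M) = (\<forall>\<tau>\<in>#M. depth_le d \<tau>)"

definition X :: "nat \<Rightarrow> utree set" where
  "X d = {t. depth_le d t}"

text \<open>The tree whose root has N tau children with subtree tau (tau ranging over A).
  (An infinitely supported family, which only occurs on a null event, is sent to the leaf.)\<close>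
definition tree_of_counts :: "utree set \<Rightarrow> (utree \<Rightarrow> nat) \<Rightarrow> utree" where
  "tree_of_counts A N = Node (\<Sum>\<tau>\<in>{\<tau>\<in>A. N \<tau> \<noteq> 0}. replicate_mset (N \<tau>) \<tau>)"

primrec nodes :: "utree \<Rightarrow> nat" where
  "nodes (Node M) = Suc (sum_mset (image_mset nodes M))"

definition num_trees :: "nat \<Rightarrow> nat" where
  "num_trees n = card {t. nodes t = n}"

definition otter_alpha :: real where
  "otter_alpha = real_of_ereal (conv_radius (\<lambda>k. real (num_trees (Suc k))))"

definition pois :: "real \<Rightarrow> nat pmf" where
  "pois r = (if r > 0 then poisson_pmf r else return_pmf 0)"

fun GW :: "real \<Rightarrow> nat \<Rightarrow> utree measure" where
  "GW \<mu> 0 = return (count_space UNIV) leaf"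
| "GW \<mu> (Suc d) =
     distr (PiM (X d) (\<lambda>\<tau>. measure_pmf (pois (\<mu> * measure (GW \<mu> d) {\<tau>}))))
           (count_space UNIV) (tree_of_counts (X d))"

definition Pnull :: "real \<Rightarrow> nat \<Rightarrow> (utree \<times> utree) measure" where
  "Pnull lam d = GW lam d \<Otimes>\<^sub>M GW lam d"

text \<open>Indices of the independent Poisson variables of the correlated model:
  Inl tau ~ Delta_tau, Inr (Inl tau') ~ Delta'_tau', Inr (Inr (tau,tau')) ~ M_(tau,tau').\<close>
type_synonym cidx = "utree + utree + utree \<times> utree"

definition cidx_set :: "nat \<Rightarrow> cidx set" where
  "cidx_set d = Inl ` X d \<union> Inr ` Inl ` X d \<union> Inr ` Inr ` (X d \<times> X d)"

definition corr_pair :: "nat \<Rightarrow> (cidx \<Rightarrow> nat) \<Rightarrow> utree \<times> utree" where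
  "corr_pair d F =
     (tree_of_counts (X d)
        (\<lambda>\<tau>. F (Inl \<tau>) + (\<Sum>\<tau>'\<in>{\<tau>'\<in>X d. F (Inr (Inr (\<tau>, \<tau>'))) \<noteq> 0}. F (Inr (Inr (\<tau>, \<tau>'))))),
      tree_of_counts (X d)
        (\<lambda>\<tau>'. F (Inr (Inl \<tau>')) + (\<Sum>\<tau>\<in>{\<tau>\<in>X d. F (Inr (Inr (\<tau>, \<tau>'))) \<noteq> 0}. F (Inr (Inr (\<tau>, \<tau>'))))))"

fun Pcorr :: "real \<Rightarrow> real \<Rightarrow> nat \<Rightarrow> (utree \<times> utree) measure" where
  "Pcorr lam s 0 = return (count_space UNIV) (leaf, leaf)"
| "Pcorr lam s (Suc d) =
     distr (PiM (cidx_set d)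
              (\<lambda>i. measure_pmf (pois
                 (case i of
                    Inl \<tau> \<Rightarrow> lam * (1 - s) * measure (GW lam d) {\<tau>}
                  | Inr (Inl \<tau>') \<Rightarrow> lam * (1 - s) * measure (GW lam d) {\<tau>'}
                  | Inr (Inr p) \<Rightarrow> lam * s * measure (Pcorr lam s d) {p}))))
           (count_space UNIV) (corr_pair d)"

text \<open>KL(P||Q) = E_P[log dP/dQ] for discrete laws (p, q the point masses), with value +infinity
  if P is not absolutely continuous w.r.t. Q; the expectation is split into positive and
  negative parts (the negative part is always finite).\<close>
definition KL :: "'a measure \<Rightarrow> 'a measure \<Rightarrow> ereal" where
  "KL P Q =
     (let p = (\<lambda>x. measure P {x}); q = (\<lambda>x. measure Q {x}); S = {x. p x > 0} in
      if (\<exists>x\<in>S. q x = 0) then \<infinity>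
      else enn2ereal (\<Sum>\<^sub>\<infinity>x\<in>S. ennreal (p x * max 0 (ln (p x / q x))))
         - enn2ereal (\<Sum>\<^sub>\<infinity>x\<in>S. ennreal (p x * max 0 (- ln (p x / q x)))))"

definition one_sided_test :: "real \<Rightarrow> real \<Rightarrow> (nat \<Rightarrow> utree \<times> utree \<Rightarrow> bool) \<Rightarrow> bool" where
  "one_sided_test lam s T \<longleftrightarrow>
     (\<lambda>d. measure (Pnull lam d) {x. T d x}) \<longlonglongrightarrow> 0 \<and>
     liminf (\<lambda>d. ereal (measure (Pcorr lam s d) {x. T d x})) > 0"

end

theory Submission
  imports Defs "HOL-Combinatorics.Multiset_Permutations"
begin

text \<open>
  Write \<open>K\<close> for the kernel \<open>P(t, t') / p(t)\<close>, where \<open>p\<close> and \<open>P\<close> are the point masses of the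
  Galton--Watson law and of the correlated law at depth \<open>d\<close>. As \<open>P\<close> is symmetric, the second moment
  of the likelihood ratio under the null model is the trace of \<open>K\<^sup>2\<close>. By induction on the depth, the
  trace of \<open>K\<^sup>m\<close> is at most \<open>\<Phi>(s\<^sup>m)\<close> for all \<open>m \<ge> 1\<close>, where \<open>\<Phi>(x)\<close> is the sum of
  \<open>x ^ (nodes t - 1)\<close> over all trees \<open>t\<close>.

  For the induction step, replace the Poisson families by \<open>n\<close> independent slots, each empty or
  containing a subtree. A slot keeps its content with probability \<open>s\<close>, a subtree being moved by \<open>K\<close>,
  and is resampled otherwise. The \<open>m\<close>-th power of this slot kernel has trace at most
  \<open>1 + s\<^sup>m tr K\<^sup>m\<close>, hence at most the sum of the \<open>m\<close>-th powers of the numbers \<open>1\<close> and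
  \<open>s ^ nodes g\<close>. The trace of a symmetric power of a kernel is a monotone function of the
  traces of the powers of the kernel, so the \<open>n\<close> unlabelled slots can be compared with a diagonal
  kernel, for which the trace is a sum over multisets of trees, i.e. over trees. Letting \<open>n\<close> tend to
  infinity, Fatou's lemma transfers the bound to the next depth.

  It remains to see that \<open>\<Phi>\<close> is finite at its radius of convergence. Trees whose root has two
  children give \<open>(x \<Phi>(x))\<^sup>2 \<le> 2 \<Phi>(x)\<close>, hence \<open>\<Phi>(x) \<le> 2 / x\<^sup>2\<close> below the radius.
\<close>

section \<open>Unordered sums of extended nonnegative reals\<close>

text \<open>Traces stand in for eigenvalues: no compactness or diagonalisation of \<open>K\<close>
  has to be established, and in \<open>ennreal\<close> every trace exists without a convergence
  argument. All powers are carried along because the trace of a symmetric power is Polya's cycle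
  index, a polynomial with nonnegative coefficients in the traces of all powers; a bound on
  \<open>K\<^sup>2\<close> alone would not propagate to the next depth. The numbers
  \<open>s ^ nodes g\<close> arise as follows: the factor \<open>x\<close> of a kept slot turns the
  weight \<open>x ^ (nodes g - 1)\<close> of a subtree into \<open>x ^ nodes g\<close>, and a
  multiset of such weights multiplies to the weight of the tree having these subtrees. So the
  functional equation of \<Phi> closes the induction with no loss. Finitely many slots make
  symmetric powers available; the price is that Fatou's lemma yields only inequalities, which is why
  row and column sums are carried as inequalities. The final bound \<Phi>(s^2) involves neither the
  depth nor \<open>lam\<close>. It controls the KL divergence because a logarithm is at most its
  argument, and it excludes tests by truncating the likelihood ratio.\<close>

abbreviation tsum :: "('a \<Rightarrow> ennreal) \<Rightarrow> ennreal" (binder \<open>\<Sum>\<^sup>+\<close> 10) where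
  "tsum f \<equiv> integral\<^sup>N (count_space UNIV) f"

lemma tsum_pair: "(\<Sum>\<^sup>+x. \<Sum>\<^sup>+y. f x y) = (\<Sum>\<^sup>+z. f (fst z) (snd z))"
  using nn_integral_fst_count_space[of "\<lambda>z. f (fst z) (snd z)"] by simp

lemma tsum_swap: "(\<Sum>\<^sup>+x. \<Sum>\<^sup>+y. f x y) = (\<Sum>\<^sup>+y. \<Sum>\<^sup>+x. f x y)"
  using nn_integral_fst_count_space[of "\<lambda>z. f (fst z) (snd z)"]
    nn_integral_snd_count_space[of "\<lambda>z. f (fst z) (snd z)"] by simp

lemma tsum_finite:
  assumes "finite A" "\<And>x. x \<notin> A \<Longrightarrow> f x = 0"
  shows "(\<Sum>\<^sup>+x. f x) = (\<Sum>x\<in>A. f x)"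
  using assms by (intro nn_integral_count_space') auto

lemma tsum_if_finite:
  assumes "finite A"
  shows "(\<Sum>\<^sup>+x. if x \<in> A then f x else 0) = (\<Sum>x\<in>A. f x)"
  using assms by (subst tsum_finite[of A]) auto

lemma tsum_single [simp]:
  "(\<Sum>\<^sup>+x. if x = a then f x else 0) = f a" "(\<Sum>\<^sup>+x. if a = x then f x else 0) = f a"
  by (subst tsum_finite[of "{a}"]; simp)+

text \<open>Grouping by the value of \<open>g\<close>. With \<open>g = mset\<close> this is the
  passage between ordered and unordered configurations, used in both directions.\<close>

lemma tsum_fibre: "(\<Sum>\<^sup>+x. f x) = (\<Sum>\<^sup>+y. \<Sum>\<^sup>+x. if g x = y then f x else 0)"
  by (subst tsum_swap) simp

lemma tsum_cmult: "(\<Sum>\<^sup>+x. c * f x) = c * (\<Sum>\<^sup>+x. f x)" for c :: ennreal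
  by (rule nn_integral_cmult) simp

lemma tsum_multc: "(\<Sum>\<^sup>+x. f x * c) = (\<Sum>\<^sup>+x. f x) * c" for c :: ennreal
  by (rule nn_integral_multc) simp

lemma tsum_add: "(\<Sum>\<^sup>+x. f x + g x) = (\<Sum>\<^sup>+x. f x) + (\<Sum>\<^sup>+x. g x)"
  by (rule nn_integral_add) simp_all

lemma tsum_mono: "(\<And>x. f x \<le> g x) \<Longrightarrow> (\<Sum>\<^sup>+x. f x) \<le> (\<Sum>\<^sup>+x. g x)"
  by (rule nn_integral_mono) simp

lemma tsum_inj_eq:
  assumes "inj g"
  shows "(\<Sum>\<^sup>+x. f (g x)) = (\<Sum>\<^sup>+y. f y * indicator (range g) y)"
  using nn_integral_count_compose_inj[of g UNIV f] assms by simp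

lemma tsum_inj_le:
  assumes "inj g"
  shows "(\<Sum>\<^sup>+x. f (g x)) \<le> (\<Sum>\<^sup>+y. f y)"
  unfolding tsum_inj_eq[OF assms] by (intro tsum_mono) (auto split: split_indicator)

lemma tsum_bij:
  assumes "bij g"
  shows "(\<Sum>\<^sup>+x. f (g x)) = (\<Sum>\<^sup>+y. f y)"
  using assms by (intro nn_integral_bij_count_space)

lemma tsum_split:
  assumes "inj g" "inj h" "range g \<inter> range h = {}" "range g \<union> range h = UNIV"
  shows "(\<Sum>\<^sup>+y. f y) = (\<Sum>\<^sup>+x. f (g x)) + (\<Sum>\<^sup>+x. f (h x))"
proof -
  have "(\<Sum>\<^sup>+y. f y) = (\<Sum>\<^sup>+y. f y * indicator (range g) y + f y * indicator (range h) y)"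
  proof (intro nn_integral_cong)
    fix y
    have "y \<in> range g \<and> y \<notin> range h \<or> y \<notin> range g \<and> y \<in> range h" using assms(3,4) by blast
    then show "f y = f y * indicator (range g) y + f y * indicator (range h) y"
      by (auto simp del: rangeI image_iff)
  qed
  then show ?thesis by (simp add: tsum_add tsum_inj_eq assms)
qed

lemma tsum_unit: "(\<Sum>\<^sup>+x::unit. f x) = f ()"
  by (subst tsum_finite[of UNIV]) (auto simp: UNIV_unit)

lemma tsum_list: "(\<Sum>\<^sup>+xs. f xs) = f [] + (\<Sum>\<^sup>+x. \<Sum>\<^sup>+xs. f (x # xs))"
proof -
  have "range (\<lambda>_::unit. []) \<union> range (\<lambda>z. fst z # snd z) = (UNIV :: 'a list set)"
  proof (intro set_eqI)
    fix xs :: "'a list"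
    show "xs \<in> range (\<lambda>_::unit. []) \<union> range (\<lambda>z. fst z # snd z) \<longleftrightarrow> xs \<in> UNIV"
      by (cases xs) (auto simp: image_iff)
  qed
  then have "(\<Sum>\<^sup>+xs. f xs) = (\<Sum>\<^sup>+x::unit. f []) + (\<Sum>\<^sup>+z. f (fst z # snd z))"
    by (intro tsum_split) (auto simp: inj_def)
  then show ?thesis by (subst tsum_pair) (simp add: tsum_unit)
qed

lemma tsum_option: "(\<Sum>\<^sup>+y. f y) = f None + (\<Sum>\<^sup>+x. f (Some x))"
proof -
  have "(\<Sum>\<^sup>+y. f y) = (\<Sum>\<^sup>+x::unit. f None) + (\<Sum>\<^sup>+x. f (Some x))"
    by (intro tsum_split) (auto simp: inj_def notin_range_Some)
  then show ?thesis by (simp add: tsum_unit)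
qed

lemma tsum_plus: "(\<Sum>\<^sup>+y. f y) = (\<Sum>\<^sup>+x. f (Inl x)) + (\<Sum>\<^sup>+x. f (Inr x))"
  by (intro tsum_split) (auto simp: inj_def UNIV_sum)

lemma tsum_liminf: "(\<Sum>\<^sup>+x. liminf (\<lambda>n. f n x)) \<le> liminf (\<lambda>n. \<Sum>\<^sup>+x. f n x)"
  by (rule nn_integral_liminf) simp

lemma tsum_ge: "f x \<le> (\<Sum>\<^sup>+x. f x)"
  using nn_integral_ge_point[of x UNIV f] by simp

section \<open>Otter's series\<close>

lemma nodes_pos: "0 < nodes t"
  by (cases t) simp

lemma nodes_child: "x \<in># M \<Longrightarrow> nodes x < nodes (Node M)"
  by (auto dest!: multi_member_split)

lemma size_le_nodes: "size M < nodes (Node M)"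
proof -
  have "size M \<le> sum_mset (image_mset nodes M)"
  proof (induction M)
    case (add x M)
    then show ?case using nodes_pos[of x] by simp
  qed simp
  then show ?thesis by simp
qed

text \<open>At most \<open>n\<close> children with at most \<open>n\<close> nodes each leave
  finitely many child lists. Finiteness matters twice: \<open>num_trees\<close> is a
  \<open>card\<close>, which would default to 0 on an infinite set, and the countability of
  \<open>utree\<close> rests on it.\<close>

lemma finite_nodes_le: "finite {t. nodes t \<le> n}"
proof (induction n)
  case 0
  have "{t. nodes t \<le> 0} = {}" using nodes_pos by (auto simp: neq0_conv[symmetric] simp del: neq0_conv)
  then show ?case by (simp only: finite.emptyI)
next
  case (Suc n)
  have "{t. nodes t \<le> Suc n} \<subseteq> (\<lambda>xs. Node (mset xs)) ` {xs. set xs \<subseteq> {t. nodes t \<le> n} \<and> length xs \<le> n}"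
  proof
    fix t assume t: "t \<in> {t. nodes t \<le> Suc n}"
    obtain M where M: "t = Node M" by (cases t)
    obtain xs where xs: "mset xs = M" using ex_mset by blast
    have "nodes x \<le> n" if "x \<in> set xs" for x
      using nodes_child[of x M] that xs t M by (auto simp del: nodes.simps)
    moreover have "length xs \<le> n"
      using size_le_nodes[of M] xs t M by (auto simp del: nodes.simps)
    ultimately show "t \<in> (\<lambda>xs. Node (mset xs)) ` {xs. set xs \<subseteq> {t. nodes t \<le> n} \<and> length xs \<le> n}"
      using M xs by auto
  qed
  moreover have "finite {xs. set xs \<subseteq> {t. nodes t \<le> n} \<and> length xs \<le> n}"
    using Suc finite_lists_length_le by blast
  ultimately show ?case by (meson finite_imageI finite_subset)
qed

lemma finite_nodes_eq: "finite {t. nodes t = n}"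
  by (rule finite_subset[OF _ finite_nodes_le[of n]]) auto

instance utree :: countable
proof
  have "(UNIV :: utree set) = (\<Union>n. {t. nodes t = n})" by blast
  moreover have "countable (\<Union>n. {t. nodes t = n})" 
    using finite_nodes_eq by (intro countable_UN) (auto intro: countable_finite)
  ultimately show "\<exists>f :: utree \<Rightarrow> nat. inj f" by (metis countable_def)
qed

instance multiset :: (countable) countable
proof
  have "surj (mset :: 'a list \<Rightarrow> _)" using ex_mset unfolding surj_def by metis
  then have "countable (UNIV :: 'a multiset set)"
    using countable_image[OF countableI_type, of mset UNIV] by metis
  then show "\<exists>f :: 'a multiset \<Rightarrow> nat. inj f" by (simp add: countable_def)
qed

text \<open>Summed over trees instead of sizes, so that it can be reorganised along subtrees. As
  \<open>nodes t\<close> is positive, the subtraction never truncates.\<close>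

definition otter_series :: "ennreal \<Rightarrow> ennreal" where
  "otter_series x = (\<Sum>\<^sup>+t. x ^ (nodes t - 1))"

lemma otter_series_mono: "x \<le> y \<Longrightarrow> otter_series x \<le> otter_series y"
  unfolding otter_series_def by (intro tsum_mono power_mono) auto

lemma tsum_Node: "(\<Sum>\<^sup>+t. f t) = (\<Sum>\<^sup>+M. f (Node M))"
proof (rule tsum_bij[symmetric])
  show "bij Node" by (metis bijI' utree.exhaust utree.inject)
qed

lemma nodes_Node_power:
  fixes x :: ennreal
  shows "x ^ (nodes (Node M) - 1) = prod_mset (image_mset (\<lambda>t. x ^ nodes t) M)"
  by (induction M) (auto simp: power_add)

text \<open>Polya's functional equation in multiset form: deleting the root leaves a multiset of
  trees, and the root is exactly the node omitted in the exponent.\<close>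

lemma otter_series_eq_multisets:
  "otter_series x = (\<Sum>\<^sup>+M. prod_mset (image_mset (\<lambda>t. x ^ nodes t) M))"
proof -
  have "(\<lambda>M. x ^ (nodes (Node M) - 1)) = (\<lambda>M. prod_mset (image_mset (\<lambda>t. x ^ nodes t) M))"
    by (rule ext) (rule nodes_Node_power)
  then show ?thesis unfolding otter_series_def tsum_Node[of "\<lambda>t. x ^ (nodes t - 1)"] by (rule arg_cong)
qed

lemma tsum_power_nodes: "(\<Sum>\<^sup>+t. x ^ nodes t) = x * otter_series x"
proof -
  have "x ^ nodes t = x * x ^ (nodes t - 1)" for t
    using nodes_pos[of t] by (cases "nodes t") auto
  then show ?thesis unfolding otter_series_def by (simp add: tsum_cmult)
qed

lemma otter_series_eq_suminf: "otter_series x = (\<Sum>k. of_nat (num_trees (Suc k)) * x ^ k)"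
proof -
  have "otter_series x = (\<Sum>\<^sup>+k. \<Sum>\<^sup>+t. if nodes t - 1 = k then x ^ (nodes t - 1) else 0)"
    unfolding otter_series_def by (rule tsum_fibre)
  also have "\<dots> = (\<Sum>\<^sup>+k. of_nat (num_trees (Suc k)) * x ^ k)"
  proof (intro nn_integral_cong)
    fix k
    have *: "(if nodes t - 1 = k then x ^ (nodes t - 1) else 0) = (if nodes t = Suc k then x ^ k else 0)" for t
      using nodes_pos[of t] by (cases "nodes t") auto
    have "(\<Sum>\<^sup>+t. if nodes t - 1 = k then x ^ (nodes t - 1) else 0) = (\<Sum>t\<in>{t. nodes t = Suc k}. x ^ k)"
      unfolding * by (subst tsum_finite[OF finite_nodes_eq[of "Suc k"]]) auto
    then show "(\<Sum>\<^sup>+t. if nodes t - 1 = k then x ^ (nodes t - 1) else 0) = of_nat (num_trees (Suc k)) * x ^ k"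
      by (simp add: num_trees_def)
  qed
  finally show ?thesis by (simp add: nn_integral_count_space_nat)
qed

text \<open>Trees whose root has exactly two children already account for half of the square of the
  series; this replaces Otter's asymptotics at the radius of convergence.\<close>
lemma otter_series_square_le: "(x * otter_series x)\<^sup>2 \<le> 2 * otter_series x"
proof -
  have "(x * otter_series x)\<^sup>2 = (\<Sum>\<^sup>+a. \<Sum>\<^sup>+b. x ^ nodes a * x ^ nodes b)"
    by (simp add: tsum_cmult tsum_multc tsum_power_nodes power2_eq_square)
  also have "\<dots> = (\<Sum>\<^sup>+z. x ^ (nodes (Node {#fst z, snd z#}) - 1))"
    by (subst tsum_pair) (simp add: power_add)
  also have "\<dots> = (\<Sum>\<^sup>+t. \<Sum>\<^sup>+z. if Node {#fst z, snd z#} = t then x ^ (nodes (Node {#fst z, snd z#}) - 1) else 0)"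
    by (rule tsum_fibre)
  also have "\<dots> \<le> (\<Sum>\<^sup>+t. 2 * x ^ (nodes t - 1))"
  proof (intro tsum_mono)
    fix t
    show "(\<Sum>\<^sup>+z. if Node {#fst z, snd z#} = t then x ^ (nodes (Node {#fst z, snd z#}) - 1) else 0)
      \<le> 2 * x ^ (nodes t - 1)" (is "?L \<le> _")
    proof (cases "\<exists>a b. t = Node {#a, b#}")
      case True
      then obtain a b where t: "t = Node {#a, b#}" by blast
      \<comment> \<open>Two ordered pairs produce this tree, but only one if \<open>a = b\<close>;
        hence the cardinality is bounded by 2 rather than computed.\<close>
      have iff: "Node {#fst z, snd z#} = t \<longleftrightarrow> z \<in> {(a, b), (b, a)}" for z
        unfolding t by (cases z) (auto simp: add_eq_conv_ex)
      have "?L = (\<Sum>\<^sup>+z. if z \<in> {(a, b), (b, a)} then x ^ (nodes t - 1) else 0)"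
        unfolding iff[symmetric] by (intro nn_integral_cong) (simp del: nodes.simps)
      also have "\<dots> = (\<Sum>z\<in>{(a, b), (b, a)}. x ^ (nodes t - 1))"
        by (rule tsum_if_finite) (intro finite.intros)
      also have "\<dots> = of_nat (card {(a, b), (b, a)}) * x ^ (nodes t - 1)" by (rule sum_constant)
      also have "\<dots> \<le> 2 * x ^ (nodes t - 1)"
      proof (intro mult_right_mono)
        have "card {(a, b), (b, a)} \<le> length [(a, b), (b, a)]"
          using card_length[of "[(a, b), (b, a)]"] by (simp only: list.set)
        then have "card {(a, b), (b, a)} \<le> 2" by (simp only: list.size)
        then show "of_nat (card {(a, b), (b, a)}) \<le> (2::ennreal)"
          using of_nat_mono[of "card {(a, b), (b, a)}" 2, where 'a=ennreal] by (simp only: of_nat_numeral)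
      qed simp
      finally show ?thesis .
    next
      case False
      then have "?L = (\<Sum>\<^sup>+z::utree \<times> utree. 0)" by (intro nn_integral_cong) auto
      then show ?thesis by simp
    qed
  qed
  also have "\<dots> = 2 * otter_series x" by (simp add: otter_series_def tsum_cmult)
  finally show ?thesis .
qed

text \<open>Cancelling one factor in the quadratic inequality requires a finite value, so the bound
  is available at first only where convergence is known. It does not blow up as \<open>x\<close>
  approaches the radius.\<close>

lemma otter_series_le:
  assumes "0 < x" "otter_series (ennreal x) < \<infinity>"
  shows "otter_series (ennreal x) \<le> ennreal (2 / x\<^sup>2)"
proof -
  obtain c where c: "otter_series (ennreal x) = ennreal c" "0 \<le> c"
    using assms(2) by (cases "otter_series (ennreal x)") auto
  have "ennreal ((x * c)\<^sup>2) \<le> ennreal (2 * c)"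
    using otter_series_square_le[of "ennreal x"] c assms(1)
    by (simp add: ennreal_mult ennreal_power[symmetric])
  then have "(x * c)\<^sup>2 \<le> 2 * c" using c by (simp add: ennreal_le_iff)
  then have "x\<^sup>2 * c * c \<le> 2 * c" by (simp add: power2_eq_square mult_ac)
  then have "x\<^sup>2 * c \<le> 2" using c(2) by (cases "c = 0") auto
  then have "c \<le> 2 / x\<^sup>2" using assms(1) by (simp add: field_simps)
  then show ?thesis using c by (simp add: ennreal_leI)
qed

lemma otter_series_finite_below:
  assumes "0 \<le> x" "ereal x < conv_radius (\<lambda>k. real (num_trees (Suc k)))"
  shows "otter_series (ennreal x) < \<infinity>"
proof -
  have sm: "summable (\<lambda>k. real (num_trees (Suc k)) * x ^ k)"
    using assms by (intro summable_in_conv_radius) auto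
  have "otter_series (ennreal x) = (\<Sum>k. ennreal (real (num_trees (Suc k)) * x ^ k))"
    unfolding otter_series_eq_suminf using assms(1)
    by (simp add: ennreal_mult ennreal_power ennreal_of_nat_eq_real_of_nat)
  also have "\<dots> = ennreal (\<Sum>k. real (num_trees (Suc k)) * x ^ k)"
    using assms(1) sm by (intro suminf_ennreal2) auto
  finally show ?thesis by simp
qed

text \<open>The bound \<open>2 / x\<^sup>2\<close> holds all along a sequence increasing to the
  radius, so Fatou's lemma gives finiteness at the radius itself; monotonicity covers every smaller
  \<open>s\<^sup>2\<close>.\<close>

lemma otter_series_finite:
  assumes "0 \<le> s" "s \<le> sqrt otter_alpha"
  shows "otter_series (ennreal (s\<^sup>2)) < \<infinity>"
proof (cases "otter_alpha \<le> 0")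
  \<comment> \<open>This case includes an infinite radius of convergence, since \<open>real_of_ereal \<infinity> = 0\<close>.\<close>
  case True
  then have "sqrt otter_alpha \<le> 0" by simp
  then have "s = 0" using assms by linarith
  then have "otter_series (ennreal (s\<^sup>2)) = (\<Sum>k. of_nat (num_trees (Suc k)) * 0 ^ k)"
    by (simp add: otter_series_eq_suminf)
  also have "\<dots> = (\<Sum>k\<in>{0}. of_nat (num_trees (Suc k)) * 0 ^ k)"
    by (intro suminf_finite) auto
  finally show ?thesis by (simp add: of_nat_less_top)
next
  case False
  define \<alpha> where "\<alpha> = otter_alpha"
  have \<alpha>: "0 < \<alpha>" "conv_radius (\<lambda>k. real (num_trees (Suc k))) = ereal \<alpha>"
    using False unfolding \<alpha>_def otter_alpha_def
    by (cases "conv_radius (\<lambda>k. real (num_trees (Suc k)))"; simp)+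
  \<comment> \<open>The offset 2 keeps \<open>x 0\<close> positive, as
    \<open>otter_series_le\<close> requires.\<close>
  define x where "x n = \<alpha> * (1 - 1 / real (n + 2))" for n
  have x: "0 < x n" "x n < \<alpha>" for n using \<alpha>(1) by (simp_all add: x_def field_simps add_pos_nonneg)
  have lim: "x \<longlonglongrightarrow> \<alpha>"
  proof -
    have "(\<lambda>n. 1 / real (n + 2)) \<longlonglongrightarrow> 0"
      using LIMSEQ_ignore_initial_segment[OF lim_1_over_n, of 2] by simp
    then have "(\<lambda>n. \<alpha> * (1 - 1 / real (n + 2))) \<longlonglongrightarrow> \<alpha> * (1 - 0)"
      by (intro tendsto_intros)
    then show ?thesis unfolding x_def by simp
  qed
  have le: "otter_series (ennreal (x n)) \<le> ennreal (2 / (x n)\<^sup>2)" for n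
    using x[of n] \<alpha> by (intro otter_series_le otter_series_finite_below) auto
  have "otter_series (ennreal \<alpha>) = (\<Sum>\<^sup>+t. liminf (\<lambda>n. ennreal (x n) ^ (nodes t - 1)))"
    unfolding otter_series_def
  proof (intro nn_integral_cong)
    fix t
    have "(\<lambda>n. ennreal (x n ^ (nodes t - 1))) \<longlonglongrightarrow> ennreal (\<alpha> ^ (nodes t - 1))"
      by (intro tendsto_ennrealI tendsto_power lim)
    from lim_imp_Liminf[OF _ this]
    show "ennreal \<alpha> ^ (nodes t - 1) = liminf (\<lambda>n. ennreal (x n) ^ (nodes t - 1))"
      using \<alpha>(1) x(1) by (simp add: ennreal_power less_imp_le)
  qed
  also have "\<dots> \<le> liminf (\<lambda>n. otter_series (ennreal (x n)))"
    unfolding otter_series_def by (rule tsum_liminf)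
  also have "\<dots> \<le> liminf (\<lambda>n. ennreal (2 / (x n)\<^sup>2))"
    using le by (intro Liminf_mono) auto
  also have "\<dots> = ennreal (2 / \<alpha>\<^sup>2)"
    using \<alpha>(1) lim by (intro lim_imp_Liminf tendsto_ennrealI tendsto_intros) auto
  finally have "otter_series (ennreal \<alpha>) < \<infinity>" by (simp add: le_less_trans)
  moreover have "s\<^sup>2 \<le> \<alpha>"
    using power_mono[OF assms(2,1), of 2] False unfolding \<alpha>_def by simp
  ultimately show ?thesis
    using otter_series_mono[of "ennreal (s\<^sup>2)" "ennreal \<alpha>"] by (auto simp: ennreal_leI intro: le_less_trans)
qed

section \<open>Kernels and their symmetric powers\<close>

definition kcomp :: "('a \<Rightarrow> 'b \<Rightarrow> ennreal) \<Rightarrow> ('b \<Rightarrow> 'c \<Rightarrow> ennreal) \<Rightarrow> 'a \<Rightarrow> 'c \<Rightarrow> ennreal" where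
  "kcomp R S x z = (\<Sum>\<^sup>+y. R x y * S y z)"

primrec kpow :: "('a \<Rightarrow> 'a \<Rightarrow> ennreal) \<Rightarrow> nat \<Rightarrow> 'a \<Rightarrow> 'a \<Rightarrow> ennreal" where
  "kpow R 0 = (\<lambda>x y. if x = y then 1 else 0)"
| "kpow R (Suc m) = kcomp R (kpow R m)"

definition ktrace :: "('a \<Rightarrow> 'a \<Rightarrow> ennreal) \<Rightarrow> ennreal" where
  "ktrace R = (\<Sum>\<^sup>+x. R x x)"

lemma kcomp_assoc: "kcomp (kcomp R S) T = kcomp R (kcomp S T)"
proof (intro ext)
  fix x w
  have "kcomp (kcomp R S) T x w = (\<Sum>\<^sup>+z. \<Sum>\<^sup>+y. R x y * S y z * T z w)"
    unfolding kcomp_def tsum_multc ..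
  also have "\<dots> = (\<Sum>\<^sup>+y. \<Sum>\<^sup>+z. R x y * S y z * T z w)" by (rule tsum_swap)
  also have "\<dots> = kcomp R (kcomp S T) x w"
    unfolding kcomp_def tsum_cmult[symmetric] by (simp only: mult.assoc)
  finally show "kcomp (kcomp R S) T x w = kcomp R (kcomp S T) x w" .
qed

lemma kcomp_id_left: "kcomp (\<lambda>x y. if x = y then 1 else 0) S = S"
proof (intro ext)
  fix x z
  have "kcomp (\<lambda>x y. if x = y then 1 else 0) S x z = (\<Sum>\<^sup>+y. if x = y then S y z else 0)"
    unfolding kcomp_def by (intro nn_integral_cong) auto
  then show "kcomp (\<lambda>x y. if x = y then 1 else 0) S x z = S x z" by simp
qed

lemma kcomp_id_right: "kcomp S (\<lambda>x y. if x = y then 1 else 0) = S"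
proof (intro ext)
  fix x z
  have "kcomp S (\<lambda>x y. if x = y then 1 else 0) x z = (\<Sum>\<^sup>+y. if y = z then S x y else 0)"
    unfolding kcomp_def by (intro nn_integral_cong) auto
  then show "kcomp S (\<lambda>x y. if x = y then 1 else 0) x z = S x z" by simp
qed

lemma kpow_1: "kpow R (Suc 0) = R"
  by (simp add: kcomp_id_right)

lemma kpow_add: "kpow R (m + n) = kcomp (kpow R m) (kpow R n)"
  by (induction m) (simp_all add: kcomp_id_left kcomp_assoc)

lemma kpow_mult: "kpow (kpow R m) n = kpow R (m * n)"
  by (induction n) (simp_all add: kpow_add)

text \<open>The left side counts only the paths that stay in the image of \<open>\<phi>\<close>. It
  is applied to \<open>pad n\<close> and to \<open>children\<close>.\<close>

lemma kpow_inj_le: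
  assumes "inj \<phi>"
  shows "kpow (\<lambda>x y. R (\<phi> x) (\<phi> y)) m x y \<le> kpow R m (\<phi> x) (\<phi> y)"
proof (induction m arbitrary: x y)
  case 0
  then show ?case using assms by (auto simp: inj_def)
next
  case (Suc m)
  have "kpow (\<lambda>x y. R (\<phi> x) (\<phi> y)) (Suc m) x y \<le> (\<Sum>\<^sup>+z. R (\<phi> x) (\<phi> z) * kpow R m (\<phi> z) (\<phi> y))"
    unfolding kpow.simps kcomp_def by (intro tsum_mono mult_left_mono Suc) auto
  also have "\<dots> \<le> (\<Sum>\<^sup>+z. R (\<phi> x) z * kpow R m z (\<phi> y))"
    by (rule tsum_inj_le[OF assms, of "\<lambda>z. R (\<phi> x) z * kpow R m z (\<phi> y)"])
  finally show ?case by (simp add: kcomp_def)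
qed

text \<open>The tensor powers of \<open>R\<close>, all lengths at once. Unequal lengths get weight
  0, so that sums may range over the whole list type.\<close>

fun listk :: "('a \<Rightarrow> 'b \<Rightarrow> ennreal) \<Rightarrow> 'a list \<Rightarrow> 'b list \<Rightarrow> ennreal" where
  "listk R [] [] = 1"
| "listk R (x # xs) (y # ys) = R x y * listk R xs ys"
| "listk R _ _ = 0"

lemma listk_neq: "length xs \<noteq> length ys \<Longrightarrow> listk R xs ys = 0"
  by (induction R xs ys rule: listk.induct) auto

lemma listk_nth: "length xs = length ys \<Longrightarrow> listk R xs ys = (\<Prod>i<length xs. R (xs ! i) (ys ! i))"
proof (induction R xs ys rule: listk.induct)
  case (2 R x xs y ys)
  then show ?case by (simp add: prod.lessThan_Suc_shift del: prod.lessThan_Suc)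
qed auto

lemma listk_kcomp: "(\<Sum>\<^sup>+ys. listk R xs ys * listk S ys zs) = listk (kcomp R S) xs zs"
proof (induction xs arbitrary: zs)
  case Nil
  show ?case by (subst tsum_list) (cases zs; simp)
next
  case (Cons x xs)
  show ?case
  proof (cases zs)
    case Nil
    then show ?thesis by (subst tsum_list) simp
  next
    case (Cons z zs')
    have "(\<Sum>\<^sup>+ys. listk R (x # xs) ys * listk S ys zs)
        = (\<Sum>\<^sup>+y. \<Sum>\<^sup>+ys. (R x y * S y z) * (listk R xs ys * listk S ys zs'))"
      unfolding Cons by (subst tsum_list) (simp add: mult_ac)
    also have "\<dots> = kcomp R S x z * listk (kcomp R S) xs zs'"
      unfolding tsum_cmult Cons.IH tsum_multc kcomp_def ..
    finally show ?thesis using Cons by simp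
  qed
qed

lemma listk_permute:
  assumes "\<sigma> permutes {..<length xs}" "length xs = length ys"
  shows "listk R (permute_list \<sigma> xs) (permute_list \<sigma> ys) = listk R xs ys"
proof -
  have "listk R (permute_list \<sigma> xs) (permute_list \<sigma> ys) = (\<Prod>i<length xs. R (xs ! \<sigma> i) (ys ! \<sigma> i))"
    using assms by (subst listk_nth) (auto simp: permute_list_nth intro!: prod.cong)
  also have "\<dots> = (\<Prod>i<length xs. R (xs ! i) (ys ! i))"
    using prod.permute[OF assms(1), of "\<lambda>i. R (xs ! i) (ys ! i)"] by (simp add: o_def)
  finally show ?thesis using assms(2) by (simp add: listk_nth)
qed

definition symk_from :: "('a \<Rightarrow> 'b \<Rightarrow> ennreal) \<Rightarrow> 'a list \<Rightarrow> 'b multiset \<Rightarrow> ennreal" where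
  "symk_from R xs B = (\<Sum>ys\<in>permutations_of_multiset B. listk R xs ys)"

lemma length_permutations_of_multiset: "ys \<in> permutations_of_multiset B \<Longrightarrow> length ys = size B"
  by (metis permutations_of_multisetD size_mset)

lemma symk_from_neq: "length xs \<noteq> size B \<Longrightarrow> symk_from R xs B = 0"
  unfolding symk_from_def
  by (intro sum.neutral ballI listk_neq) (auto dest: length_permutations_of_multiset)

lemma symk_from_tsum: "symk_from R xs B = (\<Sum>\<^sup>+ys. if mset ys = B then listk R xs ys else 0)"
  unfolding symk_from_def by (subst tsum_finite[of "permutations_of_multiset B"])
    (auto intro: permutations_of_multisetI dest: permutations_of_multisetD intro!: sum.cong)

lemma bij_betw_permute_list:
  assumes "\<sigma> permutes {..<size B}"
  shows "bij_betw (permute_list \<sigma>) (permutations_of_multiset B) (permutations_of_multiset B)"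
proof (rule bij_betw_byWitness[where f' = "permute_list (inv \<sigma>)"])
  have inv: "inv \<sigma> permutes {..<size B}" using assms by (rule permutes_inv)
  have *: "permute_list \<sigma> ys \<in> permutations_of_multiset B" if "\<sigma> permutes {..<size B}"
    "ys \<in> permutations_of_multiset B" for \<sigma> ys
    using that length_permutations_of_multiset[of ys B]
    by (intro permutations_of_multisetI) (simp add: permutations_of_multisetD)
  show "permute_list \<sigma> ` permutations_of_multiset B \<subseteq> permutations_of_multiset B"
    "permute_list (inv \<sigma>) ` permutations_of_multiset B \<subseteq> permutations_of_multiset B"
    using *[OF assms] *[OF inv] by auto
  show "\<forall>a\<in>permutations_of_multiset B. permute_list (inv \<sigma>) (permute_list \<sigma> a) = a"
    using inv assms length_permutations_of_multiset[of _ B]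
    by (auto simp: permute_list_compose[symmetric] permutes_inv_o)
  show "\<forall>a\<in>permutations_of_multiset B. permute_list \<sigma> (permute_list (inv \<sigma>) a) = a"
    using inv assms length_permutations_of_multiset[of _ B]
    by (auto simp: permute_list_compose[symmetric] permutes_inv_o)
qed

text \<open>Lumpability: applying one permutation to both lists preserves \<open>listk\<close> and
  permutes the arrangements of \<open>B\<close>, so the order of the start is irrelevant. This makes
  \<open>symk\<close> a kernel on multisets.\<close>

lemma symk_from_mset_cong:
  assumes "mset xs = mset xs'"
  shows "symk_from R xs B = symk_from R xs' B"
proof (cases "length xs = size B")
  case True
  obtain \<sigma> where \<sigma>: "\<sigma> permutes {..<length xs'}" "permute_list \<sigma> xs' = xs"
    using mset_eq_permutation[OF assms] by blast
  have len: "length xs' = size B" using assms True by (metis size_mset)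
  have "symk_from R xs B = (\<Sum>ys\<in>permutations_of_multiset B. listk R (permute_list \<sigma> xs') (permute_list \<sigma> ys))"
    unfolding symk_from_def \<sigma>(2)[symmetric]
    using \<sigma> len by (intro sum.reindex_bij_betw[symmetric] bij_betw_permute_list) auto
  also have "\<dots> = symk_from R xs' B"
    unfolding symk_from_def using \<sigma> len length_permutations_of_multiset[of _ B]
    by (intro sum.cong listk_permute) auto
  finally show ?thesis .
next
  case False
  then have "length xs' \<noteq> size B" using assms by (metis size_mset)
  then show ?thesis using False by (simp add: symk_from_neq)
qed

definition list_of_mset :: "'a multiset \<Rightarrow> 'a list" where
  "list_of_mset A = (SOME xs. mset xs = A)"

lemma mset_list_of_mset [simp]: "mset (list_of_mset A) = A"
  unfolding list_of_mset_def by (rule someI_ex) (rule ex_mset)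

text \<open>The chain of \<open>n\<close> independent particles moving according to \<open>R\<close>, observed as an unordered
  configuration.\<close>
definition symk :: "nat \<Rightarrow> ('a \<Rightarrow> 'b \<Rightarrow> ennreal) \<Rightarrow> 'a multiset \<Rightarrow> 'b multiset \<Rightarrow> ennreal" where
  "symk n R A B = (if size A = n then symk_from R (list_of_mset A) B else 0)"

lemma symk_mset: "symk n R (mset xs) B = (if length xs = n then symk_from R xs B else 0)"
  unfolding symk_def using symk_from_mset_cong[of "list_of_mset (mset xs)" xs R B] by simp

text \<open>By lumpability the second kernel may start from any arrangement of the intermediate
  multiset, so the sum over intermediate multisets unfolds to one over intermediate lists, where
  tensor powers compose.\<close>

lemma kcomp_symk:
  fixes R :: "'a \<Rightarrow> 'b \<Rightarrow> ennreal" and S :: "'b \<Rightarrow> 'c \<Rightarrow> ennreal"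
  shows "kcomp (symk n R) (symk n S) = symk n (kcomp R S)"
proof (intro ext)
  fix A :: "'a multiset" and C :: "'c multiset"
  obtain xs where A: "A = mset xs" using ex_mset by metis
  show "kcomp (symk n R) (symk n S) A C = symk n (kcomp R S) A C"
  proof (cases "length xs = n")
    case True
    have "kcomp (symk n R) (symk n S) A C = (\<Sum>\<^sup>+B. symk_from R xs B * symk n S B C)"
      unfolding kcomp_def A symk_mset using True by simp
    also have "\<dots> = (\<Sum>\<^sup>+B. \<Sum>\<^sup>+ys. if mset ys = B then listk R xs ys * symk n S (mset ys) C else 0)"
      unfolding symk_from_tsum tsum_multc[symmetric]
      by (intro nn_integral_cong) auto
    also have "\<dots> = (\<Sum>\<^sup>+ys. listk R xs ys * symk n S (mset ys) C)"
      by (rule tsum_fibre[symmetric])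
    also have "\<dots> = (\<Sum>\<^sup>+ys. listk R xs ys * symk_from S ys C)"
      using True listk_neq[of xs _ R] unfolding symk_mset
      by (intro nn_integral_cong) (metis mult_zero_left)
    also have "\<dots> = (\<Sum>\<^sup>+ys. \<Sum>\<^sup>+zs. if mset zs = C then listk R xs ys * listk S ys zs else 0)"
      unfolding symk_from_tsum tsum_cmult[symmetric] by (intro nn_integral_cong) auto
    also have "\<dots> = (\<Sum>\<^sup>+zs. \<Sum>\<^sup>+ys. if mset zs = C then listk R xs ys * listk S ys zs else 0)"
      by (rule tsum_swap)
    also have "\<dots> = (\<Sum>\<^sup>+zs. if mset zs = C then listk (kcomp R S) xs zs else 0)"
      by (intro nn_integral_cong) (auto simp: listk_kcomp)
    also have "\<dots> = symk n (kcomp R S) A C"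
      unfolding A symk_mset symk_from_tsum using True by simp
    finally show ?thesis .
  next
    case False
    then show ?thesis unfolding kcomp_def A symk_mset by simp
  qed
qed

text \<open>Restricted to positive powers: power 0 is the identity on all multisets, whereas
  \<open>symk n\<close> vanishes on those of size other than \<open>n\<close>.\<close>

lemma kpow_symk: "kpow (symk n R) (Suc m) = symk n (kpow R (Suc m))"
  by (induction m) (simp_all add: kpow_1[unfolded kpow.simps] kcomp_symk)

section \<open>The trace of a symmetric power as an average over permutations\<close>

lemma card_permute_list_eq:
  assumes "mset ys = mset xs"
  shows "card {\<sigma>. \<sigma> permutes {..<length xs} \<and> permute_list \<sigma> xs = ys} * card (permutations_of_multiset (mset xs))
    = fact (length xs)"
proof -
  let ?n = "length xs"
  define st where "st ys = {\<sigma>. \<sigma> permutes {..<?n} \<and> permute_list \<sigma> xs = ys}" for ys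
  have fin: "finite {\<sigma>. \<sigma> permutes {..<?n}}" by (simp add: finite_permutations)
  have eq: "card (st ys) = card (st xs)" if yx: "mset ys = mset xs" for ys
  proof -
    obtain \<rho> where \<rho>: "\<rho> permutes {..<?n}" "permute_list \<rho> xs = ys"
      using mset_eq_permutation[OF yx] by blast
    have inv: "inv \<rho> permutes {..<?n}" using \<rho>(1) by (rule permutes_inv)
    have xs: "permute_list (inv \<rho>) ys = xs"
      unfolding \<rho>(2)[symmetric] using permute_list_compose[of "inv \<rho>" xs \<rho>] inv \<rho>(1) by (simp add: permutes_inv_o)
    have len: "length ys = ?n" using \<rho>(2) by auto
    \<comment> \<open>Orbit-stabilizer: translation by a \<open>\<rho>\<close> that carries
      \<open>xs\<close> to \<open>ys\<close> maps the stabilizer of \<open>xs\<close> onto the fibre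
      over \<open>ys\<close>.\<close>
    have "bij_betw (\<lambda>\<sigma>. \<sigma> \<circ> \<rho>) (st xs) (st ys)"
    proof (rule bij_betw_byWitness[where f' = "\<lambda>\<sigma>. \<sigma> \<circ> inv \<rho>"])
      show "\<forall>a\<in>st xs. a \<circ> \<rho> \<circ> inv \<rho> = a" "\<forall>a\<in>st ys. a \<circ> inv \<rho> \<circ> \<rho> = a"
        using \<rho>(1) by (simp_all add: o_assoc[symmetric] permutes_inv_o)
      show "(\<lambda>\<sigma>. \<sigma> \<circ> \<rho>) ` st xs \<subseteq> st ys"
        unfolding st_def using \<rho> by (auto simp: permutes_compose permute_list_compose)
      show "(\<lambda>\<sigma>. \<sigma> \<circ> inv \<rho>) ` st ys \<subseteq> st xs"
        unfolding st_def using inv xs by (auto simp: permutes_compose permute_list_compose)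
    qed
    then show ?thesis by (simp add: bij_betw_same_card)
  qed
  have "fact ?n = card {\<sigma>. \<sigma> permutes {..<?n}}" by (simp add: card_permutations)
  also have "{\<sigma>. \<sigma> permutes {..<?n}} = (\<Union>ys\<in>permutations_of_multiset (mset xs). st ys)"
    unfolding st_def by (auto intro!: permutations_of_multisetI)
  also have "card \<dots> = (\<Sum>ys\<in>permutations_of_multiset (mset xs). card (st ys))"
    by (intro card_UN_disjoint) (auto simp: st_def intro: finite_subset[OF _ fin])
  also have "\<dots> = (\<Sum>ys\<in>permutations_of_multiset (mset xs). card (st xs))"
    by (intro sum.cong eq) (auto dest: permutations_of_multisetD)
  finally show ?thesis using eq[OF assms] by (simp add: st_def)
qed

text \<open>All fibres of the permutation action have the same size, so averages over permutations
  and over distinct arrangements agree. Cross-multiplied to avoid division in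
  \<open>ennreal\<close>.\<close>

lemma sum_permute_list:
  fixes f :: "'a list \<Rightarrow> ennreal"
  shows "of_nat (card (permutations_of_multiset (mset xs))) * (\<Sum>\<sigma> | \<sigma> permutes {..<length xs}. f (permute_list \<sigma> xs))
    = fact (length xs) * (\<Sum>ys\<in>permutations_of_multiset (mset xs). f ys)"
proof -
  let ?P = "permutations_of_multiset (mset xs)" and ?S = "{\<sigma>. \<sigma> permutes {..<length xs}}"
  have "(\<Sum>\<sigma>\<in>?S. f (permute_list \<sigma> xs)) = (\<Sum>ys\<in>?P. \<Sum>\<sigma>\<in>{\<sigma>\<in>?S. permute_list \<sigma> xs = ys}. f (permute_list \<sigma> xs))"
    by (intro sum.group[symmetric]) (auto simp: finite_permutations intro: permutations_of_multisetI)
  also have "\<dots> = (\<Sum>ys\<in>?P. of_nat (card {\<sigma>. \<sigma> permutes {..<length xs} \<and> permute_list \<sigma> xs = ys}) * f ys)"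
    by (intro sum.cong) auto
  finally have "of_nat (card ?P) * (\<Sum>\<sigma>\<in>?S. f (permute_list \<sigma> xs))
    = (\<Sum>ys\<in>?P. of_nat (card {\<sigma>. \<sigma> permutes {..<length xs} \<and> permute_list \<sigma> xs = ys} * card ?P) * f ys)"
    by (simp add: sum_distrib_left mult_ac)
  also have "\<dots> = (\<Sum>ys\<in>?P. fact (length xs) * f ys)"
  proof (intro sum.cong refl)
    fix ys assume "ys \<in> ?P"
    then have "mset ys = mset xs" by (rule permutations_of_multisetD)
    from card_permute_list_eq[OF this] show "of_nat (card {\<sigma>. \<sigma> permutes {..<length xs} \<and> permute_list \<sigma> xs = ys} * card ?P) * f ys
      = fact (length xs) * f ys" by (simp only: of_nat_fact)
  qed
  finally show ?thesis by (simp add: sum_distrib_left)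
qed

text \<open>A diagonal entry sums over the final arrangements for one fixed start; averaging over
  the arrangements of the start as well turns it into a sum over all permutations.\<close>

lemma ktrace_symk:
  "fact n * ktrace (symk n R) =
    (\<Sum>\<sigma> | \<sigma> permutes {..<n}. \<Sum>\<^sup>+xs. if length xs = n then listk R xs (permute_list \<sigma> xs) else 0)"
proof -
  have fibre: "(\<Sum>\<^sup>+xs. if mset xs = A then (if length xs = n then
      (\<Sum>\<sigma> | \<sigma> permutes {..<n}. listk R xs (permute_list \<sigma> xs)) else 0) else 0) = fact n * symk n R A A" for A
  proof (cases "size A = n")
    case True
    let ?P = "permutations_of_multiset A"
    let ?g = "\<lambda>xs. \<Sum>\<sigma> | \<sigma> permutes {..<n}. listk R xs (permute_list \<sigma> xs)"
    have "(\<Sum>\<^sup>+xs. if mset xs = A then (if length xs = n then ?g xs else 0) else 0) = (\<Sum>xs\<in>?P. ?g xs)"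
      using True by (subst tsum_finite[of ?P])
        (auto intro: permutations_of_multisetI dest: permutations_of_multisetD length_permutations_of_multiset intro!: sum.cong)
    moreover have "of_nat (card ?P) * (\<Sum>xs\<in>?P. ?g xs) = (\<Sum>xs\<in>?P. fact n * symk n R A A)"
      unfolding sum_distrib_left[of "of_nat (card ?P)" ?g ?P]
    proof (intro sum.cong refl)
      fix xs assume xs: "xs \<in> ?P"
      have A: "mset xs = A" "length xs = n"
        using xs True by (auto dest: permutations_of_multisetD length_permutations_of_multiset)
      show "of_nat (card ?P) * ?g xs = fact n * symk n R A A"
        using sum_permute_list[of xs "listk R xs"] A symk_mset[of n R xs A]
        by (simp add: symk_from_def)
    qed
    moreover have "of_nat (card ?P) \<noteq> (0::ennreal)" by simp
    ultimately show ?thesis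
      by (simp add: ennreal_mult_cancel_left of_nat_less_top)
  next
    case False
    then have "(\<lambda>xs. if mset xs = A then (if length xs = n then
      (\<Sum>\<sigma> | \<sigma> permutes {..<n}. listk R xs (permute_list \<sigma> xs)) else 0) else 0) = (\<lambda>_. 0)"
      by (intro ext) auto
    then show ?thesis using False by (simp add: symk_def)
  qed
  have "fact n * ktrace (symk n R) = (\<Sum>\<^sup>+A. fact n * symk n R A A)"
    unfolding ktrace_def tsum_cmult ..
  also have "\<dots> = (\<Sum>\<^sup>+xs. if length xs = n then
      (\<Sum>\<sigma> | \<sigma> permutes {..<n}. listk R xs (permute_list \<sigma> xs)) else 0)"
    unfolding fibre[symmetric] by (rule tsum_fibre[symmetric])
  also have "\<dots> = (\<Sum>\<^sup>+xs. \<Sum>\<sigma> | \<sigma> permutes {..<n}. if length xs = n then listk R xs (permute_list \<sigma> xs) else 0)"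
    by (intro nn_integral_cong) auto
  also have "\<dots> = (\<Sum>\<sigma> | \<sigma> permutes {..<n}. \<Sum>\<^sup>+xs. if length xs = n then listk R xs (permute_list \<sigma> xs) else 0)"
    by (rule nn_integral_sum) simp
  finally show ?thesis .
qed

section \<open>Reducing permutation sums to traces of powers\<close>

lemma tsum_length_Suc:
  "(\<Sum>\<^sup>+xs. if length xs = Suc n then f xs else 0) = (\<Sum>\<^sup>+xs. if length xs = n then (\<Sum>\<^sup>+y. f (xs @ [y])) else 0)"
proof -
  have inj: "inj (\<lambda>z. fst z @ [snd z])" by (auto simp: inj_def)
  have "xs \<in> range (\<lambda>z. fst z @ [snd z])" if "length xs = Suc n" for xs :: "'a list"
    using that by (cases xs rule: rev_cases) (auto simp: image_iff)
  then have "(\<Sum>\<^sup>+xs. if length xs = Suc n then f xs else 0)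
    = (\<Sum>\<^sup>+xs. (if length xs = Suc n then f xs else 0) * indicator (range (\<lambda>z. fst z @ [snd z])) xs)"
    by (intro nn_integral_cong) (simp split: if_split)
  also have "\<dots> = (\<Sum>\<^sup>+z. if length (fst z @ [snd z]) = Suc n then f (fst z @ [snd z]) else 0)"
    by (rule tsum_inj_eq[OF inj, symmetric])
  also have "\<dots> = (\<Sum>\<^sup>+xs. \<Sum>\<^sup>+y. if length (xs @ [y]) = Suc n then f (xs @ [y]) else 0)"
    by (rule tsum_pair[symmetric])
  also have "\<dots> = (\<Sum>\<^sup>+xs. if length xs = n then (\<Sum>\<^sup>+y. f (xs @ [y])) else 0)"
    by (intro nn_integral_cong) auto
  finally show ?thesis .
qed

text \<open>Allowing a different power of the kernel at every point lets a point be removed from its cycle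
  by merging it with its predecessor. The resulting recursion only involves traces of powers.\<close>
definition cycsum :: "('a \<Rightarrow> 'a \<Rightarrow> ennreal) \<Rightarrow> nat \<Rightarrow> (nat \<Rightarrow> nat) \<Rightarrow> ennreal" where
  "cycsum R n E = (\<Sum>\<sigma> | \<sigma> permutes {..<n}. \<Sum>\<^sup>+xs.
     if length xs = n then (\<Prod>i<n. kpow R (E i) (xs ! i) (xs ! \<sigma> i)) else 0)"

text \<open>Either the last point is fixed and its coordinate sums to a separate trace, or it
  follows some \<open>i\<close> in its cycle, and summing over its coordinate composes the two
  kernels around it into one power.\<close>

lemma cycsum_Suc:
  "cycsum R (Suc n) E = ktrace (kpow R (E n)) * cycsum R n E + (\<Sum>i<n. cycsum R n (E(i := E i + E n)))"
proof -
  define T where "T m \<sigma> E = (\<Sum>\<^sup>+xs. if length xs = m then (\<Prod>i<m. kpow R (E i) (xs ! i) (xs ! \<sigma> i)) else 0)"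
    for m \<sigma> and E :: "nat \<Rightarrow> nat"
  let ?Q = "{q. q permutes {..<n}}"
  have fixed: "T (Suc n) q E = ktrace (kpow R (E n)) * T n q E" if q: "q permutes {..<n}" for q
  proof -
    have qn: "q n = n" using q by (simp add: permutes_not_in)
    have "T (Suc n) q E = (\<Sum>\<^sup>+xs. if length xs = n then
        (\<Sum>\<^sup>+y. \<Prod>i<Suc n. kpow R (E i) ((xs @ [y]) ! i) ((xs @ [y]) ! q i)) else 0)"
      unfolding T_def tsum_length_Suc ..
    also have "\<dots> = (\<Sum>\<^sup>+xs. ktrace (kpow R (E n)) *
      (if length xs = n then (\<Prod>i<n. kpow R (E i) (xs ! i) (xs ! q i)) else 0))"
    proof (intro nn_integral_cong)
      fix xs :: "'a list"
      have "(\<Prod>i<Suc n. kpow R (E i) ((xs @ [y]) ! i) ((xs @ [y]) ! q i))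
         = (\<Prod>i<n. kpow R (E i) (xs ! i) (xs ! q i)) * kpow R (E n) y y" if "length xs = n" for y
        using that permutes_in_image[OF q] by (simp add: nth_append qn)
      then show "(if length xs = n then
        (\<Sum>\<^sup>+y. \<Prod>i<Suc n. kpow R (E i) ((xs @ [y]) ! i) ((xs @ [y]) ! q i)) else 0)
        = ktrace (kpow R (E n)) * (if length xs = n then (\<Prod>i<n. kpow R (E i) (xs ! i) (xs ! q i)) else 0)"
        by (simp add: tsum_cmult tsum_multc ktrace_def mult.commute)
    qed
    also have "\<dots> = ktrace (kpow R (E n)) * T n q E"
      unfolding T_def tsum_cmult ..
    finally show ?thesis .
  qed
  \<comment> \<open>This permutation sends \<open>i\<close> to \<open>n\<close> and \<open>n\<close>
    to \<open>q i\<close>: it inserts \<open>n\<close> into the cycle of \<open>q\<close> right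
    after \<open>i\<close>.\<close>
  have merge: "T (Suc n) (Transposition.transpose n (q i) \<circ> q) E = T n q (E(i := E i + E n))"
    if q: "q permutes {..<n}" and i: "i < n" for q i
  proof -
    let ?\<sigma> = "Transposition.transpose n (q i) \<circ> q"
    have qn: "q n = n" using q by (simp add: permutes_not_in)
    have qi: "q i < n" using permutes_in_image[OF q] i by simp
    have \<sigma>: "?\<sigma> n = q i" "?\<sigma> i = n" by (simp_all add: qn)
    have \<sigma>': "?\<sigma> j = q j" "q j < n" if "j < n" "j \<noteq> i" for j
    proof -
      show "q j < n" using permutes_in_image[OF q] that by simp
      moreover have "q j \<noteq> q i" using that permutes_inj[OF q] by (auto simp: inj_eq)
      ultimately show "?\<sigma> j = q j" by (simp add: transpose_apply_other)
    qed
    have "T (Suc n) ?\<sigma> E = (\<Sum>\<^sup>+xs. if length xs = n then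
        (\<Sum>\<^sup>+y. \<Prod>j<Suc n. kpow R (E j) ((xs @ [y]) ! j) ((xs @ [y]) ! ?\<sigma> j)) else 0)"
      unfolding T_def tsum_length_Suc ..
    also have "\<dots> = T n q (E(i := E i + E n))"
      unfolding T_def
    proof (intro nn_integral_cong if_cong refl)
      fix xs :: "'a list" assume len: "length xs = n"
      let ?r = "\<Prod>j\<in>{..<n} - {i}. kpow R (E j) (xs ! j) (xs ! q j)"
      have "(\<Prod>j<Suc n. kpow R (E j) ((xs @ [y]) ! j) ((xs @ [y]) ! ?\<sigma> j))
         = ?r * (kpow R (E i) (xs ! i) y * kpow R (E n) y (xs ! q i))" for y
      proof -
        have "(\<Prod>j<n. kpow R (E j) ((xs @ [y]) ! j) ((xs @ [y]) ! ?\<sigma> j))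
          = kpow R (E i) ((xs @ [y]) ! i) ((xs @ [y]) ! ?\<sigma> i) *
            (\<Prod>j\<in>{..<n} - {i}. kpow R (E j) ((xs @ [y]) ! j) ((xs @ [y]) ! ?\<sigma> j))"
          using i by (intro prod.remove) auto
        also have "(\<Prod>j\<in>{..<n} - {i}. kpow R (E j) ((xs @ [y]) ! j) ((xs @ [y]) ! ?\<sigma> j)) = ?r"
        proof (intro prod.cong refl)
          fix j assume "j \<in> {..<n} - {i}"
          then have "j < n" "?\<sigma> j = q j" "q j < n" using \<sigma>'[of j] by auto
          then show "kpow R (E j) ((xs @ [y]) ! j) ((xs @ [y]) ! ?\<sigma> j) = kpow R (E j) (xs ! j) (xs ! q j)"
            using len by (simp only: nth_append if_True)
        qed
        finally have "(\<Prod>j<n. kpow R (E j) ((xs @ [y]) ! j) ((xs @ [y]) ! ?\<sigma> j))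
          = kpow R (E i) (xs ! i) y * ?r"
          unfolding \<sigma> using i len by (simp add: nth_append)
        then show ?thesis
          unfolding prod.lessThan_Suc \<sigma> using qi len by (simp add: nth_append mult_ac)
      qed
      then have "(\<Sum>\<^sup>+y. \<Prod>j<Suc n. kpow R (E j) ((xs @ [y]) ! j) ((xs @ [y]) ! ?\<sigma> j))
        = ?r * kpow R (E i + E n) (xs ! i) (xs ! q i)"
        by (simp only: tsum_cmult kpow_add kcomp_def)
      also have "\<dots> = (\<Prod>j<n. kpow R ((E(i := E i + E n)) j) (xs ! j) (xs ! q j))"
      proof -
        have "(\<Prod>j<n. kpow R ((E(i := E i + E n)) j) (xs ! j) (xs ! q j))
          = kpow R ((E(i := E i + E n)) i) (xs ! i) (xs ! q i) *
            (\<Prod>j\<in>{..<n} - {i}. kpow R ((E(i := E i + E n)) j) (xs ! j) (xs ! q j))"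
          using i by (intro prod.remove) auto
        also have "(\<Prod>j\<in>{..<n} - {i}. kpow R ((E(i := E i + E n)) j) (xs ! j) (xs ! q j)) = ?r"
          by (intro prod.cong) auto
        finally show ?thesis by (simp add: mult.commute)
      qed
      finally show "(\<Sum>\<^sup>+y. \<Prod>j<Suc n. kpow R (E j) ((xs @ [y]) ! j) ((xs @ [y]) ! ?\<sigma> j))
        = (\<Prod>j<n. kpow R ((E(i := E i + E n)) j) (xs ! j) (xs ! q j))" .
    qed
    finally show ?thesis .
  qed
  have "cycsum R (Suc n) E = (\<Sum>\<sigma> | \<sigma> permutes (insert n {..<n}). T (Suc n) \<sigma> E)"
    unfolding cycsum_def T_def lessThan_Suc ..
  also have "\<dots> = (\<Sum>b\<in>insert n {..<n}. \<Sum>q\<in>?Q. T (Suc n) (Transposition.transpose n b \<circ> q) E)"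
    by (rule sum_over_permutations_insert) auto
  also have "\<dots> = (\<Sum>q\<in>?Q. T (Suc n) q E) + (\<Sum>q\<in>?Q. \<Sum>b<n. T (Suc n) (Transposition.transpose n b \<circ> q) E)"
    by (subst sum.insert) (auto intro: sum.swap)
  also have "(\<Sum>q\<in>?Q. \<Sum>b<n. T (Suc n) (Transposition.transpose n b \<circ> q) E) = (\<Sum>q\<in>?Q. \<Sum>i<n. T n q (E(i := E i + E n)))"
  proof (rule sum.cong[OF refl])
    fix q assume "q \<in> ?Q"
    then have q: "q permutes {..<n}" by simp
    \<comment> \<open>Each \<open>b\<close> equals \<open>q i\<close> for exactly one
      \<open>i\<close>; reindexing names the predecessor of \<open>n\<close>, whose exponent absorbs
      \<open>E n\<close>, instead of its image.\<close>
    have "(\<Sum>b<n. T (Suc n) (Transposition.transpose n b \<circ> q) E) = (\<Sum>i<n. T (Suc n) (Transposition.transpose n (q i) \<circ> q) E)"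
      using sum.permute[OF q, of "\<lambda>b. T (Suc n) (Transposition.transpose n b \<circ> q) E"] by (simp add: o_def)
    also have "\<dots> = (\<Sum>i<n. T n q (E(i := E i + E n)))"
      using merge[OF q] by (intro sum.cong) auto
    finally show "(\<Sum>b<n. T (Suc n) (Transposition.transpose n b \<circ> q) E) = (\<Sum>i<n. T n q (E(i := E i + E n)))" .
  qed
  also have "(\<Sum>q\<in>?Q. T (Suc n) q E) = (\<Sum>q\<in>?Q. ktrace (kpow R (E n)) * T n q E)"
    by (intro sum.cong fixed) auto
  also have "(\<Sum>q\<in>?Q. \<Sum>i<n. T n q (E(i := E i + E n))) = (\<Sum>i<n. \<Sum>q\<in>?Q. T n q (E(i := E i + E n)))"
    by (rule sum.swap)
  finally show ?thesis
    unfolding cycsum_def T_def sum_distrib_left .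
qed

text \<open>The recursion builds \<open>cycsum\<close> from traces by sums and products only.
  Merging keeps exponents positive, so the trace of power 0, about which nothing is assumed, never
  enters.\<close>

lemma cycsum_mono:
  assumes "\<And>j. 0 < j \<Longrightarrow> ktrace (kpow R j) \<le> ktrace (kpow S j)" "\<And>i. 0 < E i"
  shows "cycsum R n E \<le> cycsum S n E"
  using assms(2)
proof (induction n arbitrary: E)
  case 0
  show ?case by (simp add: cycsum_def)
next
  case (Suc n)
  show ?case unfolding cycsum_Suc
    by (intro add_mono mult_mono sum_mono assms(1) Suc.IH) (auto simp: Suc.prems)
qed

lemma ktrace_symk_cycsum: "fact n * ktrace (symk n R) = cycsum R n (\<lambda>_. 1)"
  unfolding ktrace_symk cycsum_def
proof (intro sum.cong refl nn_integral_cong)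
  fix \<sigma> xs assume "\<sigma> \<in> {\<sigma>. \<sigma> permutes {..<n}}"
  then show "(if length xs = n then listk R xs (permute_list \<sigma> xs) else 0)
    = (if length xs = n then \<Prod>i<n. kpow R 1 (xs ! i) (xs ! \<sigma> i) else 0)"
    by (auto simp: listk_nth permute_list_nth kcomp_id_right intro!: prod.cong)
qed

text \<open>The two kernels may live on different types, as only traces enter. A slot kernel can
  therefore be compared with a diagonal kernel without being diagonalised.\<close>

lemma ktrace_symk_mono:
  assumes "\<And>j. 0 < j \<Longrightarrow> ktrace (kpow R j) \<le> ktrace (kpow S j)"
  shows "ktrace (symk n R) \<le> ktrace (symk n S)"
proof -
  have "fact n * ktrace (symk n R) \<le> fact n * ktrace (symk n S)"
    unfolding ktrace_symk_cycsum by (intro cycsum_mono assms) auto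
  moreover have "(fact n :: ennreal) = of_nat (fact n)" by (rule of_nat_fact[symmetric])
  then have "(fact n :: ennreal) \<noteq> \<top>" by (simp only: ennreal_of_nat_neq_top not_False_eq_True)
  ultimately show ?thesis using ennreal_mult_le_mult_iff[of "fact n"] fact_nonzero by blast
qed

definition diagk :: "('a \<Rightarrow> ennreal) \<Rightarrow> 'a \<Rightarrow> 'a \<Rightarrow> ennreal" where
  "diagk \<theta> x y = (if x = y then \<theta> x else 0)"

lemma kpow_diagk: "kpow (diagk \<theta>) m = diagk (\<lambda>x. \<theta> x ^ m)"
proof (induction m)
  case (Suc m)
  have "kcomp (diagk \<theta>) (diagk (\<lambda>x. \<theta> x ^ m)) x z = diagk (\<lambda>x. \<theta> x ^ Suc m) x z" for x z
  proof -
    have "kcomp (diagk \<theta>) (diagk (\<lambda>x. \<theta> x ^ m)) x z = (\<Sum>\<^sup>+y. if x = y then \<theta> x * diagk (\<lambda>x. \<theta> x ^ m) x z else 0)"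
      unfolding kcomp_def diagk_def by (intro nn_integral_cong) auto
    then show ?thesis by (simp add: diagk_def)
  qed
  then show ?case unfolding kpow.simps Suc by (intro ext)
qed (simp add: fun_eq_iff diagk_def)

lemma listk_diagk: "listk (diagk \<theta>) xs ys = (if xs = ys then prod_mset (image_mset \<theta> (mset xs)) else 0)"
  by (induction "diagk \<theta>" xs ys rule: listk.induct) (auto simp: diagk_def)

text \<open>This is the complete homogeneous symmetric function of degree \<open>n\<close> in the
  entries: among the arrangements of \<open>A\<close> only the starting one is reached.\<close>

lemma ktrace_symk_diagk:
  "ktrace (symk n (diagk \<theta>)) = (\<Sum>\<^sup>+A. if size A = n then prod_mset (image_mset \<theta> A) else 0)"
  unfolding ktrace_def
proof (intro nn_integral_cong)
  fix A :: "'a multiset"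
  obtain xs where A: "A = mset xs" using ex_mset by metis
  have "symk_from (diagk \<theta>) xs (mset xs) = prod_mset (image_mset \<theta> (mset xs))"
    unfolding symk_from_def listk_diagk
    by (subst sum.mono_neutral_right[of _ "{xs}"]) (auto intro: permutations_of_multisetI)
  then show "symk n (diagk \<theta>) A A = (if size A = n then prod_mset (image_mset \<theta> A) else 0)"
    unfolding A symk_mset by simp
qed

section \<open>Particles in slots\<close>

lemma liminf_mult_le_ennreal:
  fixes a b :: "nat \<Rightarrow> ennreal"
  shows "liminf a * liminf b \<le> liminf (\<lambda>n. a n * b n)"
proof -
  have "(INF k\<in>{n..}. a k) * (INF k\<in>{m..}. b k) \<le> liminf (\<lambda>n. a n * b n)" for n m
  proof -
    have "(INF k\<in>{n..}. a k) * (INF k\<in>{m..}. b k) \<le> (INF k\<in>{max n m..}. a k * b k)"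
      by (intro INF_greatest mult_mono INF_lower) auto
    also have "\<dots> \<le> liminf (\<lambda>n. a n * b n)"
      unfolding liminf_SUP_INF by (intro SUP_upper) auto
    finally show ?thesis .
  qed
  then show ?thesis
    unfolding liminf_SUP_INF[of a] liminf_SUP_INF[of b] SUP_mult_left_ennreal SUP_mult_right_ennreal
    by (intro SUP_least)
qed

text \<open>Fatou's lemma is applied at each composition, so a pointwise lower bound on the kernels
  suffices and no domination is required.\<close>

lemma kpow_liminf:
  assumes "\<And>x y. K x y \<le> liminf (\<lambda>n. S n x y)"
  shows "kpow K m x y \<le> liminf (\<lambda>n. kpow (S n) m x y)"
proof (induction m arbitrary: x y)
  case 0
  show ?case by (simp add: Liminf_const)
next
  case (Suc m)
  have "kpow K (Suc m) x y \<le> (\<Sum>\<^sup>+z. liminf (\<lambda>n. S n x z) * liminf (\<lambda>n. kpow (S n) m z y))"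
    unfolding kpow.simps kcomp_def by (intro tsum_mono mult_mono assms Suc) auto
  also have "\<dots> \<le> (\<Sum>\<^sup>+z. liminf (\<lambda>n. S n x z * kpow (S n) m z y))"
    by (intro tsum_mono liminf_mult_le_ennreal)
  also have "\<dots> \<le> liminf (\<lambda>n. \<Sum>\<^sup>+z. S n x z * kpow (S n) m z y)"
    by (rule tsum_liminf)
  finally show ?case by (simp add: kcomp_def)
qed

text \<open>A configuration of at most \<open>n\<close> particles as the contents of \<open>n\<close> slots; \<open>None\<close> is an empty slot.\<close>
definition pad :: "nat \<Rightarrow> 'a multiset \<Rightarrow> 'a option multiset" where
  "pad n M = image_mset Some M + replicate_mset (n - size M) None"

definition unpad :: "'a option multiset \<Rightarrow> 'a multiset" where
  "unpad A = image_mset the (filter_mset (\<lambda>y. y \<noteq> None) A)"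

lemma unpad_simps [simp]:
  "unpad (A + B) = unpad A + unpad B" "unpad (replicate_mset k None) = {#}" "unpad (image_mset Some M) = M"
proof -
  show "unpad (image_mset Some M) = M" by (induction M) (auto simp: unpad_def)
  show "unpad (replicate_mset k None) = {#}" by (induction k) (auto simp: unpad_def)
qed (simp add: unpad_def)

lemma unpad_add_mset [simp]:
  "unpad (add_mset None A) = unpad A" "unpad (add_mset (Some x) A) = add_mset x (unpad A)" "unpad {#} = {#}"
  by (simp_all add: unpad_def)

lemma unpad_pad [simp]: "unpad (pad n M) = M"
  by (simp add: pad_def)

text \<open>Empty slots can be stripped again for every \<open>n\<close>; if
  \<open>size M > n\<close>, truncated subtraction adds none.\<close>

lemma inj_pad: "inj (pad n)"
  by (metis injI unpad_pad)

lemma pad_unpad: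
  assumes "size A = n"
  shows "pad n (unpad A) = A" "size (unpad A) \<le> n"
proof -
  have "A = image_mset Some (unpad A) + replicate_mset (size A - size (unpad A)) None \<and> size (unpad A) \<le> size A"
  proof (induction A)
    case (add y A)
    then show ?case
      by (cases y) (simp_all add: Suc_diff_le)
  qed simp
  then show "pad n (unpad A) = A" "size (unpad A) \<le> n" using assms by (simp_all add: pad_def)
qed

lemma size_pad: "size M \<le> n \<Longrightarrow> size (pad n M) = n"
  by (simp add: pad_def)

text \<open>Every multiset of size \<open>n\<close> is a padded one; an oversized \<open>M\<close>
  only adds terms on the right.\<close>

lemma tsum_size_le_pad: "(\<Sum>\<^sup>+A. if size A = n then h A else 0) \<le> (\<Sum>\<^sup>+M. h (pad n M))"
  unfolding tsum_inj_eq[OF inj_pad]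
proof (intro tsum_mono)
  fix A :: "'a option multiset"
  show "(if size A = n then h A else 0) \<le> h A * indicator (range (pad n)) A"
  proof (cases "size A = n")
    case True
    then have "A \<in> range (pad n)" using pad_unpad(1)[of A n] by (metis rangeI)
    then show ?thesis by simp
  qed simp
qed

definition visible :: "('i \<Rightarrow> 'a option) \<Rightarrow> 'i multiset \<Rightarrow> 'a multiset" where
  "visible g C = unpad (image_mset g C)"

lemma image_mset_pad:
  assumes "size C \<le> n"
  shows "image_mset (case_option None g) (pad n C) = pad n (visible g C)"
proof -
  let ?A = "image_mset (case_option None g) (pad n C)"
  have "?A = image_mset g C + replicate_mset (n - size C) None"
    by (simp add: pad_def image_mset.compositionality o_def)
  then have "unpad ?A = visible g C" by (simp add: visible_def)
  moreover have "size ?A = n" using assms by (simp add: size_pad)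
  ultimately show ?thesis using pad_unpad(1)[of ?A n] by simp
qed

section \<open>The Poisson limit of multinomial weights\<close>

text \<open>The probability that \<open>n\<close> independent slots with law \<open>w\<close> show
  the content \<open>C\<close>, empty slots being disregarded.\<close>

definition multinomial_weight :: "('i option \<Rightarrow> real) \<Rightarrow> nat \<Rightarrow> 'i multiset \<Rightarrow> real" where
  "multinomial_weight w n C =
     real (card (permutations_of_multiset (pad n C))) * prod_mset (image_mset w (pad n C))"

text \<open>The law of the multiset counted by independent Poisson variables of rates
  \<open>r i\<close>. The total rate \<open>L\<close> is a separate argument;
  \<open>poisson_family\<close> ties it to \<open>r\<close>.\<close>

definition poisson_weight :: "real \<Rightarrow> ('i \<Rightarrow> real) \<Rightarrow> 'i multiset \<Rightarrow> real" where
  "poisson_weight L r C = exp (- L) * prod_mset (image_mset r C) / (\<Prod>i\<in>set_mset C. fact (count C i))"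

lemma poisson_weight_nonneg: "(\<And>i. 0 \<le> r i) \<Longrightarrow> 0 \<le> poisson_weight L r C"
proof -
  assume r: "\<And>i. 0 \<le> r i"
  have "0 \<le> prod_mset (image_mset r C)" by (induction C) (auto simp: r)
  then show ?thesis unfolding poisson_weight_def by (intro divide_nonneg_nonneg mult_nonneg_nonneg prod_nonneg) auto
qed

lemma fact_ratio_tendsto: "(\<lambda>n. fact n / (fact (n - k) * real n ^ k)) \<longlonglongrightarrow> 1"
proof (induction k)
  case 0
  then show ?case by simp
next
  case (Suc k)
  have "(\<lambda>n. 1 - real k / real n) \<longlonglongrightarrow> 1 - 0"
    by (intro tendsto_diff tendsto_const lim_const_over_n)
  from tendsto_mult[OF Suc this]
  have "(\<lambda>n. fact n / (fact (n - k) * real n ^ k) * (1 - real k / real n)) \<longlonglongrightarrow> 1" by simp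
  moreover have "eventually (\<lambda>n. fact n / (fact (n - k) * real n ^ k) * (1 - real k / real n)
      = fact n / (fact (n - Suc k) * real n ^ Suc k)) sequentially"
    using eventually_gt_at_top[of k]
  proof eventually_elim
    case (elim n)
    then have "n - k = Suc (n - Suc k)" by simp
    then have "fact (n - k) = real (n - k) * fact (n - Suc k)" by (simp add: fact_Suc)
    moreover have "1 - real k / real n = real (n - k) / real n"
      using elim by (simp add: field_simps of_nat_diff)
    moreover have "real (n - k) \<noteq> 0" using elim by simp
    ultimately show ?case by (simp add: power_Suc)
  qed
  ultimately show ?case by (rule Lim_transform_eventually)
qed

lemma card_permutations_pad:
  assumes "size C \<le> n"
  shows "real (card (permutations_of_multiset (pad n C))) * (fact (n - size C) * (\<Prod>i\<in>set_mset C. fact (count C i))) = fact n"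
proof -
  have "count (image_mset Some C) None = 0" by (auto simp: not_in_iff[symmetric])
  have sub: "set_mset (pad n C) \<subseteq> insert None (Some ` set_mset C)" by (auto simp: pad_def split: if_splits)
  have c0: "count (pad n C) None = n - size C"
    using \<open>count (image_mset Some C) None = 0\<close> by (simp add: pad_def)
  have "(\<Prod>x\<in>set_mset (pad n C). fact (count (pad n C) x)) = (\<Prod>x\<in>insert None (Some ` set_mset C). (fact (count (pad n C) x) :: nat))"
    by (intro prod.mono_neutral_left sub) (auto simp: not_in_iff c0)
  also have "\<dots> = fact (n - size C) * (\<Prod>i\<in>set_mset C. fact (count (pad n C) (Some i)))"
    by (subst prod.insert) (auto simp: prod.reindex c0)
  also have "(\<Prod>i\<in>set_mset C. fact (count (pad n C) (Some i))) = (\<Prod>i\<in>set_mset C. fact (count C i) :: nat)"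
  proof (intro prod.cong refl)
    fix i
    have "count (image_mset Some C) (Some i) = count C i" by (induction C) auto
    then show "fact (count (pad n C) (Some i)) = (fact (count C i) :: nat)" by (simp add: pad_def)
  qed
  finally have "card (permutations_of_multiset (pad n C)) * (fact (n - size C) * (\<Prod>i\<in>set_mset C. fact (count C i))) = fact n"
    using card_permutations_of_multiset_aux[of "pad n C"] size_pad[OF assms] by simp
  then have "real (card (permutations_of_multiset (pad n C)) * (fact (n - size C) * (\<Prod>i\<in>set_mset C. fact (count C i)))) = real (fact n)"
    by simp
  then show ?thesis by (simp only: of_nat_mult of_nat_fact of_nat_prod)
qed

text \<open>The law of rare events. Since \<open>n! / (n - k)!\<close> behaves like
  \<open>n ^ k\<close>, each occupied slot absorbs one factor \<open>n\<close>; the power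
  \<open>n - k\<close> of the empty weight is a quotient whose denominator tends to 1.\<close>

lemma multinomial_weight_tendsto:
  fixes w :: "nat \<Rightarrow> 'i option \<Rightarrow> real"
  assumes r: "\<And>i. (\<lambda>n. real n * w n (Some i)) \<longlonglongrightarrow> r i"
    and w0: "(\<lambda>n. w n None) \<longlonglongrightarrow> 1" and L: "(\<lambda>n. w n None ^ n) \<longlonglongrightarrow> exp (- L)"
  shows "(\<lambda>n. multinomial_weight (w n) n C) \<longlonglongrightarrow> poisson_weight L r C"
proof -
  let ?k = "size C" and ?F = "(\<Prod>i\<in>set_mset C. fact (count C i)) :: real"
  have F: "?F > 0" by (intro prod_pos) auto
  have 1: "(\<lambda>n. prod_mset (image_mset (\<lambda>i. real n * w n (Some i)) C)) \<longlonglongrightarrow> prod_mset (image_mset r C)"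
    by (induction C) (auto intro!: tendsto_mult r)
  have "(\<lambda>n. w n None ^ n / w n None ^ ?k) \<longlonglongrightarrow> exp (- L) / 1 ^ ?k"
    by (intro tendsto_divide L tendsto_power w0) simp
  then have "(\<lambda>n. fact n / (fact (n - ?k) * real n ^ ?k) * (prod_mset (image_mset (\<lambda>i. real n * w n (Some i)) C) / ?F)
      * (w n None ^ n / w n None ^ ?k)) \<longlonglongrightarrow> 1 * (prod_mset (image_mset r C) / ?F) * (exp (- L) / 1 ^ ?k)"
    using F by (intro tendsto_mult[OF tendsto_mult[OF fact_ratio_tendsto tendsto_divide[OF 1 tendsto_const]]]) auto
  moreover have "eventually (\<lambda>n. fact n / (fact (n - ?k) * real n ^ ?k) * (prod_mset (image_mset (\<lambda>i. real n * w n (Some i)) C) / ?F)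
      * (w n None ^ n / w n None ^ ?k) = multinomial_weight (w n) n C) sequentially"
    using eventually_gt_at_top[of ?k] order_tendstoD(1)[OF w0, of 0, simplified]
  proof eventually_elim
    case (elim n)
    have prod: "prod_mset (image_mset (\<lambda>i. real n * w n (Some i)) C) = real n ^ ?k * prod_mset (image_mset (\<lambda>i. w n (Some i)) C)"
      by (induction C) auto
    have pw: "w n None ^ n / w n None ^ ?k = w n None ^ (n - ?k)"
      using elim by (simp add: power_diff)
    have card: "real (card (permutations_of_multiset (pad n C))) = fact n / (fact (n - ?k) * ?F)"
      using card_permutations_pad[of C n] elim F by (simp add: field_simps)
    have "prod_mset (image_mset (w n) (pad n C)) = prod_mset (image_mset (\<lambda>i. w n (Some i)) C) * w n None ^ (n - ?k)"
      by (simp add: pad_def image_mset.compositionality o_def)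
    then show ?case
      unfolding multinomial_weight_def prod pw card using elim by simp
  qed
  ultimately have "(\<lambda>n. multinomial_weight (w n) n C) \<longlonglongrightarrow> 1 * (prod_mset (image_mset r C) / ?F) * (exp (- L) / 1 ^ ?k)"
    by (rule Lim_transform_eventually)
  then show ?thesis by (simp add: poisson_weight_def mult.commute)
qed

section \<open>One step of the recursion over the depth\<close>

text \<open>\<open>p\<close> is the stationary law of a type and \<open>P\<close> the joint law of the types of two matched
  particles. At a step each slot keeps its content with probability \<open>s\<close>, a particle then moving by
  the kernel \<open>P x y / p x\<close>, and is refreshed from \<open>slot_init\<close> with probability \<open>1 - s\<close>.\<close>
locale particles =
  fixes p :: "'a \<Rightarrow> real" and P :: "'a \<Rightarrow> 'a \<Rightarrow> real" and s lam :: real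
  assumes p_nonneg: "\<And>x. 0 \<le> p x" and P_nonneg: "\<And>x y. 0 \<le> P x y"
    and p_sum: "(\<Sum>\<^sup>+x. ennreal (p x)) = 1"
    and row: "\<And>x. (\<Sum>\<^sup>+y. ennreal (P x y)) \<le> ennreal (p x)"
    and col: "\<And>y. (\<Sum>\<^sup>+x. ennreal (P x y)) \<le> ennreal (p y)"
    and s: "0 \<le> s" "s \<le> 1" and lam: "0 < lam"
begin

text \<open>Where \<open>p x = 0\<close>, division by zero gives 0; this is consistent because
  \<open>P x y\<close> vanishes there too, by \<open>P_le_p\<close>.\<close>

definition K :: "'a \<Rightarrow> 'a \<Rightarrow> ennreal" where
  "K x y = ennreal (P x y / p x)"

definition init_weight :: "real \<Rightarrow> 'a option \<Rightarrow> real" where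
  "init_weight \<epsilon> y = (case y of None \<Rightarrow> 1 - \<epsilon> | Some x \<Rightarrow> \<epsilon> * p x)"

definition slot_init :: "real \<Rightarrow> 'a option \<Rightarrow> ennreal" where
  "slot_init \<epsilon> y = ennreal (init_weight \<epsilon> y)"

fun slot_keep :: "'a option \<Rightarrow> 'a option \<Rightarrow> ennreal" where
  "slot_keep None None = 1"
| "slot_keep (Some x) (Some y) = K x y"
| "slot_keep _ _ = 0"

definition slot :: "real \<Rightarrow> 'a option \<Rightarrow> 'a option \<Rightarrow> ennreal" where
  "slot \<epsilon> y z = ennreal s * slot_keep y z + ennreal (1 - s) * slot_init \<epsilon> z"

lemma P_le_p: "P x y \<le> p x"
proof -
  have "ennreal (P x y) \<le> ennreal (p x)"
    using tsum_ge[of "\<lambda>y. ennreal (P x y)" y] row[of x] by (rule order_trans)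
  then show ?thesis using p_nonneg by (simp add: ennreal_le_iff)
qed

lemma p_K: "ennreal (p x) * K x y = ennreal (P x y)"
  unfolding K_def using p_nonneg[of x] P_nonneg[of x y] P_le_p[of x y]
  by (subst ennreal_mult[symmetric]) (auto intro: antisym)

lemma K_row: "(\<Sum>\<^sup>+y. K x y) \<le> 1"
proof (cases "p x = 0")
  case True
  then show ?thesis by (simp add: K_def)
next
  case False
  then have "0 < p x" using p_nonneg[of x] by simp
  have "K x y = ennreal (1 / p x) * ennreal (P x y)" for y
    unfolding K_def using p_nonneg P_nonneg by (subst ennreal_mult[symmetric]) auto
  then have "(\<Sum>\<^sup>+y. K x y) \<le> ennreal (1 / p x) * ennreal (p x)"
    unfolding tsum_cmult[symmetric] by (simp add: tsum_cmult mult_left_mono[OF row])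
  also have "\<dots> = 1" using \<open>0 < p x\<close> by (subst ennreal_mult[symmetric]) auto
  finally show ?thesis .
qed

lemma slot_keep_row: "(\<Sum>\<^sup>+z. slot_keep y z) \<le> 1"
  by (cases y) (simp_all add: tsum_option K_row)

context
  fixes \<epsilon> :: real
  assumes \<epsilon>: "0 \<le> \<epsilon>" "\<epsilon> \<le> 1"
begin

lemma slot_init_sum: "(\<Sum>\<^sup>+y. slot_init \<epsilon> y) = 1"
proof -
  have "(\<Sum>\<^sup>+x. ennreal (\<epsilon> * p x)) = ennreal \<epsilon>"
    using \<epsilon> p_nonneg by (simp add: ennreal_mult tsum_cmult p_sum)
  then have "(\<Sum>\<^sup>+y. slot_init \<epsilon> y) = ennreal (1 - \<epsilon>) + ennreal \<epsilon>"
    by (simp add: tsum_option slot_init_def init_weight_def)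
  also have "\<dots> = 1" using \<epsilon> by (subst ennreal_plus[symmetric]) auto
  finally show ?thesis .
qed

text \<open>The column bound makes \<open>p\<close> subinvariant under \<open>K\<close>, and the
  refresh law inherits this.\<close>

lemma slot_init_keep: "(\<Sum>\<^sup>+y. slot_init \<epsilon> y * slot_keep y z) \<le> slot_init \<epsilon> z"
proof (cases z)
  case None
  then show ?thesis by (simp add: tsum_option)
next
  case (Some x')
  have "(\<Sum>\<^sup>+y. slot_init \<epsilon> y * slot_keep y z) = (\<Sum>\<^sup>+x. ennreal \<epsilon> * (ennreal (p x) * K x x'))"
    unfolding Some using \<epsilon> p_nonneg
    by (simp add: tsum_option slot_init_def init_weight_def ennreal_mult mult.assoc)
  also have "\<dots> = ennreal \<epsilon> * (\<Sum>\<^sup>+x. ennreal (P x x'))" unfolding p_K tsum_cmult ..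
  also have "\<dots> \<le> ennreal \<epsilon> * ennreal (p x')" by (intro mult_left_mono col) auto
  finally show ?thesis
    unfolding Some using \<epsilon> p_nonneg by (simp add: slot_init_def init_weight_def ennreal_mult)
qed

lemma slot_init_keep_pow: "(\<Sum>\<^sup>+y. slot_init \<epsilon> y * kpow slot_keep m y z) \<le> slot_init \<epsilon> z"
proof (induction m)
  case 0
  have "(\<lambda>y. slot_init \<epsilon> y * kpow slot_keep 0 y z) = (\<lambda>y. if y = z then slot_init \<epsilon> y else 0)" by auto
  then show ?case by simp
next
  case (Suc m)
  have "(\<Sum>\<^sup>+y. slot_init \<epsilon> y * kpow slot_keep (Suc m) y z)
      = (\<Sum>\<^sup>+y. \<Sum>\<^sup>+x. slot_init \<epsilon> y * slot_keep y x * kpow slot_keep m x z)"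
    unfolding kpow.simps kcomp_def tsum_cmult[symmetric] by (simp only: mult.assoc)
  also have "\<dots> = (\<Sum>\<^sup>+x. \<Sum>\<^sup>+y. slot_init \<epsilon> y * slot_keep y x * kpow slot_keep m x z)" by (rule tsum_swap)
  also have "\<dots> \<le> (\<Sum>\<^sup>+x. slot_init \<epsilon> x * kpow slot_keep m x z)"
    unfolding tsum_multc by (intro tsum_mono mult_right_mono slot_init_keep) auto
  also note Suc
  finally show ?case .
qed

lemma slot_row: "(\<Sum>\<^sup>+z. slot \<epsilon> y z) \<le> 1"
proof -
  have "(\<Sum>\<^sup>+z. slot \<epsilon> y z) = ennreal s * (\<Sum>\<^sup>+z. slot_keep y z) + ennreal (1 - s) * (\<Sum>\<^sup>+z. slot_init \<epsilon> z)"
    unfolding slot_def tsum_add tsum_cmult ..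
  also have "\<dots> \<le> ennreal s * 1 + ennreal (1 - s) * 1"
    by (intro add_mono mult_left_mono slot_keep_row) (auto simp: slot_init_sum)
  also have "\<dots> = 1" using s by (simp add: ennreal_plus[symmetric] del: ennreal_plus)
  finally show ?thesis .
qed

text \<open>With weight \<open>s ^ m\<close> the slot is never refreshed and moves \<open>m\<close>
  times. Otherwise its law after the last refresh stays below \<open>slot_init\<close>, which is
  subinvariant under \<open>slot_keep\<close>.\<close>

lemma slot_pow_le:
  "kpow (slot \<epsilon>) m y z \<le> ennreal (s ^ m) * kpow slot_keep m y z + ennreal (1 - s ^ m) * slot_init \<epsilon> z"
proof (induction m arbitrary: y)
  case 0
  then show ?case by simp
next
  case (Suc m)
  let ?i = "slot_init \<epsilon>" and ?A = "slot_keep"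
  have sm: "0 \<le> s ^ m" "s ^ m \<le> 1" using s by (auto intro: power_le_one)
  have e: "0 \<le> 1 - s" "0 \<le> 1 - s ^ m" using s sm by auto
  have "kpow (slot \<epsilon>) (Suc m) y z \<le> (\<Sum>\<^sup>+x. slot \<epsilon> y x * (ennreal (s ^ m) * kpow ?A m x z + ennreal (1 - s ^ m) * ?i z))"
    unfolding kpow.simps kcomp_def by (intro tsum_mono mult_left_mono Suc) auto
  also have "\<dots> = (\<Sum>\<^sup>+x. ennreal s * ennreal (s ^ m) * (?A y x * kpow ?A m x z)
      + ennreal s * ennreal (1 - s ^ m) * ?i z * ?A y x
      + ennreal (1 - s) * ennreal (s ^ m) * (?i x * kpow ?A m x z)
      + ennreal (1 - s) * ennreal (1 - s ^ m) * ?i z * ?i x)"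
    by (intro nn_integral_cong) (simp add: slot_def algebra_simps)
  also have "\<dots> = ennreal s * ennreal (s ^ m) * kpow ?A (Suc m) y z
      + ennreal s * ennreal (1 - s ^ m) * ?i z * (\<Sum>\<^sup>+x. ?A y x)
      + ennreal (1 - s) * ennreal (s ^ m) * (\<Sum>\<^sup>+x. ?i x * kpow ?A m x z)
      + ennreal (1 - s) * ennreal (1 - s ^ m) * ?i z * (\<Sum>\<^sup>+x. ?i x)"
    unfolding tsum_add tsum_cmult kpow.simps kcomp_def ..
  also have "\<dots> \<le> ennreal s * ennreal (s ^ m) * kpow ?A (Suc m) y z
      + ennreal s * ennreal (1 - s ^ m) * ?i z * 1
      + ennreal (1 - s) * ennreal (s ^ m) * ?i z
      + ennreal (1 - s) * ennreal (1 - s ^ m) * ?i z * 1"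
    by (intro add_mono mult_left_mono slot_keep_row slot_init_keep_pow) (auto simp: slot_init_sum)
  also have "\<dots> = ennreal s * ennreal (s ^ m) * kpow ?A (Suc m) y z
      + (ennreal s * ennreal (1 - s ^ m) + ennreal (1 - s) * ennreal (s ^ m) + ennreal (1 - s) * ennreal (1 - s ^ m)) * ?i z"
    by (simp add: algebra_simps)
  also have "ennreal s * ennreal (1 - s ^ m) + ennreal (1 - s) * ennreal (s ^ m) + ennreal (1 - s) * ennreal (1 - s ^ m)
      = ennreal (1 - s ^ Suc m)"
  proof -
    have "ennreal s * ennreal (1 - s ^ m) + ennreal (1 - s) * ennreal (s ^ m) + ennreal (1 - s) * ennreal (1 - s ^ m)
      = ennreal (s * (1 - s ^ m) + (1 - s) * s ^ m + (1 - s) * (1 - s ^ m))"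
      using s(1) sm(1) e by (simp only: ennreal_mult ennreal_plus mult_nonneg_nonneg add_nonneg_nonneg)
    also have "s * (1 - s ^ m) + (1 - s) * s ^ m + (1 - s) * (1 - s ^ m) = 1 - s ^ Suc m"
      by (simp add: algebra_simps)
    finally show ?thesis .
  qed
  also have "ennreal s * ennreal (s ^ m) = ennreal (s ^ Suc m)"
    using s sm by (simp add: ennreal_mult)
  finally show ?case .
qed

lemma kpow_slot_keep:
  "kpow slot_keep m None None = 1" "kpow slot_keep m (Some x) (Some y) = kpow K m x y"
  "kpow slot_keep m None (Some y) = 0" "kpow slot_keep m (Some x) None = 0"
  by (induction m arbitrary: x) (auto simp: kcomp_def tsum_option)

text \<open>The never refreshed empty slot contributes \<open>s ^ m\<close>, the refreshed part
  \<open>1 - s ^ m\<close> because \<open>slot_init\<close> has mass 1: together the summand 1,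
  whatever \<open>\<epsilon>\<close> is.\<close>

lemma ktrace_slot_pow: "ktrace (kpow (slot \<epsilon>) m) \<le> 1 + ennreal (s ^ m) * ktrace (kpow K m)"
proof -
  have sm: "0 \<le> s ^ m" "s ^ m \<le> 1" using s by (auto intro: power_le_one)
  have "ktrace (kpow (slot \<epsilon>) m) \<le> (\<Sum>\<^sup>+y. ennreal (s ^ m) * kpow slot_keep m y y + ennreal (1 - s ^ m) * slot_init \<epsilon> y)"
    unfolding ktrace_def by (intro tsum_mono slot_pow_le)
  also have "\<dots> = ennreal (s ^ m) * ktrace (kpow slot_keep m) + ennreal (1 - s ^ m)"
    unfolding tsum_add tsum_cmult slot_init_sum ktrace_def by simp
  also have "ktrace (kpow slot_keep m) = 1 + ktrace (kpow K m)"
    unfolding ktrace_def by (simp add: tsum_option kpow_slot_keep)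
  also have "ennreal (s ^ m) * (1 + ktrace (kpow K m)) + ennreal (1 - s ^ m)
    = (ennreal (s ^ m) + ennreal (1 - s ^ m)) + ennreal (s ^ m) * ktrace (kpow K m)"
    by (simp add: algebra_simps)
  also have "ennreal (s ^ m) + ennreal (1 - s ^ m) = 1"
    using sm by (simp add: ennreal_plus[symmetric] del: ennreal_plus)
  finally show ?thesis .
qed

lemma ktrace_symk_slot_pow:
  fixes \<theta> :: "'b \<Rightarrow> ennreal"
  assumes K: "\<And>j. 0 < j \<Longrightarrow> ennreal (s ^ j) * ktrace (kpow K j) \<le> (\<Sum>\<^sup>+g. \<theta> g ^ j)" and "0 < m"
  shows "ktrace (kpow (symk n (slot \<epsilon>)) m) \<le> (\<Sum>\<^sup>+M. prod_mset (image_mset (\<lambda>g. \<theta> g ^ m) M))"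
proof -
  \<comment> \<open>The entry 1 at \<open>None\<close> plays the empty slot. It makes the weight of
    a padded multiset independent of the padding, and so the bound independent of
    \<open>n\<close>.\<close>
  define \<theta>' where "\<theta>' = case_option 1 (\<lambda>g. \<theta> g ^ m)"
  obtain k where k: "m = Suc k" using \<open>0 < m\<close> by (cases m) auto
  have "ktrace (kpow (symk n (slot \<epsilon>)) m) = ktrace (symk n (kpow (slot \<epsilon>) m))"
    unfolding k kpow_symk ..
  also have "\<dots> \<le> ktrace (symk n (diagk \<theta>'))"
  proof (rule ktrace_symk_mono)
    fix j :: nat assume "0 < j"
    \<comment> \<open>Power \<open>j\<close> of the \<open>m\<close>-step kernel calls for the trace
      of \<open>K\<close> at exponent \<open>m * j\<close>: one exponent at the next depth draws on
      all its multiples at this depth.\<close>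
    have "ktrace (kpow (kpow (slot \<epsilon>) m) j) \<le> 1 + ennreal (s ^ (m * j)) * ktrace (kpow K (m * j))"
      unfolding kpow_mult by (rule ktrace_slot_pow)
    also have "\<dots> \<le> 1 + (\<Sum>\<^sup>+g. \<theta> g ^ (m * j))"
      using \<open>0 < j\<close> \<open>0 < m\<close> by (intro add_left_mono K) simp
    also have "\<dots> = ktrace (kpow (diagk \<theta>') j)"
      unfolding kpow_diagk by (simp add: ktrace_def diagk_def \<theta>'_def tsum_option power_mult)
    finally show "ktrace (kpow (kpow (slot \<epsilon>) m) j) \<le> ktrace (kpow (diagk \<theta>') j)" .
  qed
  also have "\<dots> \<le> (\<Sum>\<^sup>+M. prod_mset (image_mset \<theta>' (pad n M)))"
    unfolding ktrace_symk_diagk by (rule tsum_size_le_pad)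
  also have "\<dots> = (\<Sum>\<^sup>+M. prod_mset (image_mset (\<lambda>g. \<theta> g ^ m) M))"
    by (simp add: \<theta>'_def pad_def image_mset.compositionality o_def)
  finally show ?thesis .
qed

end

end

section \<open>The joint content of a slot before and after one step\<close>

fun left_type :: "'a + 'a + 'a \<times> 'a \<Rightarrow> 'a option" where
  "left_type (Inl x) = Some x"
| "left_type (Inr (Inl y)) = None"
| "left_type (Inr (Inr z)) = Some (fst z)"

fun right_type :: "'a + 'a + 'a \<times> 'a \<Rightarrow> 'a option" where
  "right_type (Inl x) = None"
| "right_type (Inr (Inl y)) = Some y"
| "right_type (Inr (Inr z)) = Some (snd z)"

text \<open>No index is invisible on both sides, so \<open>None\<close> can stand for a slot that is
  empty both times and a pair of contents still determines the index.\<close>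

lemma left_right_type_inj: "inj (\<lambda>z. (case_option None left_type z, case_option None right_type z))"
proof (rule injI)
  fix z z' :: "('a + 'a + 'a \<times> 'a) option"
  assume eq: "(case_option None left_type z, case_option None right_type z) =
   (case_option None left_type z', case_option None right_type z')"
  have ne: "left_type i = None \<Longrightarrow> right_type i = None \<Longrightarrow> False" for i :: "'a + 'a + 'a \<times> 'a"
    by (cases i rule: left_type.cases) auto
  have inj: "left_type i = left_type j \<Longrightarrow> right_type i = right_type j \<Longrightarrow> i = j" for i j :: "'a + 'a + 'a \<times> 'a"
    by (cases i rule: left_type.cases; cases j rule: left_type.cases) (auto intro: prod_eqI)
  show "z = z'"
  proof (cases z; cases z')
    fix i j assume "z = Some i" "z' = Some j"
    then show ?thesis using eq inj[of i j] by simp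
  next
    fix i assume "z = Some i" "z' = None"
    then show ?thesis using eq ne[of i] by simp
  next
    fix j assume "z = None" "z' = Some j"
    then show ?thesis using eq ne[of j] by simp
  qed simp
qed

lemma listk_mult_left: "listk (\<lambda>y z. i y * R y z) xs ys = prod_mset (image_mset i (mset xs)) * listk R xs ys"
  by (induction R xs ys rule: listk.induct) (auto simp: mult_ac)

lemma listk_row:
  assumes "\<And>y. (\<Sum>\<^sup>+z. R y z) \<le> 1"
  shows "(\<Sum>\<^sup>+ys. listk R xs ys) \<le> 1"
proof (induction xs)
  case Nil
  then show ?case by (simp add: tsum_list)
next
  case (Cons x xs)
  have "(\<Sum>\<^sup>+ys. listk R (x # xs) ys) = (\<Sum>\<^sup>+y. R x y) * (\<Sum>\<^sup>+ys. listk R xs ys)"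
    by (subst tsum_list) (simp add: tsum_cmult tsum_multc)
  also have "\<dots> \<le> 1 * 1" by (intro mult_mono assms Cons) auto
  finally show ?case by simp
qed

lemma symk_row:
  assumes "\<And>y. (\<Sum>\<^sup>+z. R y z) \<le> 1"
  shows "(\<Sum>\<^sup>+B. symk n R A B) \<le> 1"
proof -
  obtain xs where A: "A = mset xs" using ex_mset by metis
  have "(\<Sum>\<^sup>+B. symk n R A B) \<le> (\<Sum>\<^sup>+B. symk_from R xs B)"
    unfolding A symk_mset by (intro tsum_mono) auto
  also have "\<dots> = (\<Sum>\<^sup>+ys. listk R xs ys)"
    unfolding symk_from_tsum by (rule tsum_fibre[symmetric])
  also have "\<dots> \<le> 1" by (rule listk_row[OF assms])
  finally show ?thesis .
qed

lemma tsum_list_pair: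
  "(\<Sum>\<^sup>+zs. g (map f1 zs) (map f2 zs) * listk W (map f1 zs) (map f2 zs)) \<le> (\<Sum>\<^sup>+xs. \<Sum>\<^sup>+ys. g xs ys * listk W xs ys)"
  if "inj (\<lambda>z. (f1 z, f2 z))"
proof -
  have "inj (\<lambda>zs. (map f1 zs, map f2 zs))"
  proof (rule injI)
    fix zs zs' assume *: "(map f1 zs, map f2 zs) = (map f1 zs', map f2 zs')"
    then have len: "length zs = length zs'" by (metis length_map prod.inject)
    have "zs ! i = zs' ! i" if "i < length zs" for i
    proof -
      have "f1 (zs ! i) = f1 (zs' ! i)" "f2 (zs ! i) = f2 (zs' ! i)"
        using * \<open>i < length zs\<close> len by (metis nth_map prod.inject)+
      then show ?thesis using \<open>inj (\<lambda>z. (f1 z, f2 z))\<close> by (auto simp: inj_def)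
    qed
    then show "zs = zs'" using len by (simp add: list_eq_iff_nth_eq)
  qed
  from tsum_inj_le[OF this, of "\<lambda>u. g (fst u) (snd u) * listk W (fst u) (snd u)"]
  show ?thesis unfolding tsum_pair by simp
qed

lemma listk_map: "listk W (map f1 zs) (map f2 zs) = prod_mset (image_mset (\<lambda>z. W (f1 z) (f2 z)) (mset zs))"
  by (induction zs) auto

lemma ennreal_prod_mset:
  assumes "\<And>x. 0 \<le> f x"
  shows "ennreal (prod_mset (image_mset f A)) = prod_mset (image_mset (\<lambda>x. ennreal (f x)) A)"
proof (induction A)
  case (add x A)
  have "0 \<le> prod_mset (image_mset f A)" by (induction A) (auto simp: assms)
  then show ?case using add by (simp add: ennreal_mult assms)
qed simp

context particles
begin

text \<open>Closed form of \<open>slot_init\<close> times \<open>slot\<close>, see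
  \<open>pair_weight_eq\<close>. The term in \<open>\<epsilon>\<^sup>2\<close> comes from particles
  that are refreshed into new particles; it disappears in the Poisson limit.\<close>

definition pair_weight :: "real \<Rightarrow> ('a + 'a + 'a \<times> 'a) option \<Rightarrow> real" where
  "pair_weight \<epsilon> z = (case z of
      None \<Rightarrow> (1 - \<epsilon>) * (1 - (1 - s) * \<epsilon>)
    | Some (Inl x) \<Rightarrow> (1 - s) * \<epsilon> * (1 - \<epsilon>) * p x
    | Some (Inr (Inl y)) \<Rightarrow> (1 - s) * \<epsilon> * (1 - \<epsilon>) * p y
    | Some (Inr (Inr (x, y))) \<Rightarrow> s * \<epsilon> * P x y + (1 - s) * \<epsilon>\<^sup>2 * p x * p y)"

definition pair_rate :: "'a + 'a + 'a \<times> 'a \<Rightarrow> real" where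
  "pair_rate i = (case i of
      Inl x \<Rightarrow> lam * (1 - s) * p x
    | Inr (Inl y) \<Rightarrow> lam * (1 - s) * p y
    | Inr (Inr (x, y)) \<Rightarrow> lam * s * P x y)"

definition new_p :: "'a multiset \<Rightarrow> real" where
  "new_p M = poisson_weight lam (\<lambda>x. lam * p x) M"

text \<open>The constant \<open>2 - s\<close> is \<open>(1 - s) + (1 - s) + s\<close>, from the
  left-only, right-only and matched families when \<open>P\<close> has mass 1.\<close>

definition new_P :: "'a multiset \<Rightarrow> 'a multiset \<Rightarrow> ennreal" where
  "new_P M M' = (\<Sum>\<^sup>+C. if visible left_type C = M \<and> visible right_type C = M'
     then ennreal (poisson_weight (lam * (2 - s)) pair_rate C) else 0)"

lemma init_weight_nonneg: "0 \<le> \<epsilon> \<Longrightarrow> \<epsilon> \<le> 1 \<Longrightarrow> 0 \<le> init_weight \<epsilon> y"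
  by (cases y) (auto simp: init_weight_def p_nonneg)

lemma pair_weight_nonneg: "0 \<le> \<epsilon> \<Longrightarrow> \<epsilon> \<le> 1 \<Longrightarrow> 0 \<le> pair_weight \<epsilon> z"
proof -
  assume \<epsilon>: "0 \<le> \<epsilon>" "\<epsilon> \<le> 1"
  then have "(1 - s) * \<epsilon> \<le> 1" using s by (intro mult_le_one) auto
  then show ?thesis using \<epsilon> s unfolding pair_weight_def
    by (auto split: option.split sum.split prod.split intro!: mult_nonneg_nonneg add_nonneg_nonneg p_nonneg P_nonneg)
qed

lemma pair_rate_nonneg: "0 \<le> pair_rate i"
  unfolding pair_rate_def using s lam
  by (auto split: sum.split prod.split intro!: mult_nonneg_nonneg p_nonneg P_nonneg)

lemma pair_weight_eq:
  assumes \<epsilon>: "0 \<le> \<epsilon>" "\<epsilon> \<le> 1"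
  shows "ennreal (pair_weight \<epsilon> z) = slot_init \<epsilon> (case_option None left_type z) *
    slot \<epsilon> (case_option None left_type z) (case_option None right_type z)"
proof -
  have e: "0 \<le> 1 - \<epsilon>" "0 \<le> 1 - s" using \<epsilon> s by auto
  note nn = \<epsilon>(1) e s(1) p_nonneg P_nonneg mult_nonneg_nonneg add_nonneg_nonneg
  consider "z = None" | x where "z = Some (Inl x)" | y where "z = Some (Inr (Inl y))"
    | x y where "z = Some (Inr (Inr (x, y)))"
  proof (cases z)
    case (Some i)
    show thesis
      by (cases i rule: left_type.cases) (use that Some in \<open>metis prod.collapse\<close>)+
  qed (use that in blast)
  then show ?thesis
  proof cases
    case 1
    have "slot_init \<epsilon> None * slot \<epsilon> None None = ennreal ((1 - \<epsilon>) * (s + (1 - s) * (1 - \<epsilon>)))"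
      unfolding slot_def slot_init_def init_weight_def using nn
      by (simp add: ennreal_mult ennreal_plus)
    then show ?thesis using 1 by (simp add: pair_weight_def algebra_simps)
  next
    case (2 x)
    have "slot_init \<epsilon> (Some x) * slot \<epsilon> (Some x) None = ennreal ((\<epsilon> * p x) * ((1 - s) * (1 - \<epsilon>)))"
      unfolding slot_def slot_init_def init_weight_def using nn
      by (simp add: ennreal_mult)
    then show ?thesis using 2 by (simp add: pair_weight_def mult_ac)
  next
    case (3 y)
    have "slot_init \<epsilon> None * slot \<epsilon> None (Some y) = ennreal ((1 - \<epsilon>) * ((1 - s) * (\<epsilon> * p y)))"
      unfolding slot_def slot_init_def init_weight_def using nn
      by (simp add: ennreal_mult)
    then show ?thesis using 3 by (simp add: pair_weight_def mult_ac)
  next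
    case (4 x y)
    have "slot_init \<epsilon> (Some x) * slot \<epsilon> (Some x) (Some y)
      = ennreal ((\<epsilon> * p x) * (s * (P x y / p x) + (1 - s) * (\<epsilon> * p y)))"
    proof -
      have *: "ennreal (a * (b * c + d * e)) = ennreal a * (ennreal b * ennreal c + ennreal d * ennreal e)"
        if "0 \<le> a" "0 \<le> b" "0 \<le> c" "0 \<le> d" "0 \<le> e" for a b c d e :: real
        using that by (simp add: ennreal_mult ennreal_plus)
      show ?thesis
        unfolding slot_def slot_init_def init_weight_def K_def slot_keep.simps option.case
        by (rule *[symmetric]) (use nn in auto)
    qed
    also have "(\<epsilon> * p x) * (s * (P x y / p x) + (1 - s) * (\<epsilon> * p y)) = s * \<epsilon> * P x y + (1 - s) * \<epsilon>\<^sup>2 * p x * p y"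
    proof (cases "p x = 0")
      case True
      then have "P x y = 0" using P_le_p[of x y] P_nonneg[of x y] by simp
      then show ?thesis using True by simp
    next
      case False
      then show ?thesis by (simp add: field_simps power2_eq_square)
    qed
    finally show ?thesis using 4 by (simp add: pair_weight_def)
  qed
qed

text \<open>Both sides describe \<open>n\<close> slots at two consecutive times, unordered on the
  left and labelled on the right. All arrangements of \<open>pad n M\<close> contribute equally,
  which produces the multinomial coefficient.\<close>

lemma multinomial_symk:
  assumes \<epsilon>: "0 \<le> \<epsilon>" "\<epsilon> \<le> 1" and "size M \<le> n"
  shows "ennreal (multinomial_weight (init_weight \<epsilon>) n M) * symk n (slot \<epsilon>) (pad n M) B
    = (\<Sum>\<^sup>+xs. \<Sum>\<^sup>+ys. (if mset xs = pad n M \<and> mset ys = B then 1 else 0) * listk (\<lambda>y z. slot_init \<epsilon> y * slot \<epsilon> y z) xs ys)"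
proof -
  let ?W = "\<lambda>y z. slot_init \<epsilon> y * slot \<epsilon> y z" and ?A = "pad n M"
  have nn: "0 \<le> prod_mset (image_mset (init_weight \<epsilon>) A)" for A
    by (induction A) (auto simp: init_weight_nonneg \<epsilon>)
  have "(\<Sum>\<^sup>+xs. \<Sum>\<^sup>+ys. (if mset xs = ?A \<and> mset ys = B then 1 else 0) * listk ?W xs ys)
    = (\<Sum>\<^sup>+xs. if mset xs = ?A then (\<Sum>\<^sup>+ys. if mset ys = B then listk ?W xs ys else 0) else 0)"
    by (intro nn_integral_cong) (auto intro!: nn_integral_cong)
  also have "\<dots> = (\<Sum>\<^sup>+xs. if xs \<in> permutations_of_multiset ?A then
      prod_mset (image_mset (slot_init \<epsilon>) ?A) * symk n (slot \<epsilon>) ?A B else 0)"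
  proof (intro nn_integral_cong)
    fix xs
    show "(if mset xs = ?A then (\<Sum>\<^sup>+ys. if mset ys = B then listk ?W xs ys else 0) else 0)
      = (if xs \<in> permutations_of_multiset ?A then prod_mset (image_mset (slot_init \<epsilon>) ?A) * symk n (slot \<epsilon>) ?A B else 0)"
    proof (cases "mset xs = ?A")
      case True
      then have len: "length xs = n" using size_pad[OF assms(3)] by (metis size_mset)
      have "(\<Sum>\<^sup>+ys. if mset ys = B then listk ?W xs ys else 0)
        = (\<Sum>\<^sup>+ys. prod_mset (image_mset (slot_init \<epsilon>) ?A) * (if mset ys = B then listk (slot \<epsilon>) xs ys else 0))"
        unfolding listk_mult_left True by (intro nn_integral_cong) auto
      also have "\<dots> = prod_mset (image_mset (slot_init \<epsilon>) ?A) * symk n (slot \<epsilon>) ?A B"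
        unfolding tsum_cmult symk_from_tsum[symmetric] True[symmetric] symk_mset using len by simp
      finally show ?thesis using True by (simp add: permutations_of_multisetI)
    next
      case False
      then show ?thesis by (auto dest: permutations_of_multisetD)
    qed
  qed
  also have "\<dots> = of_nat (card (permutations_of_multiset ?A)) * (prod_mset (image_mset (slot_init \<epsilon>) ?A) * symk n (slot \<epsilon>) ?A B)"
    by (subst tsum_if_finite) auto
  also have "\<dots> = ennreal (multinomial_weight (init_weight \<epsilon>) n M) * symk n (slot \<epsilon>) ?A B"
    using nn[of ?A] by (simp add: multinomial_weight_def ennreal_mult slot_init_def[abs_def] ennreal_prod_mset
      init_weight_nonneg \<epsilon> ennreal_of_nat_eq_real_of_nat mult.assoc)
  finally show ?thesis by simp
qed

text \<open>Labelled slots are read as pairs of contents. The multiset \<open>C\<close> of pairs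
  determines both configurations, each list of pairs belongs to at most one \<open>C\<close>, and
  distinct lists of pairs give distinct pairs of lists.\<close>

lemma multinomial_pair_le:
  assumes \<epsilon>: "0 \<le> \<epsilon>" "\<epsilon> \<le> 1" and "size M \<le> n"
  shows "(\<Sum>\<^sup>+C. if size C \<le> n \<and> visible left_type C = M \<and> visible right_type C = M'
      then ennreal (multinomial_weight (pair_weight \<epsilon>) n C) else 0)
    \<le> ennreal (multinomial_weight (init_weight \<epsilon>) n M) * symk n (slot \<epsilon>) (pad n M) (pad n M')"
proof -
  let ?f1 = "case_option None left_type" and ?f2 = "case_option None right_type"
  let ?W = "\<lambda>y z. slot_init \<epsilon> y * slot \<epsilon> y z"
  let ?g = "\<lambda>xs ys. (if mset xs = pad n M \<and> mset ys = pad n M' then 1 else 0) :: ennreal"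
  let ?h = "\<lambda>zs. ?g (map ?f1 zs) (map ?f2 zs) * listk ?W (map ?f1 zs) (map ?f2 zs)"
  have nn: "0 \<le> prod_mset (image_mset (pair_weight \<epsilon>) A)" for A
    by (induction A) (auto simp: pair_weight_nonneg \<epsilon>)
  have "(\<Sum>\<^sup>+C. if size C \<le> n \<and> visible left_type C = M \<and> visible right_type C = M'
      then ennreal (multinomial_weight (pair_weight \<epsilon>) n C) else 0)
    \<le> (\<Sum>\<^sup>+C. \<Sum>\<^sup>+zs. if mset zs = pad n C then ?h zs else 0)"
  proof (intro tsum_mono)
    fix C
    show "(if size C \<le> n \<and> visible left_type C = M \<and> visible right_type C = M'
      then ennreal (multinomial_weight (pair_weight \<epsilon>) n C) else 0) \<le> (\<Sum>\<^sup>+zs. if mset zs = pad n C then ?h zs else 0)"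
    proof (cases "size C \<le> n \<and> visible left_type C = M \<and> visible right_type C = M'")
      case True
      have "(\<Sum>\<^sup>+zs. if mset zs = pad n C then ?h zs else 0)
        = (\<Sum>\<^sup>+zs. if zs \<in> permutations_of_multiset (pad n C) then
            prod_mset (image_mset (\<lambda>z. ennreal (pair_weight \<epsilon> z)) (pad n C)) else 0)"
      proof (intro nn_integral_cong)
        fix zs
        show "(if mset zs = pad n C then ?h zs else 0) = (if zs \<in> permutations_of_multiset (pad n C) then
            prod_mset (image_mset (\<lambda>z. ennreal (pair_weight \<epsilon> z)) (pad n C)) else 0)"
        proof (cases "mset zs = pad n C")
          case zs: True
          have "mset (map ?f1 zs) = pad n M" "mset (map ?f2 zs) = pad n M'"
            using True zs image_mset_pad[of C n left_type] image_mset_pad[of C n right_type] by simp_all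
          then have "?h zs = listk ?W (map ?f1 zs) (map ?f2 zs)" by simp
          also have "\<dots> = prod_mset (image_mset (\<lambda>z. ennreal (pair_weight \<epsilon> z)) (pad n C))"
            unfolding listk_map zs pair_weight_eq[OF \<epsilon>] ..
          finally show ?thesis using zs by (simp add: permutations_of_multisetI)
        next
          case False
          then show ?thesis by (auto dest: permutations_of_multisetD)
        qed
      qed
      also have "\<dots> = of_nat (card (permutations_of_multiset (pad n C))) *
          prod_mset (image_mset (\<lambda>z. ennreal (pair_weight \<epsilon> z)) (pad n C))"
        by (subst tsum_if_finite) auto
      also have "\<dots> = ennreal (multinomial_weight (pair_weight \<epsilon>) n C)"
        using nn[of "pad n C"] by (simp add: multinomial_weight_def ennreal_mult ennreal_prod_mset
          pair_weight_nonneg \<epsilon> ennreal_of_nat_eq_real_of_nat)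
      finally show ?thesis by simp
    next
      case False
      then show ?thesis unfolding if_not_P[OF False] by simp
    qed
  qed
  also have "\<dots> = (\<Sum>\<^sup>+zs. \<Sum>\<^sup>+C. if mset zs = pad n C then ?h zs else 0)" by (rule tsum_swap)
  also have "\<dots> \<le> (\<Sum>\<^sup>+zs. ?h zs)"
  proof (intro tsum_mono)
    fix zs
    have "(\<Sum>\<^sup>+C. if mset zs = pad n C then ?h zs else 0) \<le> (\<Sum>\<^sup>+A. if mset zs = A then ?h zs else 0)"
      by (rule tsum_inj_le[OF inj_pad, of "\<lambda>A. if mset zs = A then ?h zs else 0"])
    then show "(\<Sum>\<^sup>+C. if mset zs = pad n C then ?h zs else 0) \<le> ?h zs" by simp
  qed
  also have "\<dots> \<le> (\<Sum>\<^sup>+xs. \<Sum>\<^sup>+ys. ?g xs ys * listk ?W xs ys)"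
    by (rule tsum_list_pair) (rule left_right_type_inj)
  also have "\<dots> = ennreal (multinomial_weight (init_weight \<epsilon>) n M) * symk n (slot \<epsilon>) (pad n M) (pad n M')"
    by (rule multinomial_symk[symmetric]) (use assms in auto)
  finally show ?thesis .
qed

end

section \<open>The Poisson limit of the slot chain\<close>

context particles
begin

lemma eps_tendsto: "(\<lambda>n. lam / real n) \<longlonglongrightarrow> 0"
  by (rule lim_const_over_n)

lemma eventually_eps: "eventually (\<lambda>n. 0 \<le> lam / real n \<and> lam / real n \<le> 1 \<and> 0 < n) sequentially"
  using order_tendstoD(2)[OF eps_tendsto, of 1, simplified] eventually_gt_at_top[of 0]
  by eventually_elim (use lam in auto)

lemma power_one_minus_tendsto: "(\<lambda>n. (1 - x / real n) ^ n) \<longlonglongrightarrow> exp (- x)" for x :: real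
  using tendsto_exp_limit_sequentially[of "- x"] by simp

lemma init_multinomial_tendsto:
  "(\<lambda>n. multinomial_weight (init_weight (lam / real n)) n M) \<longlonglongrightarrow> new_p M"
  unfolding new_p_def
proof (rule multinomial_weight_tendsto)
  fix x
  have "eventually (\<lambda>n. lam * p x = real n * init_weight (lam / real n) (Some x)) sequentially"
    using eventually_eps by eventually_elim (simp add: init_weight_def)
  then show "(\<lambda>n. real n * init_weight (lam / real n) (Some x)) \<longlonglongrightarrow> lam * p x"
    by (rule Lim_transform_eventually[OF tendsto_const])
next
  have "(\<lambda>n. 1 - lam / real n) \<longlonglongrightarrow> 1 - 0" by (intro tendsto_intros eps_tendsto)
  then show "(\<lambda>n. init_weight (lam / real n) None) \<longlonglongrightarrow> 1" by (simp add: init_weight_def)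
  show "(\<lambda>n. init_weight (lam / real n) None ^ n) \<longlonglongrightarrow> exp (- lam)"
    unfolding init_weight_def using power_one_minus_tendsto[of lam] by simp
qed

lemma pair_multinomial_tendsto:
  "(\<lambda>n. multinomial_weight (pair_weight (lam / real n)) n C) \<longlonglongrightarrow> poisson_weight (lam * (2 - s)) pair_rate C"
proof (rule multinomial_weight_tendsto)
  fix i
  \<comment> \<open>The pair weight multiplied by \<open>n\<close>, with the factor
    \<open>lam / n\<close> already cancelled; the two agree once \<open>n > 0\<close>.\<close>
  define \<rho> where "\<rho> n = (case i of
      Inl x \<Rightarrow> lam * (1 - s) * (1 - lam / real n) * p x
    | Inr (Inl y) \<Rightarrow> lam * (1 - s) * (1 - lam / real n) * p y
    | Inr (Inr (x, y)) \<Rightarrow> lam * s * P x y + (1 - s) * lam * (lam / real n) * p x * p y)" for n :: nat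
  have "\<rho> \<longlonglongrightarrow> (case i of
      Inl x \<Rightarrow> lam * (1 - s) * (1 - 0) * p x
    | Inr (Inl y) \<Rightarrow> lam * (1 - s) * (1 - 0) * p y
    | Inr (Inr (x, y)) \<Rightarrow> lam * s * P x y + (1 - s) * lam * 0 * p x * p y)"
    unfolding \<rho>_def by (cases i rule: left_type.cases; simp only: sum.case split_beta; intro tendsto_intros eps_tendsto)
  moreover have "eventually (\<lambda>n. \<rho> n = real n * pair_weight (lam / real n) (Some i)) sequentially"
    using eventually_eps by eventually_elim
      (auto simp: \<rho>_def pair_weight_def field_simps power2_eq_square split: sum.split prod.split)
  ultimately have "(\<lambda>n. real n * pair_weight (lam / real n) (Some i)) \<longlonglongrightarrow> (case i of
      Inl x \<Rightarrow> lam * (1 - s) * (1 - 0) * p x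
    | Inr (Inl y) \<Rightarrow> lam * (1 - s) * (1 - 0) * p y
    | Inr (Inr (x, y)) \<Rightarrow> lam * s * P x y + (1 - s) * lam * 0 * p x * p y)"
    by (rule Lim_transform_eventually)
  then show "(\<lambda>n. real n * pair_weight (lam / real n) (Some i)) \<longlonglongrightarrow> pair_rate i"
    unfolding pair_rate_def by (cases i rule: left_type.cases) (simp_all add: split_beta)
next
  have "(\<lambda>n. (1 - lam / real n) * (1 - (1 - s) * (lam / real n))) \<longlonglongrightarrow> (1 - 0) * (1 - (1 - s) * 0)"
    by (intro tendsto_intros eps_tendsto)
  then show "(\<lambda>n. pair_weight (lam / real n) None) \<longlonglongrightarrow> 1" by (simp add: pair_weight_def)
  \<comment> \<open>The weight of a slot empty both times factorises, and the exponents
    \<open>lam\<close> and \<open>(1 - s) * lam\<close> add up to the total rate.\<close>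
  have "(\<lambda>n. (1 - lam / real n) ^ n * (1 - ((1 - s) * lam) / real n) ^ n) \<longlonglongrightarrow> exp (- lam) * exp (- ((1 - s) * lam))"
    by (intro tendsto_mult power_one_minus_tendsto)
  also have "exp (- lam) * exp (- ((1 - s) * lam)) = exp (- (lam * (2 - s)))"
    by (simp add: exp_add[symmetric] algebra_simps)
  finally show "(\<lambda>n. pair_weight (lam / real n) None ^ n) \<longlonglongrightarrow> exp (- (lam * (2 - s)))"
    by (simp add: pair_weight_def power_mult_distrib)
qed

abbreviation (input) slots :: "nat \<Rightarrow> 'a multiset \<Rightarrow> 'a multiset \<Rightarrow> ennreal" where
  "slots n M M' \<equiv> symk n (slot (lam / real n)) (pad n M) (pad n M')"

lemma new_p_nonneg: "0 \<le> new_p M"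
  unfolding new_p_def using lam p_nonneg by (intro poisson_weight_nonneg) auto

text \<open>The multiplier \<open>c\<close> serves two purposes: constantly 1 it gives the row
  bound, and as the inverse of the initial weight it gives the bound on the kernel.\<close>

lemma new_P_liminf:
  assumes "c \<longlonglongrightarrow> c0" "\<And>n. 0 \<le> c n"
  shows "ennreal c0 * new_P M M' \<le>
    liminf (\<lambda>n. ennreal (c n) * (ennreal (multinomial_weight (init_weight (lam / real n)) n M) * slots n M M'))"
proof -
  let ?v = "\<lambda>C. visible left_type C = M \<and> visible right_type C = M'"
  let ?f = "\<lambda>n C. if size C \<le> n \<and> ?v C then ennreal (multinomial_weight (pair_weight (lam / real n)) n C) else 0"
  have c0: "0 \<le> c0" using assms(2) by (intro LIMSEQ_le_const[OF assms(1)]) auto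
  have "ennreal c0 * new_P M M' = (\<Sum>\<^sup>+C. liminf (\<lambda>n. ennreal (c n) * ?f n C))"
    unfolding new_P_def tsum_cmult[symmetric]
  proof (intro nn_integral_cong)
    fix C
    show "ennreal c0 * (if ?v C then ennreal (poisson_weight (lam * (2 - s)) pair_rate C) else 0)
      = liminf (\<lambda>n. ennreal (c n) * ?f n C)"
    proof (cases "?v C")
      case True
      have "(\<lambda>n. ennreal (c n * multinomial_weight (pair_weight (lam / real n)) n C)) \<longlonglongrightarrow>
        ennreal (c0 * poisson_weight (lam * (2 - s)) pair_rate C)"
        by (intro tendsto_ennrealI tendsto_mult assms pair_multinomial_tendsto)
      moreover have "eventually (\<lambda>n. ennreal (c n * multinomial_weight (pair_weight (lam / real n)) n C)
          = ennreal (c n) * ?f n C) sequentially"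
        using eventually_ge_at_top[of "size C"] by eventually_elim (use True assms(2) in \<open>simp add: ennreal_mult'\<close>)
      ultimately have "(\<lambda>n. ennreal (c n) * ?f n C) \<longlonglongrightarrow> ennreal (c0 * poisson_weight (lam * (2 - s)) pair_rate C)"
        by (rule Lim_transform_eventually)
      from lim_imp_Liminf[OF _ this] show ?thesis using True c0 by (simp add: ennreal_mult')
    next
      case False
      then have "(\<lambda>n. ennreal (c n) * ?f n C) = (\<lambda>n. 0)" by (intro ext) auto
      then show ?thesis unfolding if_not_P[OF False] by (simp add: Liminf_const)
    qed
  qed
  also have "\<dots> \<le> liminf (\<lambda>n. \<Sum>\<^sup>+C. ennreal (c n) * ?f n C)" by (rule tsum_liminf)
  also have "\<dots> \<le> liminf (\<lambda>n. ennreal (c n) * (ennreal (multinomial_weight (init_weight (lam / real n)) n M) * slots n M M'))"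
  proof (rule Liminf_mono)
    show "eventually (\<lambda>n. (\<Sum>\<^sup>+C. ennreal (c n) * ?f n C) \<le>
      ennreal (c n) * (ennreal (multinomial_weight (init_weight (lam / real n)) n M) * slots n M M')) sequentially"
      using eventually_eps eventually_ge_at_top[of "size M"]
    proof eventually_elim
      case (elim n)
      then show ?case unfolding tsum_cmult by (intro mult_left_mono multinomial_pair_le) auto
    qed
  qed
  finally show ?thesis .
qed

text \<open>Rows of the slot chain have mass at most 1 and its initial weights converge to
  \<open>new_p\<close>, so Fatou's lemma reproduces the row inequality of the locale at the next
  depth.\<close>

lemma new_row: "(\<Sum>\<^sup>+M'. new_P M M') \<le> ennreal (new_p M)"
proof -
  let ?q = "\<lambda>n. ennreal (multinomial_weight (init_weight (lam / real n)) n M)"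
  have "new_P M M' \<le> liminf (\<lambda>n. ?q n * slots n M M')" for M'
    using new_P_liminf[of "\<lambda>_. 1" 1 M M'] by simp
  then have "(\<Sum>\<^sup>+M'. new_P M M') \<le> (\<Sum>\<^sup>+M'. liminf (\<lambda>n. ?q n * slots n M M'))" by (rule tsum_mono)
  also have "\<dots> \<le> liminf (\<lambda>n. \<Sum>\<^sup>+M'. ?q n * slots n M M')" by (rule tsum_liminf)
  also have "\<dots> \<le> liminf ?q"
  proof (rule Liminf_mono)
    show "eventually (\<lambda>n. (\<Sum>\<^sup>+M'. ?q n * slots n M M') \<le> ?q n) sequentially"
      using eventually_eps
    proof eventually_elim
      case (elim n)
      have "(\<Sum>\<^sup>+M'. slots n M M') \<le> (\<Sum>\<^sup>+B. symk n (slot (lam / real n)) (pad n M) B)"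
        by (rule tsum_inj_le[OF inj_pad])
      also have "\<dots> \<le> 1" using elim by (intro symk_row slot_row) auto
      finally show ?case unfolding tsum_cmult using mult_left_mono[of _ 1 "?q n"] by fastforce
    qed
  qed
  also have "\<dots> = ennreal (new_p M)"
    by (intro lim_imp_Liminf tendsto_ennrealI init_multinomial_tendsto) simp
  finally show ?thesis .
qed

lemma new_K_liminf: "ennreal (1 / new_p M) * new_P M M' \<le> liminf (\<lambda>n. slots n M M')"
proof (cases "new_p M = 0")
  case False
  let ?q = "\<lambda>n. multinomial_weight (init_weight (lam / real n)) n M"
  \<comment> \<open>For small \<open>n\<close> the ratio \<open>lam / n\<close> may exceed 1 and the
    weight may be negative; the absolute value keeps \<open>c n\<close> nonnegative for all
    \<open>n\<close>.\<close>
  define c where "c n = \<bar>1 / ?q n\<bar>" for n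
  have pos: "0 < new_p M" using False new_p_nonneg[of M] by simp
  have "c \<longlonglongrightarrow> \<bar>1 / new_p M\<bar>"
    unfolding c_def using False by (intro tendsto_rabs tendsto_divide tendsto_const init_multinomial_tendsto)
  then have "c \<longlonglongrightarrow> 1 / new_p M" using pos by simp
  from new_P_liminf[OF this]
  have "ennreal (1 / new_p M) * new_P M M' \<le> liminf (\<lambda>n. ennreal (c n) * (ennreal (?q n) * slots n M M'))"
    by (simp add: c_def)
  also have "\<dots> \<le> liminf (\<lambda>n. slots n M M')"
  proof (rule Liminf_mono)
    show "eventually (\<lambda>n. ennreal (c n) * (ennreal (?q n) * slots n M M') \<le> slots n M M') sequentially"
      using order_tendstoD(1)[OF init_multinomial_tendsto pos]
    proof eventually_elim
      case (elim n)
      then have "ennreal (c n) * ennreal (?q n) = 1"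
        unfolding c_def by (subst ennreal_mult[symmetric]) auto
      then show ?case by (simp add: mult.assoc[symmetric])
    qed
  qed
  finally show ?thesis .
qed simp

lemma new_ktrace:
  fixes \<theta> :: "'b \<Rightarrow> ennreal"
  assumes K: "\<And>j. 0 < j \<Longrightarrow> ennreal (s ^ j) * ktrace (kpow K j) \<le> (\<Sum>\<^sup>+g. \<theta> g ^ j)" and "0 < m"
  shows "ktrace (kpow (\<lambda>M M'. ennreal (1 / new_p M) * new_P M M') m) \<le> (\<Sum>\<^sup>+M. prod_mset (image_mset (\<lambda>g. \<theta> g ^ m) M))"
proof -
  have "ktrace (kpow (\<lambda>M M'. ennreal (1 / new_p M) * new_P M M') m)
      \<le> (\<Sum>\<^sup>+M. liminf (\<lambda>n. kpow (slots n) m M M))"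
    unfolding ktrace_def by (intro tsum_mono kpow_liminf new_K_liminf)
  also have "\<dots> \<le> liminf (\<lambda>n. \<Sum>\<^sup>+M. kpow (slots n) m M M)" by (rule tsum_liminf)
  also have "\<dots> \<le> liminf (\<lambda>n::nat. \<Sum>\<^sup>+M. prod_mset (image_mset (\<lambda>g. \<theta> g ^ m) M))"
  proof (rule Liminf_mono)
    show "eventually (\<lambda>n. (\<Sum>\<^sup>+M. kpow (slots n) m M M) \<le> (\<Sum>\<^sup>+M. prod_mset (image_mset (\<lambda>g. \<theta> g ^ m) M))) sequentially"
      using eventually_eps
    proof eventually_elim
      case (elim n)
      let ?S = "symk n (slot (lam / real n))"
      have "(\<Sum>\<^sup>+M. kpow (slots n) m M M) \<le> (\<Sum>\<^sup>+M. kpow ?S m (pad n M) (pad n M))"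
        by (intro tsum_mono kpow_inj_le inj_pad)
      also have "\<dots> \<le> ktrace (kpow ?S m)"
        unfolding ktrace_def by (rule tsum_inj_le[OF inj_pad, of "\<lambda>A. kpow ?S m A A"])
      also have "\<dots> \<le> (\<Sum>\<^sup>+M. prod_mset (image_mset (\<lambda>g. \<theta> g ^ m) M))"
        using elim assms by (intro ktrace_symk_slot_pow) auto
      finally show ?case .
    qed
  qed
  finally show ?thesis by (simp add: Liminf_const)
qed

end

section \<open>Families of independent Poisson variables\<close>

definition counts_mset :: "'i set \<Rightarrow> ('i \<Rightarrow> nat) \<Rightarrow> 'i multiset" where
  "counts_mset A N = (\<Sum>i\<in>{i\<in>A. N i \<noteq> 0}. replicate_mset (N i) i)"

lemma count_counts_mset:
  assumes "finite {i\<in>A. N i \<noteq> 0}"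
  shows "count (counts_mset A N) x = (if x \<in> A then N x else 0)"
proof -
  have "count (counts_mset A N) x = (\<Sum>i\<in>{i\<in>A. N i \<noteq> 0}. if i = x then N x else 0)"
    unfolding counts_mset_def count_sum by (intro sum.cong) auto
  also have "\<dots> = (if x \<in> A then N x else 0)" using assms by (simp add: sum.delta)
  finally show ?thesis .
qed

lemma counts_mset_infinite: "infinite {i\<in>A. N i \<noteq> 0} \<Longrightarrow> counts_mset A N = {#}"
  by (simp add: counts_mset_def)

text \<open>Also true for infinite support, where both sides default to 0. The inner sums of
  \<open>corr_pair\<close> thereby inherit measurability from \<open>counts_mset\<close>.\<close>

lemma size_counts_mset: "size (counts_mset A N) = (\<Sum>i\<in>{i\<in>A. N i \<noteq> 0}. N i)"
  unfolding counts_mset_def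
  by (cases "finite {i\<in>A. N i \<noteq> 0}") (simp_all add: size_multiset_sum)

lemma counts_mset_eq_iff:
  assumes "finite {i\<in>A. N i \<noteq> 0}"
  shows "counts_mset A N = C \<longleftrightarrow> (\<forall>i. (if i \<in> A then N i else 0) = count C i)"
  by (simp add: multiset_eq_iff count_counts_mset[OF assms])

text \<open>Multisets over a countable type are countable, so this form of finiteness is a countable
  combination of coordinate events and hence measurable.\<close>

lemma finite_iff_subset_mset: "finite B \<longleftrightarrow> (\<exists>C. \<forall>i. i \<in> B \<longrightarrow> i \<in># C)"
proof
  assume "finite B"
  then show "\<exists>C. \<forall>i. i \<in> B \<longrightarrow> i \<in># C" by (intro exI[of _ "mset_set B"]) simp
next
  assume "\<exists>C. \<forall>i. i \<in> B \<longrightarrow> i \<in># C"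
  then obtain C where "B \<subseteq> set_mset C" by blast
  then show "finite B" by (rule finite_subset) simp
qed

lemma measurable_counts_mset:
  fixes g :: "'i :: countable \<Rightarrow> 'w \<Rightarrow> nat"
  assumes "\<And>i. i \<in> A \<Longrightarrow> g i \<in> measurable M (count_space UNIV)"
  shows "(\<lambda>\<omega>. counts_mset A (\<lambda>i. g i \<omega>)) \<in> measurable M (count_space UNIV)"
proof -
  define h where "h i \<omega> = (if i \<in> A then g i \<omega> else 0)" for i \<omega>
  have [measurable]: "h i \<in> measurable M (count_space UNIV)" for i
    unfolding h_def using assms by (cases "i \<in> A") auto
  have fin: "finite {i\<in>A. g i \<omega> \<noteq> 0} \<longleftrightarrow> (\<exists>C. \<forall>i. h i \<omega> \<noteq> 0 \<longrightarrow> i \<in># C)" for \<omega>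
    unfolding finite_iff_subset_mset by (auto simp: h_def)
  have eq: "counts_mset A (\<lambda>i. g i \<omega>) = C \<longleftrightarrow>
      (\<exists>C. \<forall>i. h i \<omega> \<noteq> 0 \<longrightarrow> i \<in># C) \<and> (\<forall>i. h i \<omega> = count C i) \<or>
      \<not> (\<exists>C. \<forall>i. h i \<omega> \<noteq> 0 \<longrightarrow> i \<in># C) \<and> C = {#}" for \<omega> C
    unfolding fin[symmetric] by (cases "finite {i\<in>A. g i \<omega> \<noteq> 0}")
      (simp_all add: counts_mset_infinite counts_mset_eq_iff h_def eq_commute[of "{#}"])
  have "{\<omega> \<in> space M. counts_mset A (\<lambda>i. g i \<omega>) = C} \<in> sets M" for C
    unfolding eq by measurable
  then show ?thesis
    by (subst measurable_count_space_eq2_countable) (auto simp: vimage_def Int_def conj_commute)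
qed

lemma pmf_pois: "0 \<le> r \<Longrightarrow> pmf (pois r) k = exp (- r) * r ^ k / fact k"
  by (cases "r = 0") (auto simp: pois_def indicator_def power_0_left)

locale poisson_family =
  fixes I :: "'i :: countable set" and r :: "'i \<Rightarrow> real" and L :: real
  assumes rate_nonneg: "\<And>i. 0 \<le> r i" and rate_outside: "\<And>i. i \<notin> I \<Longrightarrow> r i = 0"
    and rate_sum: "(\<Sum>\<^sup>+i. ennreal (r i)) = ennreal L" and L_nonneg: "0 \<le> L"
begin

abbreviation (input) \<mu> :: "('i \<Rightarrow> nat) measure" where
  "\<mu> \<equiv> PiM I (\<lambda>i. measure_pmf (pois (r i)))"

lemma measurable_component [measurable]: "i \<in> I \<Longrightarrow> (\<lambda>\<omega>. \<omega> i) \<in> measurable \<mu> (count_space UNIV)"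
  using measurable_component_singleton[of i I "\<lambda>i. measure_pmf (pois (r i))"] by simp

lemma prob_space_\<mu>: "prob_space \<mu>"
  by (intro prob_space_PiM prob_space_measure_pmf)

lemma emeasure_cylinder:
  assumes "finite J" "J \<subseteq> I"
  shows "emeasure \<mu> {\<omega>\<in>space \<mu>. \<forall>i\<in>J. \<omega> i = N i} = ennreal (\<Prod>i\<in>J. exp (- r i) * r i ^ N i / fact (N i))"
proof -
  interpret product_prob_space "\<lambda>i. measure_pmf (pois (r i))" I
    by (intro product_prob_spaceI prob_space_measure_pmf)
  have "emeasure \<mu> {\<omega>\<in>space \<mu>. \<forall>i\<in>J. \<omega> i \<in> {N i}} = (\<Prod>i\<in>J. emeasure (measure_pmf (pois (r i))) {N i})"
    using assms by (intro emeasure_PiM_Collect) auto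
  also have "\<dots> = (\<Prod>i\<in>J. ennreal (exp (- r i) * r i ^ N i / fact (N i)))"
    by (intro prod.cong) (auto simp: emeasure_pmf_single pmf_pois rate_nonneg)
  also have "\<dots> = ennreal (\<Prod>i\<in>J. exp (- r i) * r i ^ N i / fact (N i))"
    by (intro prod_ennreal) (simp add: rate_nonneg)
  finally show ?thesis by simp
qed

definition initial :: "nat \<Rightarrow> 'i set" where
  "initial n = {i\<in>I. to_nat i < n}"

lemma finite_initial: "finite (initial n)"
proof (rule finite_imageD[of to_nat])
  show "finite (to_nat ` initial n)"
    by (rule finite_subset[of _ "{..<n}"]) (auto simp: initial_def)
qed (simp add: inj_on_def)

lemma sum_initial_tendsto: "(\<lambda>n. \<Sum>i\<in>initial n. r i) \<longlonglongrightarrow> L"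
proof -
  have "ennreal (\<Sum>i\<in>initial n. r i) = (\<Sum>\<^sup>+i. ennreal (r i) * indicator (initial n) i)" for n
    by (subst tsum_finite[OF finite_initial[of n]]) (auto simp: rate_nonneg)
  moreover have "(\<lambda>n. \<Sum>\<^sup>+i. ennreal (r i) * indicator (initial n) i) \<longlonglongrightarrow> (\<Sum>\<^sup>+i. ennreal (r i) * indicator I i)"
  proof (rule nn_integral_LIMSEQ)
    show "incseq (\<lambda>n i. ennreal (r i) * indicator (initial n) i)"
      by (auto simp: incseq_def le_fun_def initial_def split: split_indicator)
    show "(\<lambda>n. ennreal (r i) * indicator (initial n) i) \<longlonglongrightarrow> ennreal (r i) * indicator I i" for i
    proof (rule tendsto_eventually)
      show "eventually (\<lambda>n. ennreal (r i) * indicator (initial n) i = ennreal (r i) * indicator I i) sequentially"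
        using eventually_gt_at_top[of "to_nat i"] by eventually_elim (auto simp: initial_def split: split_indicator)
    qed
  qed simp_all
  moreover have "(\<Sum>\<^sup>+i. ennreal (r i) * indicator I i) = ennreal L"
    unfolding rate_sum[symmetric] by (intro nn_integral_cong) (auto simp: rate_outside split: split_indicator)
  ultimately have "(\<lambda>n. ennreal (\<Sum>i\<in>initial n. r i)) \<longlonglongrightarrow> ennreal L" by simp
  then show ?thesis
    by (rule tendsto_ennrealD) (auto simp: L_nonneg rate_nonneg intro!: sum_nonneg always_eventually)
qed

text \<open>The event is a decreasing intersection of finite cylinders. Once
  \<open>initial n\<close> contains the support of \<open>C\<close>, further indices contribute only
  factors \<open>exp (- r i)\<close>, and their total product tends to
  \<open>exp (- L)\<close>.\<close>

lemma emeasure_point: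
  assumes "set_mset C \<subseteq> I"
  shows "emeasure \<mu> {\<omega>\<in>space \<mu>. \<forall>i\<in>I. \<omega> i = count C i} = ennreal (poisson_weight L r C)"
proof -
  interpret prob_space \<mu> by (rule prob_space_\<mu>)
  define E where "E n = {\<omega>\<in>space \<mu>. \<forall>i\<in>initial n. \<omega> i = count C i}" for n
  have sub: "initial n \<subseteq> I" for n by (auto simp: initial_def)
  have E: "E n \<in> sets \<mu>" for n
    unfolding E_def using finite_initial[of n] sub[of n] by (intro sets.sets_Collect_finite_All) auto
  have "(\<Inter>n. E n) = {\<omega>\<in>space \<mu>. \<forall>i\<in>I. \<omega> i = count C i}"
    by (auto simp: E_def initial_def)
  moreover have "decseq E"
    by (auto simp: decseq_def E_def initial_def)
  then have "(\<lambda>n. emeasure \<mu> (E n)) \<longlonglongrightarrow> emeasure \<mu> (\<Inter>n. E n)"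
    using E by (intro Lim_emeasure_decseq) auto
  moreover have "(\<lambda>n. emeasure \<mu> (E n)) \<longlonglongrightarrow> ennreal (poisson_weight L r C)"
  proof -
    have lim: "(\<lambda>n. exp (- (\<Sum>i\<in>initial n. r i)) * prod_mset (image_mset r C) / (\<Prod>i\<in>set_mset C. fact (count C i))) \<longlonglongrightarrow> poisson_weight L r C"
      unfolding poisson_weight_def by (intro tendsto_intros sum_initial_tendsto) auto
    have ev: "eventually (\<lambda>n. ennreal (exp (- (\<Sum>i\<in>initial n. r i)) * prod_mset (image_mset r C) / (\<Prod>i\<in>set_mset C. fact (count C i)))
       = emeasure \<mu> (E n)) sequentially"
    proof -
      obtain m where m: "\<And>i. i \<in># C \<Longrightarrow> to_nat i < m"
        using finite_nat_set_iff_bounded[of "to_nat ` set_mset C"] by auto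
      show ?thesis using eventually_ge_at_top[of m]
      proof eventually_elim
        case (elim n)
        have C: "set_mset C \<subseteq> initial n"
          using assms m elim by (force simp: initial_def)
        have "(\<Prod>i\<in>initial n. r i ^ count C i / fact (count C i)) = (\<Prod>i\<in>set_mset C. r i ^ count C i / fact (count C i))"
          using C finite_initial[of n] by (intro prod.mono_neutral_right) (auto simp: not_in_iff)
        moreover have "(\<Prod>i\<in>initial n. exp (- r i)) = exp (- (\<Sum>i\<in>initial n. r i))"
          by (simp add: exp_sum[OF finite_initial, symmetric] sum_negf)
        moreover have "(\<Prod>i\<in>initial n. exp (- r i) * r i ^ count C i / fact (count C i))
          = (\<Prod>i\<in>initial n. exp (- r i)) * (\<Prod>i\<in>initial n. r i ^ count C i / fact (count C i))"
          unfolding prod.distrib[symmetric] by simp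
        ultimately have "(\<Prod>i\<in>initial n. exp (- r i) * r i ^ count C i / fact (count C i))
          = exp (- (\<Sum>i\<in>initial n. r i)) * ((\<Prod>i\<in>set_mset C. r i ^ count C i) / (\<Prod>i\<in>set_mset C. fact (count C i)))"
          by (simp only: prod_dividef)
        then show ?case
          unfolding E_def emeasure_cylinder[OF finite_initial sub] by (simp add: image_prod_mset_multiplicity)
      qed
    qed
    show ?thesis by (rule Lim_transform_eventually[OF tendsto_ennrealI[OF lim] ev])
  qed
  ultimately show ?thesis using LIMSEQ_unique by metis
qed

text \<open>Borel-Cantelli: index \<open>i\<close> is hit with probability
  \<open>1 - exp (- r i)\<close>, at most \<open>r i\<close>, so the expected number of indices hit
  is at most \<open>L\<close>.\<close>

lemma AE_finite_support: "AE \<omega> in \<mu>. finite {i\<in>I. \<omega> i \<noteq> 0}"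
proof -
  interpret prob_space \<mu> by (rule prob_space_\<mu>)
  define B where "B i = (if i \<in> I then {\<omega>\<in>space \<mu>. \<omega> i \<noteq> 0} else {})" for i
  have B [measurable]: "B i \<in> sets \<mu>" for i unfolding B_def by auto
  have "emeasure \<mu> (B i) \<le> ennreal (r i)" for i
  proof (cases "i \<in> I")
    case True
    have "prob {\<omega>\<in>space \<mu>. \<omega> i = 0} = exp (- r i)"
      using emeasure_cylinder[of "{i}" "\<lambda>_. 0"] True by (simp add: emeasure_eq_measure)
    moreover have "B i = space \<mu> - {\<omega>\<in>space \<mu>. \<omega> i = 0}" using True by (auto simp: B_def)
    ultimately have "prob (B i) = 1 - exp (- r i)" using True by (simp add: prob_compl)
    also have "\<dots> \<le> r i" using exp_ge_add_one_self[of "- r i"] by simp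
    finally show ?thesis by (simp add: emeasure_eq_measure ennreal_leI)
  qed (simp add: B_def)
  then have "(\<Sum>\<^sup>+i. emeasure \<mu> (B i)) \<le> ennreal L"
    unfolding rate_sum[symmetric] by (rule tsum_mono)
  moreover have "(\<integral>\<^sup>+\<omega>. (\<Sum>\<^sup>+i. indicator (B i) \<omega>) \<partial>\<mu>) = (\<Sum>\<^sup>+i. emeasure \<mu> (B i))"
    by (subst nn_integral_count_space_nn_integral) simp_all
  ultimately have "(\<integral>\<^sup>+\<omega>. (\<Sum>\<^sup>+i. indicator (B i) \<omega>) \<partial>\<mu>) \<noteq> \<infinity>"
    by (auto simp: top_unique)
  moreover have "(\<lambda>\<omega>. \<Sum>\<^sup>+i. indicator (B i) \<omega>) \<in> borel_measurable \<mu>"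
  proof -
    \<comment> \<open>Measurability in \<open>\<omega>\<close> is obtained by writing the unordered
      sum over a countable type as a series along \<open>to_nat\<close>.\<close>
    have eq: "(\<Sum>\<^sup>+i. indicator (B i) \<omega>) = (\<Sum>n. indicator (B (from_nat n)) \<omega> * indicator (range (to_nat :: 'i \<Rightarrow> nat)) n)" for \<omega>
      using tsum_inj_eq[of "to_nat :: 'i \<Rightarrow> nat" "\<lambda>n. indicator (B (from_nat n)) \<omega>"]
      by (simp add: nn_integral_count_space_nat)
    show ?thesis unfolding eq by measurable
  qed
  ultimately have "AE \<omega> in \<mu>. (\<Sum>\<^sup>+i. indicator (B i) \<omega>) \<noteq> \<infinity>"
    by (intro nn_integral_PInf_AE)
  then show ?thesis
  proof (rule AE_mp, intro AE_I2 impI)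
    fix \<omega> assume \<omega>: "\<omega> \<in> space \<mu>" and fin: "(\<Sum>\<^sup>+i. indicator (B i) \<omega>) \<noteq> \<infinity>"
    have "(\<Sum>\<^sup>+i. indicator (B i) \<omega>) = (\<Sum>\<^sup>+i. indicator {i. \<omega> \<in> B i} i)"
      by (intro nn_integral_cong) (auto split: split_indicator)
    also have "\<dots> = emeasure (count_space UNIV) {i. \<omega> \<in> B i}" by simp
    finally have "finite {i. \<omega> \<in> B i}"
      using fin by (metis emeasure_count_space_infinite subset_UNIV)
    moreover have "{i\<in>I. \<omega> i \<noteq> 0} = {i. \<omega> \<in> B i}" using \<omega> by (auto simp: B_def)
    ultimately show "finite {i\<in>I. \<omega> i \<noteq> 0}" by simp
  qed
qed

text \<open>Covers both tree models: the map has to factor through the counting multiset only for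
  finite support, and the null event on which default values occur is discarded.\<close>

lemma emeasure_distr_counts:
  fixes h :: "('i \<Rightarrow> nat) \<Rightarrow> 'b :: countable"
  assumes h: "h \<in> measurable \<mu> (count_space UNIV)"
    and H: "\<And>\<omega>. finite {i\<in>I. \<omega> i \<noteq> 0} \<Longrightarrow> h \<omega> = H (counts_mset I \<omega>)"
  shows "emeasure (distr \<mu> (count_space UNIV) h) {b} =
    (\<Sum>\<^sup>+C. if H C = b then ennreal (poisson_weight L r C) else 0)"
proof -
  define E where "E C = (if H C = b \<and> set_mset C \<subseteq> I then {\<omega>\<in>space \<mu>. \<forall>i\<in>I. \<omega> i = count C i} else {})" for C
  have sing: "{\<omega>\<in>space \<mu>. \<forall>i\<in>I. \<omega> i = count C i} \<in> sets \<mu>" for C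
    by (intro sets.sets_Collect_countable_All') auto
  have E: "E C \<in> sets \<mu>" for C unfolding E_def using sing by auto
  have "emeasure (distr \<mu> (count_space UNIV) h) {b} = emeasure \<mu> (h -` {b} \<inter> space \<mu>)"
    using h by (intro emeasure_distr) auto
  also have "\<dots> = emeasure \<mu> (\<Union>C. E C)"
  proof (rule emeasure_eq_AE)
    show "AE \<omega> in \<mu>. (\<omega> \<in> h -` {b} \<inter> space \<mu>) = (\<omega> \<in> (\<Union>C. E C))"
    proof (rule AE_mp[OF AE_finite_support], intro AE_I2 impI)
      fix \<omega> assume \<omega>: "\<omega> \<in> space \<mu>" and fin: "finite {i\<in>I. \<omega> i \<noteq> 0}"
      show "(\<omega> \<in> h -` {b} \<inter> space \<mu>) = (\<omega> \<in> (\<Union>C. E C))"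
      proof
        assume "\<omega> \<in> h -` {b} \<inter> space \<mu>"
        then have "H (counts_mset I \<omega>) = b" using H[OF fin] by simp
        moreover have "set_mset (counts_mset I \<omega>) \<subseteq> I"
          unfolding counts_mset_def using fin by (auto simp: set_mset_sum split: if_splits)
        ultimately have "\<omega> \<in> E (counts_mset I \<omega>)"
          using \<omega> by (simp add: E_def count_counts_mset[OF fin])
        then show "\<omega> \<in> (\<Union>C. E C)" by blast
      next
        assume "\<omega> \<in> (\<Union>C. E C)"
        then obtain C where C: "\<omega> \<in> E C" by blast
        then have C': "H C = b" "set_mset C \<subseteq> I" "\<forall>i\<in>I. \<omega> i = count C i"
          by (auto simp: E_def split: if_splits)
        have "counts_mset I \<omega> = C"
          unfolding counts_mset_eq_iff[OF fin] using C' by (auto simp: not_in_iff[symmetric])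
        then show "\<omega> \<in> h -` {b} \<inter> space \<mu>" using H[OF fin] C' \<omega> by simp
      qed
    qed
    show "h -` {b} \<inter> space \<mu> \<in> sets \<mu>" using h by (rule measurable_sets) simp
    show "(\<Union>C. E C) \<in> sets \<mu>" using E by (intro sets.countable_UN) auto
  qed
  also have "\<dots> = (\<Sum>\<^sup>+C. emeasure \<mu> (E C))"
  proof (rule emeasure_UN_countable)
    show "disjoint_family_on E UNIV"
      unfolding disjoint_family_on_def
    proof (intro ballI impI equals0I)
      fix C D \<omega> assume "C \<noteq> D" and "\<omega> \<in> E C \<inter> E D"
      then have "\<And>i. count C i = count D i"
        unfolding E_def by (auto split: if_splits) (metis count_inI subsetD)
      then show False using \<open>C \<noteq> D\<close> by (simp add: multiset_eq_iff)
    qed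
  qed (use E in auto)
  also have "\<dots> = (\<Sum>\<^sup>+C. if H C = b then ennreal (poisson_weight L r C) else 0)"
  proof (intro nn_integral_cong)
    fix C
    \<comment> \<open>A multiset that leaves \<open>I\<close> contains an index of rate 0, which
      contributes a factor 0.\<close>
    have "poisson_weight L r C = 0" if nsub: "\<not> set_mset C \<subseteq> I"
    proof -
      obtain i where "i \<in># C" "r i = 0" using nsub rate_outside by blast
      then have "0 \<in># image_mset r C" by (metis image_eqI set_image_mset)
      then show ?thesis unfolding poisson_weight_def by (simp add: prod_mset_zero_iff)
    qed
    then show "emeasure \<mu> (E C) = (if H C = b then ennreal (poisson_weight L r C) else 0)"
      by (auto simp: E_def emeasure_point)
  qed
  finally show ?thesis .
qed

end

section \<open>Point masses of the tree models\<close>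

lemma tsum_measure_singleton:
  fixes M :: "'a :: countable measure"
  assumes "finite_measure M" "sets M = UNIV"
  shows "emeasure M A = (\<Sum>\<^sup>+x. ennreal (measure M {x}) * indicator A x)"
proof -
  interpret finite_measure M by fact
  have "emeasure M A = (\<integral>\<^sup>+x. emeasure M {x} \<partial>count_space A)"
    using assms(2) by (intro emeasure_countable_singleton) auto
  also have "\<dots> = (\<integral>\<^sup>+x. emeasure M {x} * indicator A x \<partial>count_space UNIV)"
    by (cases "A = UNIV") (simp_all add: nn_integral_count_space_indicator)
  finally show ?thesis by (simp add: emeasure_eq_measure)
qed

lemma tsum_prob:
  fixes M :: "'a :: countable measure"
  assumes "prob_space M" "sets M = UNIV"
  shows "(\<Sum>\<^sup>+x. ennreal (measure M {x})) = 1"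
proof -
  interpret prob_space M by fact
  have "space M = UNIV" using sets_eq_imp_space_eq[of M "count_space UNIV"] assms(2) by simp
  then show ?thesis
    using tsum_measure_singleton[of M UNIV] assms(2) emeasure_space_1 finite_measure_axioms by simp
qed

lemma tree_of_counts_eq: "tree_of_counts A N = Node (counts_mset A N)"
  by (simp add: tree_of_counts_def counts_mset_def)

lemma measurable_tree_of_counts:
  assumes "\<And>i. i \<in> A \<Longrightarrow> g i \<in> measurable M (count_space UNIV)"
  shows "(\<lambda>\<omega>. tree_of_counts A (\<lambda>i. g i \<omega>)) \<in> measurable M (count_space UNIV)"
  unfolding tree_of_counts_eq
  by (rule measurable_compose[OF measurable_counts_mset[OF assms]]) simp_all

lemma measurable_corr_pair:
  assumes "\<And>i. i \<in> cidx_set d \<Longrightarrow> (\<lambda>F. F i) \<in> measurable M (count_space UNIV)"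
  shows "corr_pair d \<in> measurable M (count_space UNIV)"
proof -
  have idx: "Inl x \<in> cidx_set d" "Inr (Inl x) \<in> cidx_set d" if "x \<in> X d" for x
    using that by (auto simp: cidx_set_def)
  have idx2: "Inr (Inr (x, y)) \<in> cidx_set d" if "x \<in> X d" "y \<in> X d" for x y
    using that by (auto simp: cidx_set_def)
  have plus: "(\<lambda>\<omega>. f \<omega> + h \<omega>) \<in> measurable M (count_space UNIV)"
    if "f \<in> measurable M (count_space UNIV)" "h \<in> measurable M (count_space UNIV)" for f h :: "_ \<Rightarrow> nat"
    using that by measurable
  have sum1: "(\<lambda>F. \<Sum>y\<in>{y\<in>X d. F (Inr (Inr (x, y))) \<noteq> 0}. F (Inr (Inr (x, y)))) \<in> measurable M (count_space UNIV)"
    if "x \<in> X d" for x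
    unfolding size_counts_mset[of "X d" "\<lambda>y. F (Inr (Inr (x, y)))" for F, symmetric]
    by (rule measurable_compose[OF measurable_counts_mset[where g = "\<lambda>y F. F (Inr (Inr (x, y)))"]])
      (use assms idx2 that in auto)
  have sum2: "(\<lambda>F. \<Sum>x\<in>{x\<in>X d. F (Inr (Inr (x, y))) \<noteq> 0}. F (Inr (Inr (x, y)))) \<in> measurable M (count_space UNIV)"
    if "y \<in> X d" for y
    unfolding size_counts_mset[of "X d" "\<lambda>x. F (Inr (Inr (x, y)))" for F, symmetric]
    by (rule measurable_compose[OF measurable_counts_mset[where g = "\<lambda>x F. F (Inr (Inr (x, y)))"]])
      (use assms idx2 that in auto)
  let ?l = "\<lambda>F. tree_of_counts (X d) (\<lambda>\<tau>. F (Inl \<tau>) + (\<Sum>\<tau>'\<in>{\<tau>'\<in>X d. F (Inr (Inr (\<tau>, \<tau>'))) \<noteq> 0}. F (Inr (Inr (\<tau>, \<tau>')))))"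
  let ?r = "\<lambda>F. tree_of_counts (X d) (\<lambda>\<tau>'. F (Inr (Inl \<tau>')) + (\<Sum>\<tau>\<in>{\<tau>\<in>X d. F (Inr (Inr (\<tau>, \<tau>'))) \<noteq> 0}. F (Inr (Inr (\<tau>, \<tau>')))))"
  have "?l \<in> measurable M (count_space UNIV)" "?r \<in> measurable M (count_space UNIV)"
    by (intro measurable_tree_of_counts plus sum1 sum2 assms idx; assumption)+
  then have "(\<lambda>F. (?l F, ?r F)) \<in> measurable M (count_space UNIV \<Otimes>\<^sub>M count_space UNIV)"
    by (rule measurable_Pair)
  then show ?thesis
    by (simp add: corr_pair_def[abs_def] pair_measure_countable)
qed

lemma sets_GW [simp]: "sets (GW lam d) = UNIV"
  by (cases d) auto

lemma sets_Pcorr [simp]: "sets (Pcorr lam s d) = UNIV"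
  by (cases d) auto

lemma measurable_PiM_pois:
  "i \<in> I \<Longrightarrow> (\<lambda>\<omega>. \<omega> i) \<in> measurable (PiM I (\<lambda>i. measure_pmf (q i))) (count_space UNIV)"
  using measurable_component_singleton[of i I "\<lambda>i. measure_pmf (q i)"] by simp

lemma measurable_tree_of_counts_PiM:
  "tree_of_counts I \<in> measurable (PiM I (\<lambda>i. measure_pmf (q i))) (count_space UNIV)"
  by (rule measurable_tree_of_counts[of I "\<lambda>i \<omega>. \<omega> i"]) (rule measurable_PiM_pois)

lemma prob_space_GW: "prob_space (GW lam d)"
proof (cases d)
  case 0
  then show ?thesis by (simp add: prob_space_return)
next
  case (Suc n)
  interpret prob_space "PiM (X n) (\<lambda>\<tau>. measure_pmf (pois (lam * measure (GW lam n) {\<tau>})))"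
    by (intro prob_space_PiM prob_space_measure_pmf)
  show ?thesis unfolding Suc GW.simps by (rule prob_space_distr) (rule measurable_tree_of_counts_PiM)
qed

lemma prob_space_Pcorr: "prob_space (Pcorr lam s d)"
proof (cases d)
  case 0
  then show ?thesis by (simp add: prob_space_return)
next
  case (Suc n)
  show ?thesis unfolding Suc Pcorr.simps
    by (intro prob_space.prob_space_distr prob_space_PiM prob_space_measure_pmf measurable_corr_pair measurable_PiM_pois)
qed

abbreviation gw :: "real \<Rightarrow> nat \<Rightarrow> utree \<Rightarrow> real" where
  "gw lam d t \<equiv> measure (GW lam d) {t}"

abbreviation corr :: "real \<Rightarrow> real \<Rightarrow> nat \<Rightarrow> utree \<Rightarrow> utree \<Rightarrow> real" where
  "corr lam s d t t' \<equiv> measure (Pcorr lam s d) {(t, t')}"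

lemma gw_sum: "(\<Sum>\<^sup>+t. ennreal (gw lam d t)) = 1"
  by (rule tsum_prob[OF prob_space_GW]) simp

lemma corr_sum: "(\<Sum>\<^sup>+t. \<Sum>\<^sup>+t'. ennreal (corr lam s d t t')) = 1"
  unfolding tsum_pair[of "\<lambda>t t'. ennreal (corr lam s d t t')"]
  using tsum_prob[OF prob_space_Pcorr, of lam s d] by simp

text \<open>Vanishing outside \<open>X d\<close> is an assumption here because
  \<open>gw_outside\<close> is itself proved by induction through this formula.\<close>

lemma gw_Suc_aux:
  assumes "0 < lam" "\<And>t. t \<notin> X d \<Longrightarrow> gw lam d t = 0"
  shows "gw lam (Suc d) (Node M) = poisson_weight lam (\<lambda>t. lam * gw lam d t) M"
proof -
  interpret poisson_family "X d" "\<lambda>t. lam * gw lam d t" lam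
    using assms by unfold_locales (auto simp: ennreal_mult tsum_cmult gw_sum)
  interpret G: prob_space "GW lam (Suc d)" by (rule prob_space_GW)
  have "emeasure (GW lam (Suc d)) {Node M} = (\<Sum>\<^sup>+C. if Node C = Node M then ennreal (poisson_weight lam (\<lambda>t. lam * gw lam d t) C) else 0)"
    unfolding GW.simps
    by (rule emeasure_distr_counts) (rule measurable_tree_of_counts_PiM, rule tree_of_counts_eq)
  then have "ennreal (gw lam (Suc d) (Node M)) = ennreal (poisson_weight lam (\<lambda>t. lam * gw lam d t) M)"
    by (simp add: G.emeasure_eq_measure del: GW.simps)
  then show ?thesis
    by (subst (asm) ennreal_inj) (auto intro!: poisson_weight_nonneg simp: rate_nonneg simp del: GW.simps)
qed

lemma gw_outside:
  assumes "0 < lam"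
  shows "t \<notin> X d \<Longrightarrow> gw lam d t = 0"
proof (induction d arbitrary: t)
  case 0
  then have "t \<noteq> leaf" by (auto simp: X_def)
  then show ?case by (simp add: measure_return)
next
  case (Suc d)
  obtain M where t: "t = Node M" by (cases t)
  then obtain x where "x \<in># M" "x \<notin> X d" using Suc.prems by (auto simp: X_def)
  then have "0 \<in># image_mset (\<lambda>t. lam * gw lam d t) M"
    using Suc.IH[of x] by (auto intro!: image_eqI[of _ _ x])
  then have "poisson_weight lam (\<lambda>t. lam * gw lam d t) M = 0"
    unfolding poisson_weight_def by (simp add: prod_mset_zero_iff del: GW.simps)
  moreover have "gw lam (Suc d) t = poisson_weight lam (\<lambda>t. lam * gw lam d t) M"
    unfolding t by (rule gw_Suc_aux[OF assms Suc.IH])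
  ultimately show ?case by (simp only:)
qed

lemma gw_Suc: "0 < lam \<Longrightarrow> gw lam (Suc d) (Node M) = poisson_weight lam (\<lambda>t. lam * gw lam d t) M"
  by (intro gw_Suc_aux gw_outside)

lemma count_visible: "count (visible g C) x = (\<Sum>i\<in>{i\<in>set_mset C. g i = Some x}. count C i)"
proof -
  have "count (unpad A) x = count A (Some x)" for A
  proof (induction A)
    case (add y A)
    then show ?case by (cases y) auto
  qed simp
  then have "count (visible g C) x = (\<Sum>i\<in>g -` {Some x} \<inter> set_mset C. count C i)"
    by (simp add: visible_def count_image_mset)
  also have "g -` {Some x} \<inter> set_mset C = {i\<in>set_mset C. g i = Some x}" by auto
  finally show ?thesis .
qed

lemma count_visible_left:
  "count (visible left_type C) x = count C (Inl x) + (\<Sum>y\<in>{y. count C (Inr (Inr (x, y))) \<noteq> 0}. count C (Inr (Inr (x, y))))"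
proof -
  let ?Y = "{y. count C (Inr (Inr (x, y))) \<noteq> 0}"
  have inj: "inj_on (\<lambda>y. Inr (Inr (x, y))) ?Y" by (auto simp: inj_on_def)
  have "(\<lambda>y. Inr (Inr (x, y))) ` ?Y \<subseteq> set_mset C" by auto
  then have fin: "finite ?Y" by (rule inj_on_finite[OF inj]) simp
  have "(\<Sum>i\<in>{i\<in>set_mset C. left_type i = Some x}. count C i)
    = (\<Sum>i\<in>insert (Inl x) ((\<lambda>y. Inr (Inr (x, y))) ` ?Y). count C i)"
  proof (rule sum.mono_neutral_left)
    show "{i \<in> set_mset C. left_type i = Some x} \<subseteq> insert (Inl x) ((\<lambda>y. Inr (Inr (x, y))) ` ?Y)"
    proof
      fix i assume i: "i \<in> {i \<in> set_mset C. left_type i = Some x}"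
      then show "i \<in> insert (Inl x) ((\<lambda>y. Inr (Inr (x, y))) ` ?Y)"
        by (cases i rule: left_type.cases) (auto simp: image_iff)
    qed
  qed (use fin in \<open>auto simp: not_in_iff\<close>)
  also have "\<dots> = count C (Inl x) + (\<Sum>y\<in>?Y. count C (Inr (Inr (x, y))))"
    unfolding sum.reindex[OF inj, unfolded o_def, symmetric] using fin by (intro sum.insert) auto
  finally show ?thesis by (simp only: count_visible)
qed

lemma count_visible_right:
  "count (visible right_type C) y = count C (Inr (Inl y)) + (\<Sum>x\<in>{x. count C (Inr (Inr (x, y))) \<noteq> 0}. count C (Inr (Inr (x, y))))"
proof -
  let ?Y = "{x. count C (Inr (Inr (x, y))) \<noteq> 0}"
  have inj: "inj_on (\<lambda>x. Inr (Inr (x, y))) ?Y" by (auto simp: inj_on_def)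
  have "(\<lambda>x. Inr (Inr (x, y))) ` ?Y \<subseteq> set_mset C" by auto
  then have fin: "finite ?Y" by (rule inj_on_finite[OF inj]) simp
  have "(\<Sum>i\<in>{i\<in>set_mset C. right_type i = Some y}. count C i)
    = (\<Sum>i\<in>insert (Inr (Inl y)) ((\<lambda>x. Inr (Inr (x, y))) ` ?Y). count C i)"
  proof (rule sum.mono_neutral_left)
    show "{i \<in> set_mset C. right_type i = Some y} \<subseteq> insert (Inr (Inl y)) ((\<lambda>x. Inr (Inr (x, y))) ` ?Y)"
    proof
      fix i assume i: "i \<in> {i \<in> set_mset C. right_type i = Some y}"
      then show "i \<in> insert (Inr (Inl y)) ((\<lambda>x. Inr (Inr (x, y))) ` ?Y)"
        by (cases i rule: left_type.cases) (auto simp: image_iff)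
    qed
  qed (use fin in \<open>auto simp: not_in_iff\<close>)
  also have "\<dots> = count C (Inr (Inl y)) + (\<Sum>x\<in>?Y. count C (Inr (Inr (x, y))))"
    unfolding sum.reindex[OF inj, unfolded o_def, symmetric] using fin by (intro sum.insert) auto
  finally show ?thesis by (simp only: count_visible)
qed

lemma counts_mset_eqI:
  assumes "\<And>x. x \<in> A \<Longrightarrow> N x = count C x" "set_mset C \<subseteq> A"
  shows "counts_mset A N = C"
proof -
  have "{i\<in>A. N i \<noteq> 0} \<subseteq> set_mset C" using assms(1) by (auto simp: not_in_iff)
  then have fin: "finite {i\<in>A. N i \<noteq> 0}" by (rule finite_subset) simp
  show ?thesis unfolding counts_mset_eq_iff[OF fin] using assms by (auto simp: not_in_iff[symmetric])
qed

text \<open>With finite support the two trees are the two marginals of a single counting multiset,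
  the form that \<open>emeasure_distr_counts\<close> expects.\<close>

lemma corr_pair_eq:
  assumes fin: "finite {i\<in>cidx_set d. F i \<noteq> 0}"
  defines "C \<equiv> counts_mset (cidx_set d) F"
  shows "corr_pair d F = (Node (visible left_type C), Node (visible right_type C))"
proof -
  have C: "count C i = (if i \<in> cidx_set d then F i else 0)" for i
    unfolding C_def by (rule count_counts_mset[OF fin])
  have idx: "Inl x \<in> cidx_set d \<longleftrightarrow> x \<in> X d" "Inr (Inl x) \<in> cidx_set d \<longleftrightarrow> x \<in> X d"
    "Inr (Inr (x, y)) \<in> cidx_set d \<longleftrightarrow> x \<in> X d \<and> y \<in> X d" for x y
    by (auto simp: cidx_set_def)
  have set1: "set_mset (visible left_type C) \<subseteq> X d" and set2: "set_mset (visible right_type C) \<subseteq> X d"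
  proof (safe)
    fix x assume x: "x \<in># visible left_type C"
    show "x \<in> X d"
    proof (rule ccontr)
      assume "x \<notin> X d"
      then have "count (visible left_type C) x = 0"
        unfolding count_visible_left C by (simp add: idx)
      then show False using x by (simp add: not_in_iff[symmetric])
    qed
  next
    fix x assume x: "x \<in># visible right_type C"
    show "x \<in> X d"
    proof (rule ccontr)
      assume "x \<notin> X d"
      then have "count (visible right_type C) x = 0"
        unfolding count_visible_right C by (simp add: idx)
      then show False using x by (simp add: not_in_iff[symmetric])
    qed
  qed
  have "tree_of_counts (X d) (\<lambda>\<tau>. F (Inl \<tau>) + (\<Sum>\<tau>'\<in>{\<tau>'\<in>X d. F (Inr (Inr (\<tau>, \<tau>'))) \<noteq> 0}. F (Inr (Inr (\<tau>, \<tau>')))))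
    = Node (visible left_type C)"
    unfolding tree_of_counts_eq
  proof (intro arg_cong[of _ _ Node] counts_mset_eqI set1)
    fix x assume x: "x \<in> X d"
    have "{y. count C (Inr (Inr (x, y))) \<noteq> 0} = {y\<in>X d. F (Inr (Inr (x, y))) \<noteq> 0}"
      using x by (auto simp: C idx)
    then show "F (Inl x) + (\<Sum>y\<in>{y\<in>X d. F (Inr (Inr (x, y))) \<noteq> 0}. F (Inr (Inr (x, y)))) = count (visible left_type C) x"
      unfolding count_visible_left using x by (simp add: C idx)
  qed
  moreover have "tree_of_counts (X d) (\<lambda>\<tau>'. F (Inr (Inl \<tau>')) + (\<Sum>\<tau>\<in>{\<tau>\<in>X d. F (Inr (Inr (\<tau>, \<tau>'))) \<noteq> 0}. F (Inr (Inr (\<tau>, \<tau>')))))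
    = Node (visible right_type C)"
    unfolding tree_of_counts_eq
  proof (intro arg_cong[of _ _ Node] counts_mset_eqI set2)
    fix y assume y: "y \<in> X d"
    have "{x. count C (Inr (Inr (x, y))) \<noteq> 0} = {x\<in>X d. F (Inr (Inr (x, y))) \<noteq> 0}"
      using y by (auto simp: C idx)
    then show "F (Inr (Inl y)) + (\<Sum>x\<in>{x\<in>X d. F (Inr (Inr (x, y))) \<noteq> 0}. F (Inr (Inr (x, y)))) = count (visible right_type C) y"
      unfolding count_visible_right using y by (simp add: C idx)
  qed
  ultimately show ?thesis by (simp add: corr_pair_def)
qed

section \<open>Exchanging the two trees\<close>

fun swap_type :: "'a + 'a + 'a \<times> 'a \<Rightarrow> 'a + 'a + 'a \<times> 'a" where
  "swap_type (Inl x) = Inr (Inl x)"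
| "swap_type (Inr (Inl y)) = Inl y"
| "swap_type (Inr (Inr z)) = Inr (Inr (snd z, fst z))"

lemma swap_type_swap_type [simp]: "swap_type (swap_type i) = i"
  by (cases i rule: swap_type.cases) auto

lemma type_swap_type [simp]: "left_type (swap_type i) = right_type i" "right_type (swap_type i) = left_type i"
  by (cases i rule: swap_type.cases; simp)+

lemma poisson_weight_image_mset:
  assumes "inj f"
  shows "poisson_weight L r (image_mset f C) = poisson_weight L (\<lambda>i. r (f i)) C"
proof -
  have cnt: "count (image_mset f C) (f i) = count C i" for i
    using assms by (induction C) (auto dest: injD)
  have inj: "inj_on f (set_mset C)" using assms by (rule inj_on_subset) simp
  have "(\<Prod>j\<in>set_mset (image_mset f C). fact (count (image_mset f C) j)) = (\<Prod>i\<in>set_mset C. fact (count C i) :: real)"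
    by (simp only: set_image_mset prod.reindex[OF inj] o_def cnt)
  then show ?thesis
    unfolding poisson_weight_def by (simp add: image_mset.compositionality o_def)
qed

text \<open>Swapping the trees relabels the indices and preserves the rates. Symmetry converts row
  bounds into column bounds and identifies the second moment with a trace.\<close>

lemma (in particles) new_P_commute:
  assumes "\<And>x y. P x y = P y x"
  shows "new_P M M' = new_P M' M"
proof -
  let ?f = "\<lambda>M M' C. if visible left_type C = M \<and> visible right_type C = M'
     then ennreal (poisson_weight (lam * (2 - s)) pair_rate C) else 0"
  have rate: "pair_rate (swap_type i) = pair_rate i" for i
    by (cases i rule: swap_type.cases) (auto simp: pair_rate_def split_beta assms)
  have inj: "inj (swap_type :: 'a + 'a + 'a \<times> 'a \<Rightarrow> _)" by (metis injI swap_type_swap_type)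
  have bij: "bij (image_mset (swap_type :: 'a + 'a + 'a \<times> 'a \<Rightarrow> _))"
    by (rule o_bij[where g = "image_mset swap_type"]) (simp_all add: fun_eq_iff image_mset.compositionality o_def)
  have "new_P M M' = (\<Sum>\<^sup>+C. ?f M M' (image_mset swap_type C))"
    unfolding new_P_def by (rule tsum_bij[OF bij, symmetric])
  also have "\<dots> = new_P M' M"
    unfolding new_P_def poisson_weight_image_mset[OF inj] rate
    by (intro nn_integral_cong) (auto simp: visible_def image_mset.compositionality o_def)
  finally show ?thesis .
qed

section \<open>Induction over the depth\<close>

lemma inj_children: "inj children"
  by (rule injI) (metis children.simps utree.exhaust)

text \<open>The trace bounds are needed for all positive \<open>m\<close> together, since exponent
  \<open>m\<close> at the next depth uses all multiples of \<open>m\<close> at this one.\<close>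

definition tree_invariant :: "real \<Rightarrow> real \<Rightarrow> nat \<Rightarrow> bool" where
  "tree_invariant lam s d \<longleftrightarrow> particles (gw lam d) (corr lam s d) s lam \<and>
     (\<forall>t t'. corr lam s d t t' = corr lam s d t' t) \<and>
     (\<forall>m>0. ktrace (kpow (\<lambda>t t'. ennreal (corr lam s d t t' / gw lam d t)) m) \<le> otter_series (ennreal (s ^ m)))"

lemma tree_invariant_0:
  assumes "0 < lam" "0 \<le> s" "s \<le> 1"
  shows "tree_invariant lam s 0"
proof -
  have g: "gw lam 0 t = (if t = leaf then 1 else 0)" for t
    by (simp add: measure_return indicator_def)
  have c: "corr lam s 0 t t' = (if t = leaf then if t' = leaf then 1 else 0 else 0)" for t t'
    by (simp add: measure_return indicator_def)
  have row: "(\<Sum>\<^sup>+t'. ennreal (corr lam s 0 t t')) \<le> ennreal (gw lam 0 t)" for t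
  proof -
    have "(\<Sum>\<^sup>+t'. ennreal (corr lam s 0 t t')) = (\<Sum>\<^sup>+t'. if t' = leaf then (if t = leaf then 1 else 0) else 0)"
      unfolding c by (intro nn_integral_cong) auto
    then show ?thesis unfolding g by simp
  qed
  have sym: "corr lam s 0 t t' = corr lam s 0 t' t" for t t' unfolding c by auto
  have "particles (gw lam 0) (corr lam s 0) s lam"
    using assms row row[unfolded sym] gw_sum[of lam 0] by unfold_locales simp_all
  moreover have "ktrace (kpow (\<lambda>t t'. ennreal (corr lam s 0 t t' / gw lam 0 t)) m) \<le> otter_series (ennreal (s ^ m))" if "0 < m" for m
  proof -
    have "(\<lambda>t t'. ennreal (corr lam s 0 t t' / gw lam 0 t)) = diagk (\<lambda>t. if t = leaf then 1 else 0)"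
      unfolding c g diagk_def by (intro ext) auto
    then have "ktrace (kpow (\<lambda>t t'. ennreal (corr lam s 0 t t' / gw lam 0 t)) m) = (\<Sum>\<^sup>+t. (if t = leaf then 1 else 0) ^ m)"
      by (simp only: kpow_diagk ktrace_def diagk_def simp_thms if_True)
    \<comment> \<open>Positivity of \<open>m\<close> matters: \<open>0 ^ 0 = 1\<close> would let
      every tree contribute.\<close>
    also have "\<dots> = (\<Sum>\<^sup>+t. if t = leaf then 1 else 0)"
      using that by (intro nn_integral_cong) (auto simp: power_0_left)
    \<comment> \<open>The exponent is 0, so the single-node tree alone supplies the value 1, even
      for \<open>s = 0\<close>.\<close>
    also have "\<dots> = ennreal (s ^ m) ^ (nodes leaf - 1)" by simp
    also have "\<dots> \<le> otter_series (ennreal (s ^ m))"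
      unfolding otter_series_def by (rule tsum_ge)
    finally show ?thesis .
  qed
  ultimately show ?thesis unfolding tree_invariant_def using sym by blast
qed

lemma corr_Suc:
  assumes lam: "0 < lam" and inv: "particles (gw lam d) (corr lam s d) s lam"
  shows "ennreal (corr lam s (Suc d) (Node M) (Node M')) = particles.new_P (gw lam d) (corr lam s d) s lam M M'"
proof -
  interpret particles "gw lam d" "corr lam s d" s lam by fact
  have le: "corr lam s d x y \<le> gw lam d y" for x y
  proof -
    have "ennreal (corr lam s d x y) \<le> ennreal (gw lam d y)"
      using tsum_ge[of "\<lambda>x. ennreal (corr lam s d x y)" x] col[of y] by (rule order_trans)
    then show ?thesis by (simp add: ennreal_le_iff)
  qed
  have s': "0 \<le> 1 - s" using s by simp
  interpret poisson_family "cidx_set d" pair_rate "lam * (2 - s)"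
  proof
    show "0 \<le> pair_rate i" for i by (rule pair_rate_nonneg)
    show "0 \<le> lam * (2 - s)" using lam s by simp
    show "pair_rate i = 0" if i: "i \<notin> cidx_set d" for i
    proof (cases i rule: left_type.cases)
      case (1 x)
      then have "x \<notin> X d" using i by (auto simp: cidx_set_def)
      then show ?thesis using 1 gw_outside[OF lam] by (simp add: pair_rate_def)
    next
      case (2 x)
      then have "x \<notin> X d" using i by (auto simp: cidx_set_def)
      then show ?thesis using 2 gw_outside[OF lam] by (simp add: pair_rate_def)
    next
      case (3 z)
      then have "fst z \<notin> X d \<or> snd z \<notin> X d" using i by (auto simp: cidx_set_def image_iff mem_Times_iff)
      \<comment> \<open>An entry is bounded by both marginals, so it vanishes as soon as one of the
        two trees lies outside \<open>X d\<close>.\<close>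
      then have "corr lam s d (fst z) (snd z) = 0"
        using gw_outside[OF lam] P_le_p[of "fst z" "snd z"] le[of "fst z" "snd z"]
        by (metis P_nonneg order_antisym)
      then show ?thesis using 3 by (simp add: pair_rate_def split_beta)
    qed
    have c: "(\<Sum>\<^sup>+z. ennreal (corr lam s d (fst z) (snd z))) = 1"
      using corr_sum[of lam s d] unfolding tsum_pair[of "\<lambda>t t'. ennreal (corr lam s d t t')"] .
    have "(\<Sum>\<^sup>+i. ennreal (pair_rate i)) = (\<Sum>\<^sup>+x. ennreal (lam * (1 - s)) * ennreal (gw lam d x)) +
        ((\<Sum>\<^sup>+x. ennreal (lam * (1 - s)) * ennreal (gw lam d x)) +
         (\<Sum>\<^sup>+z. ennreal (lam * s) * ennreal (corr lam s d (fst z) (snd z))))"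
      unfolding tsum_plus[of "\<lambda>i. ennreal (pair_rate i)"] tsum_plus[of "\<lambda>i. ennreal (pair_rate (Inr i))"]
      using lam s s' by (simp add: pair_rate_def split_beta ennreal_mult)
    also have "\<dots> = ennreal (lam * (1 - s)) + (ennreal (lam * (1 - s)) + ennreal (lam * s))"
      unfolding tsum_cmult gw_sum c by simp
    also have "\<dots> = ennreal (lam * (1 - s) + (lam * (1 - s) + lam * s))"
    proof -
      have "0 \<le> lam * (1 - s)" "0 \<le> lam * s" using lam s by simp_all
      then show ?thesis by (simp only: ennreal_plus add_nonneg_nonneg)
    qed
    also have "lam * (1 - s) + (lam * (1 - s) + lam * s) = lam * (2 - s)" by (simp add: algebra_simps)
    finally show "(\<Sum>\<^sup>+i. ennreal (pair_rate i)) = ennreal (lam * (2 - s))" .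
  qed
  interpret C: prob_space "Pcorr lam s (Suc d)" by (rule prob_space_Pcorr)
  have rate: "(case i of
        Inl \<tau> \<Rightarrow> lam * (1 - s) * measure (GW lam d) {\<tau>}
      | Inr (Inl \<tau>') \<Rightarrow> lam * (1 - s) * measure (GW lam d) {\<tau>'}
      | Inr (Inr p) \<Rightarrow> lam * s * measure (Pcorr lam s d) {p}) = pair_rate i" for i
    by (cases i rule: left_type.cases) (simp_all add: pair_rate_def split_beta)
  have "ennreal (corr lam s (Suc d) (Node M) (Node M')) = emeasure (Pcorr lam s (Suc d)) {(Node M, Node M')}"
    by (simp only: C.emeasure_eq_measure)
  also have "\<dots> = (\<Sum>\<^sup>+C. if (Node (visible left_type C), Node (visible right_type C)) = (Node M, Node M')
      then ennreal (poisson_weight (lam * (2 - s)) pair_rate C) else 0)"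
    unfolding Pcorr.simps rate
    by (rule emeasure_distr_counts)
      (intro measurable_corr_pair measurable_PiM_pois, assumption, rule corr_pair_eq)
  also have "\<dots> = new_P M M'" unfolding new_P_def by simp
  finally show ?thesis .
qed

lemma tree_invariant_Suc:
  assumes lam: "0 < lam" and inv: "tree_invariant lam s d"
  shows "tree_invariant lam s (Suc d)"
proof -
  have sym: "corr lam s d t t' = corr lam s d t' t" for t t' using inv by (simp add: tree_invariant_def)
  interpret particles "gw lam d" "corr lam s d" s lam using inv by (simp add: tree_invariant_def)
  have tr: "ktrace (kpow K m) \<le> otter_series (ennreal (s ^ m))" if "0 < m" for m
    using inv that unfolding tree_invariant_def K_def[abs_def] by blast
  have p: "gw lam (Suc d) t = new_p (children t)" for t
    unfolding new_p_def using gw_Suc[OF lam, of d "children t"] by (cases t) (simp del: GW.simps)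
  have P: "ennreal (corr lam s (Suc d) t t') = new_P (children t) (children t')" for t t'
    using corr_Suc[OF lam particles_axioms, of "children t" "children t'"]
    by (cases t; cases t') (simp del: Pcorr.simps)
  have sym': "corr lam s (Suc d) t t' = corr lam s (Suc d) t' t" for t t'
  proof -
    have "ennreal (corr lam s (Suc d) t t') = ennreal (corr lam s (Suc d) t' t)"
      unfolding P by (rule new_P_commute[OF sym])
    then show ?thesis by (simp del: Pcorr.simps)
  qed
  have row': "(\<Sum>\<^sup>+t'. ennreal (corr lam s (Suc d) t t')) \<le> ennreal (gw lam (Suc d) t)" for t
  proof -
    have "(\<Sum>\<^sup>+t'. ennreal (corr lam s (Suc d) t t')) \<le> (\<Sum>\<^sup>+M'. new_P (children t) M')"
      unfolding P by (rule tsum_inj_le[OF inj_children, of "\<lambda>M'. new_P (children t) M'"])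
    also have "\<dots> \<le> ennreal (gw lam (Suc d) t)" unfolding p by (rule new_row)
    finally show ?thesis .
  qed
  have col': "(\<Sum>\<^sup>+t. ennreal (corr lam s (Suc d) t t')) \<le> ennreal (gw lam (Suc d) t')" for t'
    using row'[of t'] unfolding sym'[of t'] .
  have "particles (gw lam (Suc d)) (corr lam s (Suc d)) s lam"
    using lam s row' col' gw_sum[of lam "Suc d"] by unfold_locales (simp_all del: GW.simps Pcorr.simps)
  moreover have "ktrace (kpow (\<lambda>t t'. ennreal (corr lam s (Suc d) t t' / gw lam (Suc d) t)) m) \<le> otter_series (ennreal (s ^ m))"
    if m: "0 < m" for m
  proof -
    let ?K = "\<lambda>M M'. ennreal (1 / new_p M) * new_P M M'"
    have "ennreal (corr lam s (Suc d) t t' / gw lam (Suc d) t) = ?K (children t) (children t')" for t t'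
      unfolding P[symmetric] p[symmetric]
      by (subst ennreal_mult[symmetric]) (simp_all del: GW.simps Pcorr.simps)
    then have "ktrace (kpow (\<lambda>t t'. ennreal (corr lam s (Suc d) t t' / gw lam (Suc d) t)) m)
      \<le> (\<Sum>\<^sup>+t. kpow ?K m (children t) (children t))"
      unfolding ktrace_def by (simp only:) (intro tsum_mono kpow_inj_le inj_children)
    also have "\<dots> \<le> ktrace (kpow ?K m)"
      unfolding ktrace_def by (rule tsum_inj_le[OF inj_children, of "\<lambda>M. kpow ?K m M M"])
    \<comment> \<open>The abstract weights become \<open>\<theta> g = s ^ nodes g\<close>: the
      factor \<open>s ^ j\<close> of a kept slot raises the exponent \<open>nodes g - 1\<close> of
      the series to \<open>nodes g\<close>.\<close>
    also have "\<dots> \<le> (\<Sum>\<^sup>+M. prod_mset (image_mset (\<lambda>g. (ennreal s ^ nodes g) ^ m) M))"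
    proof (rule new_ktrace[OF _ m])
      fix j :: nat assume "0 < j"
      have "ennreal (s ^ j) * ktrace (kpow K j) \<le> ennreal (s ^ j) * otter_series (ennreal (s ^ j))"
        by (intro mult_left_mono tr \<open>0 < j\<close>) simp
      also have "\<dots> = (\<Sum>\<^sup>+g. ennreal (s ^ j) ^ nodes g)" by (rule tsum_power_nodes[symmetric])
      also have "\<dots> = (\<Sum>\<^sup>+g. (ennreal s ^ nodes g) ^ j)"
        using s by (simp add: ennreal_power[symmetric] power_mult[symmetric] mult.commute)
      finally show "ennreal (s ^ j) * ktrace (kpow K j) \<le> (\<Sum>\<^sup>+g. (ennreal s ^ nodes g) ^ j)" .
    qed
    \<comment> \<open>A multiset of trees is again a tree, so the bound has the same form as at the
      previous depth.\<close>
    also have "\<dots> = otter_series (ennreal (s ^ m))"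
      unfolding otter_series_eq_multisets
      using s by (simp add: ennreal_power[symmetric] power_mult[symmetric] mult.commute)
    finally show ?thesis .
  qed
  ultimately show ?thesis unfolding tree_invariant_def using sym' by blast
qed

lemma tree_invariant: "0 < lam \<Longrightarrow> 0 \<le> s \<Longrightarrow> s \<le> 1 \<Longrightarrow> tree_invariant lam s d"
  by (induction d) (auto intro: tree_invariant_0 tree_invariant_Suc)

section \<open>From the second moment to the KL divergence and to tests\<close>

lemma prob_space_Pnull: "prob_space (Pnull lam d)"
proof -
  interpret prob_space "GW lam d" by (rule prob_space_GW)
  interpret pair_prob_space "GW lam d" "GW lam d" ..
  show ?thesis unfolding Pnull_def by (rule P.prob_space_axioms)
qed

lemma sets_Pnull: "sets (Pnull lam d) = UNIV"
proof -
  have "sets (Pnull lam d) = sets (count_space UNIV \<Otimes>\<^sub>M (count_space UNIV :: utree measure))"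
    unfolding Pnull_def by (rule sets_pair_measure_cong) simp_all
  also have "\<dots> = UNIV" by (subst pair_measure_countable) simp_all
  finally show ?thesis .
qed

lemma measure_Pnull_singleton: "measure (Pnull lam d) {(t, t')} = gw lam d t * gw lam d t'"
proof -
  interpret prob_space "GW lam d" by (rule prob_space_GW)
  have "emeasure (Pnull lam d) ({t} \<times> {t'}) = emeasure (GW lam d) {t} * emeasure (GW lam d) {t'}"
    unfolding Pnull_def by (rule emeasure_pair_measure_Times) simp_all
  then have "measure (Pnull lam d) ({t} \<times> {t'}) = gw lam d t * gw lam d t'"
    by (simp add: measure_def enn2real_mult)
  then show ?thesis by simp
qed

lemma chi_square_le:
  assumes "0 < lam" "0 \<le> s" "s \<le> 1"
  shows "(\<Sum>\<^sup>+z. ennreal ((measure (Pcorr lam s d) {z})\<^sup>2 / measure (Pnull lam d) {z})) \<le> otter_series (ennreal (s\<^sup>2))"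
proof -
  note inv = tree_invariant[OF assms, of d, unfolded tree_invariant_def]
  let ?K = "\<lambda>t t'. ennreal (corr lam s d t t' / gw lam d t)"
  have "(\<Sum>\<^sup>+z. ennreal ((measure (Pcorr lam s d) {z})\<^sup>2 / measure (Pnull lam d) {z}))
    = (\<Sum>\<^sup>+t. \<Sum>\<^sup>+t'. ennreal ((corr lam s d t t')\<^sup>2 / (gw lam d t * gw lam d t')))"
    unfolding tsum_pair by (intro nn_integral_cong) (metis measure_Pnull_singleton prod.collapse)
  also have "\<dots> = (\<Sum>\<^sup>+t. \<Sum>\<^sup>+t'. ?K t t' * ?K t' t)"
  proof (intro nn_integral_cong)
    fix t t'
    have "corr lam s d t' t = corr lam s d t t'" using inv by blast
    then show "ennreal ((corr lam s d t t')\<^sup>2 / (gw lam d t * gw lam d t')) = ?K t t' * ?K t' t"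
      by (simp add: ennreal_mult[symmetric] power2_eq_square)
  qed
  also have "\<dots> = ktrace (kpow ?K (Suc (Suc 0)))"
    unfolding ktrace_def kpow.simps kcomp_id_right kcomp_def ..
  also have "\<dots> \<le> otter_series (ennreal (s ^ Suc (Suc 0)))" using inv by blast
  finally show ?thesis by (simp add: power2_eq_square)
qed

text \<open>By the row bound and symmetry, a joint mass is at most either marginal mass; a null
  product has a null factor.\<close>

lemma Pcorr_absolutely_continuous:
  assumes "0 < lam" "0 \<le> s" "s \<le> 1" "measure (Pnull lam d) {z} = 0"
  shows "measure (Pcorr lam s d) {z} = 0"
proof -
  obtain t t' where z: "z = (t, t')" by (cases z)
  interpret particles "gw lam d" "corr lam s d" s lam
    using tree_invariant[OF assms(1-3), of d] by (simp add: tree_invariant_def)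
  have sym: "corr lam s d t t' = corr lam s d t' t"
    using tree_invariant[OF assms(1-3), of d] by (simp add: tree_invariant_def)
  have "gw lam d t = 0 \<or> gw lam d t' = 0" using assms(4) unfolding z measure_Pnull_singleton by simp
  then show ?thesis
    unfolding z using P_le_p[of t t'] P_le_p[of t' t] sym by (metis P_nonneg order_antisym)
qed

lemma infsum_le_tsum:
  fixes f :: "'a \<Rightarrow> ennreal"
  assumes "\<And>x. f x \<le> g x"
  shows "infsum f S \<le> (\<Sum>\<^sup>+x. g x)"
proof (rule infsum_le_finite_sums)
  show "f summable_on S" by (rule nonneg_summable_on_complete) simp
  fix F assume "finite F" "F \<subseteq> S"
  have "sum f F \<le> sum g F" by (intro sum_mono assms)
  also have "\<dots> = (\<Sum>\<^sup>+x. if x \<in> F then g x else 0)" using \<open>finite F\<close> by (rule tsum_if_finite[symmetric])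
  also have "\<dots> \<le> (\<Sum>\<^sup>+x. g x)" by (intro tsum_mono) auto
  finally show "sum f F \<le> (\<Sum>\<^sup>+x. g x)" .
qed

text \<open>For the likelihood ratio \<open>r\<close>, the positive part \<open>max 0 (ln r)\<close>
  is at most \<open>r\<close>, and subtracting the negative part only lowers the value. Absolute
  continuity excludes the infinite branch.\<close>

lemma KL_le_chi_square:
  assumes "\<And>z. measure Q {z} = 0 \<Longrightarrow> measure P {z} = 0"
  shows "KL P Q \<le> enn2ereal (\<Sum>\<^sup>+z. ennreal ((measure P {z})\<^sup>2 / measure Q {z}))"
proof -
  have "measure P {z} * max 0 (ln (measure P {z} / measure Q {z})) \<le> (measure P {z})\<^sup>2 / measure Q {z}" for z
  proof (cases "measure P {z} = 0")
    case False
    then have pos: "0 < measure P {z}" "0 < measure Q {z}"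
      using assms[of z] by (auto simp: zero_less_measure_iff)
    have "max 0 (ln (measure P {z} / measure Q {z})) \<le> measure P {z} / measure Q {z}"
      using ln_le_minus_one[of "measure P {z} / measure Q {z}"] pos by auto
    then have "measure P {z} * max 0 (ln (measure P {z} / measure Q {z})) \<le> measure P {z} * (measure P {z} / measure Q {z})"
      using pos by (intro mult_left_mono) auto
    then show ?thesis by (simp add: power2_eq_square)
  qed simp
  then have "(\<Sum>\<^sub>\<infinity>z\<in>{z. measure P {z} > 0}. ennreal (measure P {z} * max 0 (ln (measure P {z} / measure Q {z}))))
    \<le> (\<Sum>\<^sup>+z. ennreal ((measure P {z})\<^sup>2 / measure Q {z}))"
    by (intro infsum_le_tsum ennreal_leI)
  moreover have "\<not> (\<exists>z\<in>{z. measure P {z} > 0}. measure Q {z} = 0)" using assms by force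
  ultimately show ?thesis
    unfolding KL_def Let_def by (simp add: ereal_diff_le_mono_left less_eq_ennreal.rep_eq)
qed

text \<open>Truncation of the likelihood ratio at \<open>1 / \<delta>\<close>: below this level
  \<open>P\<close> is at most \<open>Q / \<delta>\<close>, above it at most \<delta> times the
  second moment density \<open>P\<^sup>2 / Q\<close>.\<close>

lemma measure_le_chi_square:
  fixes P Q :: "'a :: countable measure"
  assumes "finite_measure P" "sets P = UNIV" "finite_measure Q" "sets Q = UNIV"
    and ac: "\<And>z. measure Q {z} = 0 \<Longrightarrow> measure P {z} = 0" and "0 < \<delta>"
    and C: "(\<Sum>\<^sup>+z. ennreal ((measure P {z})\<^sup>2 / measure Q {z})) \<le> ennreal C" "0 \<le> C"
  shows "measure P A \<le> \<delta> * C + measure Q A / \<delta>"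
proof -
  interpret P: finite_measure P by fact
  interpret Q: finite_measure Q by fact
  have le: "measure P {z} \<le> \<delta> * ((measure P {z})\<^sup>2 / measure Q {z}) + measure Q {z} / \<delta>" for z
  proof (cases "measure P {z} \<le> measure Q {z} / \<delta>")
    case True
    moreover have "0 \<le> \<delta> * ((measure P {z})\<^sup>2 / measure Q {z})" using \<open>0 < \<delta>\<close> by simp
    ultimately show ?thesis by linarith
  next
    case False
    then have "measure P {z} \<noteq> 0" using \<open>0 < \<delta>\<close> by (auto simp: not_le divide_less_0_iff not_less)
    then have pos: "0 < measure P {z}" "0 < measure Q {z}"
      using ac[of z] by (auto simp: zero_less_measure_iff)
    have "measure Q {z} \<le> \<delta> * measure P {z}" using False \<open>0 < \<delta>\<close> by (simp add: field_simps)
    then have "measure P {z} * measure Q {z} \<le> measure P {z} * (\<delta> * measure P {z})"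
      using pos by (intro mult_left_mono) auto
    then have "measure P {z} \<le> \<delta> * ((measure P {z})\<^sup>2 / measure Q {z})"
      using pos by (simp add: field_simps power2_eq_square)
    moreover have "0 \<le> measure Q {z} / \<delta>" using \<open>0 < \<delta>\<close> by simp
    ultimately show ?thesis by linarith
  qed
  have "ennreal (measure P A) = (\<Sum>\<^sup>+z. ennreal (measure P {z}) * indicator A z)"
    using tsum_measure_singleton[OF assms(1,2), of A] by (simp add: P.emeasure_eq_measure)
  also have "\<dots> \<le> (\<Sum>\<^sup>+z. ennreal \<delta> * ennreal ((measure P {z})\<^sup>2 / measure Q {z}) + ennreal (1 / \<delta>) * (ennreal (measure Q {z}) * indicator A z))"
  proof (intro tsum_mono)
    fix z
    have "ennreal (measure P {z}) \<le> ennreal (\<delta> * ((measure P {z})\<^sup>2 / measure Q {z}) + 1 / \<delta> * measure Q {z})"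
      using le[of z] by (intro ennreal_leI) simp
    also have "\<dots> = ennreal \<delta> * ennreal ((measure P {z})\<^sup>2 / measure Q {z}) + ennreal (1 / \<delta>) * ennreal (measure Q {z})"
    proof -
      have "0 \<le> \<delta>" "0 \<le> 1 / \<delta>" "0 \<le> (measure P {z})\<^sup>2 / measure Q {z}" "0 \<le> measure Q {z}"
        using \<open>0 < \<delta>\<close> by simp_all
      then show ?thesis by (simp only: ennreal_plus ennreal_mult mult_nonneg_nonneg)
    qed
    finally show "ennreal (measure P {z}) * indicator A z \<le>
      ennreal \<delta> * ennreal ((measure P {z})\<^sup>2 / measure Q {z}) + ennreal (1 / \<delta>) * (ennreal (measure Q {z}) * indicator A z)"
      by (auto split: split_indicator)
  qed
  also have "\<dots> = ennreal \<delta> * (\<Sum>\<^sup>+z. ennreal ((measure P {z})\<^sup>2 / measure Q {z})) + ennreal (1 / \<delta>) * ennreal (measure Q A)"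
    unfolding tsum_add tsum_cmult tsum_measure_singleton[OF assms(3,4), symmetric] Q.emeasure_eq_measure ..
  also have "\<dots> \<le> ennreal \<delta> * ennreal C + ennreal (1 / \<delta>) * ennreal (measure Q A)"
    by (intro add_mono mult_left_mono C order_refl) simp
  also have "\<dots> = ennreal (\<delta> * C + measure Q A / \<delta>)"
    using \<open>0 < \<delta>\<close> C(2) by (simp add: ennreal_mult[symmetric] ennreal_plus[symmetric] del: ennreal_plus)
  finally show ?thesis using \<open>0 < \<delta>\<close> C(2) by (subst (asm) ennreal_le_iff) auto
qed

theorem theorem2:
  fixes s :: real
  assumes "0 \<le> s" and "s \<le> 1" and "s \<le> sqrt otter_alpha"
  shows "(\<forall>lam>0. limsup (\<lambda>d. KL (Pcorr lam s d) (Pnull lam d)) < \<infinity>)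
       \<and> (\<forall>lam>0. \<not> (\<exists>T. one_sided_test lam s T))"
proof (intro conjI allI impI notI)
  \<comment> \<open>The constant is fixed before \<open>lam\<close> and \<open>d\<close>, so one
    bound serves all of them.\<close>
  obtain C where C: "otter_series (ennreal (s\<^sup>2)) = ennreal C" "0 \<le> C"
    using otter_series_finite[OF assms(1,3)] by (cases "otter_series (ennreal (s\<^sup>2))") auto
  {
    fix lam :: real assume lam: "0 < lam"
    have "limsup (\<lambda>d. KL (Pcorr lam s d) (Pnull lam d)) \<le> ereal C"
    proof (rule Limsup_bounded, rule always_eventually, rule allI)
      fix d
      have "KL (Pcorr lam s d) (Pnull lam d) \<le>
          enn2ereal (\<Sum>\<^sup>+z. ennreal ((measure (Pcorr lam s d) {z})\<^sup>2 / measure (Pnull lam d) {z}))"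
        using Pcorr_absolutely_continuous[OF lam assms(1,2)] by (rule KL_le_chi_square)
      also have "\<dots> \<le> enn2ereal (ennreal C)"
        using chi_square_le[OF lam assms(1,2), of d] unfolding C(1) by (simp only: less_eq_ennreal.rep_eq)
      finally show "KL (Pcorr lam s d) (Pnull lam d) \<le> ereal C" using C(2) by (simp add: enn2ereal_ennreal)
    qed
    then show "limsup (\<lambda>d. KL (Pcorr lam s d) (Pnull lam d)) < \<infinity>"
      by (rule le_less_trans) simp
  next
    fix lam :: real assume lam: "0 < lam" and "\<exists>T. one_sided_test lam s T"
    then obtain T where null: "(\<lambda>d. measure (Pnull lam d) {x. T d x}) \<longlonglongrightarrow> 0"
      and power: "liminf (\<lambda>d. ereal (measure (Pcorr lam s d) {x. T d x})) > 0"
      by (auto simp: one_sided_test_def)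
    obtain c where c: "0 < ereal c" "ereal c < liminf (\<lambda>d. ereal (measure (Pcorr lam s d) {x. T d x}))"
      using ereal_dense2[OF power] by blast
    \<comment> \<open>Chosen so that \<open>\<delta> * C\<close> is at most \<open>c / 2\<close>;
      the summand 1 keeps \<delta> well defined for \<open>C = 0\<close>. A null probability below
      \<open>\<delta> * (c / 2)\<close> then bounds the other term by \<open>c / 2\<close>,
      contradicting power above \<open>c\<close>.\<close>
    define \<delta> where "\<delta> = c / (2 * (C + 1))"
    have \<delta>: "0 < \<delta>" "\<delta> * C \<le> c / 2" using c(1) C(2) by (auto simp: \<delta>_def field_simps)
    have "eventually (\<lambda>d. ereal c < ereal (measure (Pcorr lam s d) {x. T d x})) sequentially"
      using c(2) by (rule less_LiminfD)
    moreover have "eventually (\<lambda>d. measure (Pnull lam d) {x. T d x} < \<delta> * (c / 2)) sequentially"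
      using null \<delta>(1) c(1) by (intro order_tendstoD(2)) auto
    ultimately have "eventually (\<lambda>d::nat. False) sequentially"
    proof eventually_elim
      case (elim d)
      have "measure (Pcorr lam s d) {x. T d x} \<le> \<delta> * C + measure (Pnull lam d) {x. T d x} / \<delta>"
        using prob_space_Pcorr[of lam s d] prob_space_Pnull[of lam d] Pcorr_absolutely_continuous[OF lam assms(1,2)]
          chi_square_le[OF lam assms(1,2), of d] \<delta>(1) C
        by (intro measure_le_chi_square) (auto simp: sets_Pnull prob_space_def)
      moreover have "measure (Pnull lam d) {x. T d x} / \<delta> < c / 2"
        using elim(2) \<delta>(1) by (simp add: field_simps)
      moreover have "c < measure (Pcorr lam s d) {x. T d x}" using elim(1) by (simp only: less_ereal.simps)
      ultimately show False using \<delta>(2) by linarith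
    qed
    then show False by simp
  }
qed

end
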